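(* Let $a\ge1$. The universal weight function $W(t_1,\dots,t_a)=P(f_\alpha(t_1)\cdots f_\alpha(t_a))$ of $U_q(\widehat{\mathfrak{sl}}_2)$ has the following descriptions (identities of series in the domain $|t_1|\gg\cdots\gg|t_a|$). (i) $$P\big(f_\alpha(t_1)\cdots f_\alpha(t_a)\big)=\prod_{1\le i<j\le a}\frac{q^{-1}t_i-qt_j}{qt_i-q^{-1}t_j}\ f^+_\alpha(t_a)\,f^+_\alpha(t_{a-1};t_a)\cdots f^+_\alpha(t_1;t_2,\dots,t_a).$$ (ii) $$P\big(f_\alpha(t_1)\cdots f_\alpha(t_a)\big)=\prod_{1\le i<j\le a}\frac{t_i-t_j}{qt_i-q^{-1}t_j}\oint\cdots\oint Z(t_1,\dots,t_a;w_1,\dots,w_a)\,f_\alpha(w_a)\frac{dw_a}{w_a}\cdots f_\alpha(w_1)\frac{dw_1}{w_1}.$$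
   Context: Let $q\in\mathbb C^*$ be generic (not a root of unity). $U_q(\widehat{\mathfrak{sl}}_2)$ (central charge zero, no grading operator) is generated by $e_\alpha[n],f_\alpha[n]$ ($n\in\mathbb Z$), $h_\alpha[n]$ ($n\ne0$), $k_\alpha^{\pm1}$; with $e_\alpha(z)=\sum_ne_\alpha[n]z^{-n}$, $f_\alpha(z)=\sum_nf_\alpha[n]z^{-n}$, $\psi_\alpha^\pm(z)=k_\alpha^{\pm1}\exp\big(\pm(q-q^{-1})\sum_{n>0}h_\alpha[\pm n]z^{\mp n}\big)$, $\delta(z)=\sum_{k\in\mathbb Z}z^k$, the relations are $(z-q^{2}w)e_\alpha(z)e_\alpha(w)=e_\alpha(w)e_\alpha(z)(q^{2}z-w)$, $(z-q^{-2}w)f_\alpha(z)f_\alpha(w)=f_\alpha(w)f_\alpha(z)(q^{-2}z-w)$, $\psi_\alpha^\pm(z)e_\alpha(w)\psi_\alpha^\pm(z)^{-1}=\frac{q^2z-w}{z-q^2w}e_\alpha(w)$, $\psi_\alpha^\pm(z)f_\alpha(w)\psi_\alpha^\pm(z)^{-1}=\frac{q^{-2}z-w}{z-q^{-2}w}f_\alpha(w)$, the $\psi$'s commute, and $[e_\alpha(z),f_\alpha(w)]=\frac{\delta(z/w)}{q-q^{-1}}(\psi_\alpha^+(z)-\psi_\alpha^-(w))$. $U_F$ is the subalgebra generated by $k_\alpha^{\pm1}$, $f_\alpha[n]$ ($n\in\mathbb Z$), $h_\alpha[n]$ ($n>0$); $U_f^-\subset U_F$ is generated by $f_\alpha[n]$,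 $n\le0$; $U_F^+\subset U_F$ is generated by $k_\alpha^{\pm1}$, $f_\alpha[n]$, $h_\alpha[n]$, $n>0$. Multiplication $U_f^-\otimes U_F^+\to U_F$ is a linear isomorphism, and $P:U_F\to U_F^+$ is $P(f_1f_2)=\varepsilon(f_1)f_2$ for $f_1\in U_f^-$, $f_2\in U_F^+$, where $\varepsilon$ is the counit ($\varepsilon(f_\alpha[n])=\varepsilon(h_\alpha[n])=0$, $\varepsilon(k_\alpha^{\pm1})=1$). $P$ is applied coefficientwise to series. (This agrees with the analogous projection of $f_\alpha(t_1)\cdots f_\alpha(t_a)$ inside $U_q(\widehat{\mathfrak{sl}}_3)$.) $f_\alpha^+(z)=\sum_{n>0}f_\alpha[n]z^{-n}$, and $f^+_\alpha(t;t_1,\dots,t_b)=f^+_\alpha(t)-\sum_{m=1}^b\varphi_{t_m}(t;t_1,\dots,t_b)f^+_\alpha(t_m)$, where $$\varphi_{s_j}(s;s_1,\dots,s_b)=\prod_{i=1,\,i\ne j}^b\frac{s-s_i}{s_j-s_i}\ \prod_{i=1}^b\frac{q^{-1}s_j-qs_i}{q^{-1}s-qs_i}.$$ The kernel is $$Z(t_1,\dots,t_a;w_1,\dots,w_a)=\prod_{i=1}^a\frac{w_i/t_i}{1-w_i/t_i}\prod_{j=1}^{i-1}\frac{q-q^{-1}w_j/t_i}{1-w_j/t_i},$$ expanded in powers of $w_j/t_i$. $\oint g(w)\frac{dw}{w}$ is the formal integral, i.e. the coefficient $g_0$ of $g(w)=\sum_kg_kw^{-k}$. All other rational functions of the $t_i$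 are expanded in the domain $|t_1|\gg\cdots\gg|t_a|$. *)

theory Defs
  imports
    Complex_Main
    "HOL-Library.Poly_Mapping"
    "HOL-Library.Groups_Big_Fun"
    "HOL-Computational_Algebra.Formal_Power_Series"
    "HOL-Algebra.Generated_Rings"
    "HOL-Algebra.QuotRing"
    "HOL-Algebra.Algebraic_Closure_Type"
begin

unbundle fps_syntax

section \<open>The free algebra on the modes of the currents\<close>

text \<open>\<^term>\<open>H n\<close> is meant for nonzero \<^term>\<open>n\<close> only; \<^term>\<open>H 0\<close> is killed by a relator below.\<close>

datatype gen = E int | F int | H int | K | Kinv

datatype word = Word (letters: "gen list")

instantiation word :: monoid_add
begin

definition zero_word :: word where
  "zero_word = Word []"

definition plus_word :: "word \<Rightarrow> word \<Rightarrow> word" where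
  "plus_word u v = Word (letters u @ letters v)"

instance
  by standard (simp_all add: zero_word_def plus_word_def)

end

text \<open>The monoid algebra over \<open>\<complex>\<close> of the free monoid of words, that is, the free unital
  associative algebra. Its multiplication is the convolution product of \<^type>\<open>poly_mapping\<close>;
  scalars sit on the empty word.\<close>

type_synonym falg = "word \<Rightarrow>\<^sub>0 complex"

definition scal :: "complex \<Rightarrow> falg" where
  "scal c = Poly_Mapping.single 0 c"

definition gen :: "gen \<Rightarrow> falg" where
  "gen g = Poly_Mapping.single (Word [g]) 1"


section \<open>The algebra \<open>U\<^sub>q\<close>\<close>

text \<open>Exponential of a power series without constant term over a noncommutative algebra.\<close>

definition falg_exp :: "falg fps \<Rightarrow> falg fps" where
  "falg_exp A = Abs_fps (\<lambda>n. \<Sum>j\<le>n. scal (1 / fact j) * (A ^ j) $ n)"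

text \<open>The sign \<open>s = \<plusminus>1\<close> selects \<open>\<psi>\<^sup>\<plusminus>(z)\<close>, which is written as a power series in \<open>z\<^sup>-\<^sup>s\<close>.\<close>

definition psi_arg :: "complex \<Rightarrow> int \<Rightarrow> falg fps" where
  "psi_arg q s = Abs_fps (\<lambda>n. if n = 0 then 0
     else scal (of_int s * (q - 1 / q)) * gen (H (s * int n)))"

definition kpow :: "int \<Rightarrow> falg" where
  "kpow s = gen (if s = 1 then K else Kinv)"

definition psi :: "complex \<Rightarrow> int \<Rightarrow> falg fps" where
  "psi q s = fps_const (kpow s) * falg_exp (psi_arg q s)"

definition psi_inv :: "complex \<Rightarrow> int \<Rightarrow> falg fps" where
  "psi_inv q s = falg_exp (- psi_arg q s) * fps_const (kpow (- s))"

text \<open>The coefficient of \<open>z\<^sup>-\<^sup>k\<close> in \<open>\<psi>\<^sup>s(z)\<close>, for an arbitrary integer \<open>k\<close>.\<close>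

definition psi_mode :: "complex \<Rightarrow> int \<Rightarrow> int \<Rightarrow> falg" where
  "psi_mode q s k = (if s * k \<ge> 0 then psi q s $ nat (s * k) else 0)"

text \<open>\<open>(p z - w) / (z - p w) = (p - x) / (1 - p x)\<close> with \<open>x = w/z\<close>. For \<open>\<psi>\<^sup>-\<close>, a power series
  in \<open>z\<close>, the same rational function has to be expanded in \<open>x = z/w\<close>, where it
  is \<open>(p\<^sup>-\<^sup>1 - x) / (1 - p\<^sup>-\<^sup>1 x)\<close>.\<close>

definition structure_series :: "complex \<Rightarrow> complex fps" where
  "structure_series p = (fps_const p - fps_X) / (1 - fps_const p * fps_X)"

text \<open>The relators are the coefficients of the current relations. Those of the two
  quadratic relations and of the commutator relation are taken at \<open>z\<^sup>-\<^sup>m w\<^sup>-\<^sup>n\<close>; those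
  of the conjugation relations at \<open>z\<^sup>-\<^sup>s\<^sup>r w\<^sup>-\<^sup>n\<close>.\<close>

definition relators :: "complex \<Rightarrow> falg set" where
  "relators q =
     {gen (H 0), gen K * gen Kinv - 1, gen Kinv * gen K - 1}
   \<union> {(gen (E (m + 1)) * gen (E n) - scal (q ^ 2) * gen (E m) * gen (E (n + 1)))
       - (scal (q ^ 2) * gen (E n) * gen (E (m + 1)) - gen (E (n + 1)) * gen (E m)) | m n. True}
   \<union> {(gen (F (m + 1)) * gen (F n) - scal (1 / q ^ 2) * gen (F m) * gen (F (n + 1)))
       - (scal (1 / q ^ 2) * gen (F n) * gen (F (m + 1)) - gen (F (n + 1)) * gen (F m)) | m n. True}
   \<union> {(psi q s * fps_const (gen (E n)) * psi_inv q s) $ r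
       - scal (structure_series (q powi (2 * s)) $ r) * gen (E (n + s * int r))
       | s n r. s \<in> {1, -1}}
   \<union> {(psi q s * fps_const (gen (F n)) * psi_inv q s) $ r
       - scal (structure_series (q powi (- 2 * s)) $ r) * gen (F (n + s * int r))
       | s n r. s \<in> {1, -1}}
   \<union> {psi q s $ r * psi q s' $ r' - psi q s' $ r' * psi q s $ r
       | s s' r r'. s \<in> {1, -1} \<and> s' \<in> {1, -1}}
   \<union> {(gen (E m) * gen (F n) - gen (F n) * gen (E m))
       - scal (1 / (q - 1 / q)) * (psi_mode q 1 (m + n) - psi_mode q (- 1) (m + n)) | m n. True}"

definition rel_ideal :: "complex \<Rightarrow> falg set" where
  "rel_ideal q = genideal ring_of_type_algebra (relators q)"

definition Uq :: "complex \<Rightarrow> falg set ring" where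
  "Uq q = ring_of_type_algebra Quot rel_ideal q"

definition cls :: "complex \<Rightarrow> falg \<Rightarrow> falg set" where
  "cls q x = rel_ideal q +>\<^bsub>ring_of_type_algebra\<^esub> x"


section \<open>The subalgebras, the counit and the projection\<close>

text \<open>Adjoining the scalars to the generating set makes the generated subring a
  \<open>\<complex>\<close>-subalgebra.\<close>

definition subalgebra_gen :: "complex \<Rightarrow> gen set \<Rightarrow> falg set set" where
  "subalgebra_gen q G = generate_ring (Uq q) (range (\<lambda>c. cls q (scal c)) \<union> (\<lambda>g. cls q (gen g)) ` G)"

definition UF :: "complex \<Rightarrow> falg set set" where
  "UF q = subalgebra_gen q ({K, Kinv} \<union> range F \<union> {H n | n. n > 0})"

definition Uf_minus :: "complex \<Rightarrow> falg set set" where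
  "Uf_minus q = subalgebra_gen q {F n | n. n \<le> 0}"

definition UF_plus :: "complex \<Rightarrow> falg set set" where
  "UF_plus q = subalgebra_gen q ({K, Kinv} \<union> {F n | n. n > 0} \<union> {H n | n. n > 0})"

definition counit_word :: "word \<Rightarrow> complex" where
  "counit_word w = (\<Prod>g\<leftarrow>letters w. if g = K \<or> g = Kinv then 1 else 0)"

definition counit_free :: "falg \<Rightarrow> complex" where
  "counit_free x = (\<Sum>w\<in>Poly_Mapping.keys x. Poly_Mapping.lookup x w * counit_word w)"

text \<open>All relators lie in the kernel of \<^const>\<open>counit_free\<close>, so it is constant on cosets.\<close>

definition counit :: "falg set \<Rightarrow> complex" where
  "counit A = the_elem (counit_free ` A)"

text \<open>\<open>P\<close> is the linear map \<open>U\<^sub>F \<rightarrow> U\<^sub>F\<^sup>+\<close> with \<open>P (f\<^sub>1 f\<^sub>2) = \<epsilon>(f\<^sub>1) f\<^sub>2\<close>. It is unique on \<open>U\<^sub>F\<close>, and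
  exists because multiplication \<open>U\<^sub>f\<^sup>- \<otimes> U\<^sub>F\<^sup>+ \<rightarrow> U\<^sub>F\<close> is a linear isomorphism. Values
  outside \<open>U\<^sub>F\<close> are unconstrained.\<close>

definition is_projection :: "complex \<Rightarrow> (falg set \<Rightarrow> falg set) \<Rightarrow> bool" where
  "is_projection q P \<longleftrightarrow>
     P \<in> UF q \<rightarrow> UF_plus q
   \<and> (\<forall>x\<in>UF q. \<forall>y\<in>UF q. P (x \<oplus>\<^bsub>Uq q\<^esub> y) = P x \<oplus>\<^bsub>Uq q\<^esub> P y)
   \<and> (\<forall>c. \<forall>x\<in>UF q. P (cls q (scal c) \<otimes>\<^bsub>Uq q\<^esub> x) = cls q (scal c) \<otimes>\<^bsub>Uq q\<^esub> P x)
   \<and> (\<forall>x\<in>Uf_minus q. \<forall>y\<in>UF_plus q.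
        P (x \<otimes>\<^bsub>Uq q\<^esub> y) = cls q (scal (counit x)) \<otimes>\<^bsub>Uq q\<^esub> y)"


section \<open>Formal series\<close>

text \<open>A series in the variables \<open>t\<^sub>i = T i\<close> and \<open>w\<^sub>i = W i\<close> maps an exponent vector to the
  coefficient of the corresponding monomial. Coefficients are computed in the free
  algebra and sent to \<^const>\<open>Uq\<close> by \<^const>\<open>cls\<close> at the end; this is harmless because
  every coefficient that occurs is a finite sum of products of modes.\<close>

datatype var = T nat | W nat

type_synonym series = "(var \<Rightarrow>\<^sub>0 int) \<Rightarrow> falg"

abbreviation expo :: "var \<Rightarrow> int \<Rightarrow> (var \<Rightarrow>\<^sub>0 int)" where
  "expo v k \<equiv> Poly_Mapping.single v k"

text \<open>The product of two series. \<^const>\<open>Sum_any\<close> is \<open>0\<close> on infinite support, but in every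
  product formed below each coefficient is a finite sum.\<close>

definition sprod :: "series \<Rightarrow> series \<Rightarrow> series" (infixr "\<star>" 70) where
  "A \<star> B = (\<lambda>N. Sum_any (\<lambda>M. A M * B (N - M)))"

definition monomial :: "complex \<Rightarrow> (var \<Rightarrow>\<^sub>0 int) \<Rightarrow> series" where
  "monomial c M = (\<lambda>N. if N = M then scal c else 0)"

definition sprod_list :: "series list \<Rightarrow> series" where
  "sprod_list As = foldr (\<star>) As (monomial 1 0)"

text \<open>\<open>1 / (1 - c v/u)\<close>, expanded in powers of \<open>v/u\<close>\<close>

definition geom :: "complex \<Rightarrow> var \<Rightarrow> var \<Rightarrow> series" where
  "geom c v u = (\<lambda>N. Sum_any (\<lambda>k. monomial (c ^ k) (expo v (int k) - expo u (int k)) N))"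

text \<open>\<open>x t\<^sub>i + y t\<^sub>j\<close>\<close>

definition lin :: "complex \<Rightarrow> nat \<Rightarrow> complex \<Rightarrow> nat \<Rightarrow> series" where
  "lin x i y j = (\<lambda>N. monomial x (expo (T i) 1) N + monomial y (expo (T j) 1) N)"

text \<open>\<open>1 / (x t\<^sub>i + y t\<^sub>j)\<close> for \<open>i \<noteq> j\<close>, expanded in the domain \<open>|t\<^sub>1| \<ggreater> |t\<^sub>2| \<ggreater> \<dots>\<close>\<close>

definition recip :: "complex \<Rightarrow> nat \<Rightarrow> complex \<Rightarrow> nat \<Rightarrow> series" where
  "recip x i y j =
     (if i < j then monomial (1 / x) (expo (T i) (- 1)) \<star> geom (- y / x) (T j) (T i)
      else monomial (1 / y) (expo (T j) (- 1)) \<star> geom (- x / y) (T i) (T j))"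

definition f_current :: "var \<Rightarrow> series" where
  "f_current v = (\<lambda>N. let k = Poly_Mapping.lookup N v in
     if N = expo v k then gen (F (- k)) else 0)"

definition f_plus :: "var \<Rightarrow> series" where
  "f_plus v = (\<lambda>N. let k = Poly_Mapping.lookup N v in
     if N = expo v k \<and> - k > 0 then gen (F (- k)) else 0)"

definition oint :: "var \<Rightarrow> series \<Rightarrow> series" where
  "oint v A = (\<lambda>N. if Poly_Mapping.lookup N v = 0 then A N else 0)"


section \<open>The two right-hand sides\<close>

text \<open>\<open>\<phi>\<^bsub>t\<^sub>m\<^esub>(t\<^sub>s; t\<^sub>i | i \<in> ss)\<close>, for \<open>m\<close> a member of the list \<open>ss\<close> of distinct indices\<close>

definition phi :: "complex \<Rightarrow> nat \<Rightarrow> nat \<Rightarrow> nat list \<Rightarrow> series" where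
  "phi q m s ss =
     sprod_list [lin 1 s (- 1) i \<star> recip 1 m (- 1) i. i \<leftarrow> ss, i \<noteq> m]
   \<star> sprod_list [lin (1 / q) m (- q) i \<star> recip (1 / q) s (- q) i. i \<leftarrow> ss]"

text \<open>\<open>f\<^sup>+(t\<^sub>s; t\<^sub>i | i \<in> ss)\<close>\<close>

definition f_plus_shifted :: "complex \<Rightarrow> nat \<Rightarrow> nat list \<Rightarrow> series" where
  "f_plus_shifted q s ss =
     (\<lambda>N. f_plus (T s) N - (\<Sum>m\<leftarrow>ss. (phi q m s ss \<star> f_plus (T m)) N))"

definition current_product :: "nat \<Rightarrow> series" where
  "current_product a = sprod_list [f_current (T i). i \<leftarrow> [1..<a + 1]]"

definition weight_rhs1 :: "complex \<Rightarrow> nat \<Rightarrow> series" where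
  "weight_rhs1 q a =
     sprod_list [lin (1 / q) i (- q) j \<star> recip q i (- 1 / q) j. i \<leftarrow> [1..<a + 1], j \<leftarrow> [i + 1..<a + 1]]
   \<star> sprod_list [f_plus_shifted q i [i + 1..<a + 1]. i \<leftarrow> rev [1..<a + 1]]"

text \<open>Here \<^term>\<open>expo (W j) 1 - expo (T i) 1\<close> is the exponent vector of \<open>w\<^sub>j/t\<^sub>i\<close>.\<close>

definition Zkernel :: "complex \<Rightarrow> nat \<Rightarrow> series" where
  "Zkernel q a = sprod_list
     [(monomial 1 (expo (W i) 1 - expo (T i) 1) \<star> geom 1 (W i) (T i))
      \<star> sprod_list
          [(\<lambda>N. monomial q 0 N + monomial (- 1 / q) (expo (W j) 1 - expo (T i) 1) N)
           \<star> geom 1 (W j) (T i). j \<leftarrow> [1..<i]].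
      i \<leftarrow> [1..<a + 1]]"

definition weight_rhs2 :: "complex \<Rightarrow> nat \<Rightarrow> series" where
  "weight_rhs2 q a =
     sprod_list [lin 1 i (- 1) j \<star> recip q i (- 1 / q) j. i \<leftarrow> [1..<a + 1], j \<leftarrow> [i + 1..<a + 1]]
   \<star> foldr oint [W i. i \<leftarrow> [1..<a + 1]]
       (Zkernel q a \<star> sprod_list [f_current (W i). i \<leftarrow> rev [1..<a + 1]])"

end

theory Submission
  imports Defs
begin

text \<open>
Only the quadratic relation between the modes \<open>f[n]\<close> matters. In the span of the words in these
modes let \<open>J\<close> be the sum of the two-sided ideal of the relation and the right ideal generated by the modes
\<open>f[n]\<close> with \<open>n \<le> 0\<close>. The relation rewrites a descent in a word by words that are lexicographically smaller,
so every word is a combination of weakly increasing ones (\<open>word_in_span_sorted\<close>), that is, of words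
in nonpositive modes followed by words in positive modes. Hence the projection kills \<open>J\<close>
(\<open>J_killed\<close>), while it fixes the words in positive modes (\<open>P_pos\<close>). Both right-hand sides of the theorem
have coefficients in the span of such words, so both formulas are congruences modulo \<open>J\<close>; a linear map \<open>nf\<close> with kernel
\<open>J\<close> turns them into equations between series.

Sorting preserves the sum of the indices. Therefore \<open>f[n\<^sub>1]\<dots>f[n\<^sub>a]\<close> lies in \<open>J\<close> unless
\<open>n\<^sub>1 + \<dots> + n\<^sub>k \<ge> k\<close> for all \<open>k\<close>, and modulo \<open>J\<close> the product of currents
is supported in a cone of exponents (\<open>cone_supported_Phi\<close>) on which series can be multiplied, and on which
the linear forms in the \<open>t\<^sub>i\<close>, expanded for \<open>|t\<^sub>1| \<ggreater> \<dots> \<ggreater> |t\<^sub>a|\<close>, are invertible.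

The heart of the proof is that \<open>G = D f(t\<^sub>1)\<dots>f(t\<^sub>a)\<close>, where \<open>D\<close> is the product of the
\<open>q t\<^sub>i - q\<^sup>-\<^sup>1 t\<^sub>j\<close> for \<open>i < j\<close>, is antisymmetric in the variables (\<open>Gam_adjacent\<close>).
Modulo \<open>J\<close> its exponent in the first variable is at most \<open>a - 2\<close>, because the first mode of a word must be positive and
\<open>D\<close> has degree \<open>a - 1\<close>; by antisymmetry this bound holds in every variable. An
antisymmetric series with exponents bounded above in every variable is divisible by the Vandermonde product
(\<open>divide_by_Vdm\<close>), so \<open>G = \<Prod>(t\<^sub>i - t\<^sub>j) S\<close> modulo \<open>J\<close>, with \<open>S\<close> symmetric and all exponents
of \<open>S\<close> negative.

For the integral formula the currents \<open>f(w\<^sub>a)\<dots>f(w\<^sub>1)\<close> are replaced by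
\<open>S(w) \<Prod> (w\<^sub>i - w\<^sub>j) / (q w\<^sub>i - q\<^sup>-\<^sup>1 w\<^sub>j)\<close>, the product over \<open>j < i\<close>. Since all exponents are negative, integrating against
\<open>(w\<^sub>a/t\<^sub>a) / (1 - w\<^sub>a/t\<^sub>a)\<close> substitutes \<open>t\<^sub>a\<close> for \<open>w\<^sub>a\<close>, and the substituted factors cancel those
factors of the kernel that contain \<open>t\<^sub>a\<close>. After all integrations \<open>S(t)\<close> is left (\<open>integrate_all\<close>).

For the product formula one moves \<open>f(t\<^sub>1)\<close> to the end, which gives
\<open>G(t\<^sub>1, \<dots>, t\<^sub>a) = B(t\<^sub>1) G(t\<^sub>2, \<dots>, t\<^sub>a) f(t\<^sub>1)\<close> with \<open>B(t) = \<Prod>(q\<^sup>-\<^sup>1 t - q t\<^sub>j)\<close>, the product over \<open>j > 1\<close>. Passing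
from \<open>f(t\<^sub>1)\<close> to \<open>f\<^sup>+(t\<^sub>1)\<close> changes the right-hand side by terms with exponents \<open>\<ge> 0\<close> in \<open>t\<^sub>1\<close>, and modulo \<open>J\<close> by the bound on \<open>G\<close> these form
a polynomial in \<open>t\<^sub>1\<close> of degree at most \<open>a - 2\<close>. As \<open>G\<close> vanishes at \<open>t\<^sub>1 = t\<^sub>m\<close>, the values of this polynomial
at \<open>t\<^sub>2, \<dots>, t\<^sub>a\<close> are known, and Lagrange interpolation expresses it by the functions
\<open>\<phi>\<close> (\<open>Psi_zero\<close>, \<open>Gamc_step\<close>).
\<close>

section \<open>Series supported in cones\<close>

abbreviation "lookup \<equiv> Poly_Mapping.lookup"
abbreviation "keys \<equiv> Poly_Mapping.keys"

text \<open>The variables much larger than \<open>v\<close> in the order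
  \<open>|t\<^sub>1| \<ggreater> |t\<^sub>2| \<ggreater> \<dots> \<ggreater> |w\<^sub>2| \<ggreater> |w\<^sub>1|\<close>. The reversed order of the \<open>w\<^sub>i\<close> is the one in which the currents
  appear under the integral.\<close>

definition sdown :: "var \<Rightarrow> var set" where
  "sdown v = (case v of T i \<Rightarrow> {T j | j. j < i} | W i \<Rightarrow> range T \<union> {W j | j. j > i})"

definition wt :: "var set \<Rightarrow> (var \<Rightarrow>\<^sub>0 int) \<Rightarrow> int" where
  "wt D N = (\<Sum>v\<in>keys N \<inter> D. lookup N v)"

text \<open>If \<open>v\<^sub>1 \<ggreater> v\<^sub>2 \<ggreater> \<dots>\<close> are the elements of \<open>V\<close>, the condition bounds the sums of the first
  \<open>k\<close> exponents from above for every \<open>k\<close>. It is imposed both with and without \<open>v\<close> so that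
  each exponent is a difference of two bounded quantities.\<close>

definition cone :: "var set \<Rightarrow> int \<Rightarrow> (var \<Rightarrow>\<^sub>0 int) set" where
  "cone V c = {N. keys N \<subseteq> V \<and> (\<forall>v. wt (sdown v) N \<le> c \<and> wt (insert v (sdown v)) N \<le> c)}"

definition cone_supported :: "((var \<Rightarrow>\<^sub>0 int) \<Rightarrow> 'a::zero) \<Rightarrow> bool" where
  "cone_supported A \<longleftrightarrow> (\<exists>V c. finite V \<and> (\<forall>N. A N \<noteq> 0 \<longrightarrow> N \<in> cone V c))"

lemma not_in_sdown [simp]: "v \<notin> sdown v"
  by (auto simp: sdown_def split: var.splits)

lemma sdown_trans: "u \<in> sdown v \<Longrightarrow> v \<in> sdown w \<Longrightarrow> u \<in> sdown w"
  by (auto simp: sdown_def split: var.splits)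

lemma wt_superset:
  assumes "finite Z" "keys N \<subseteq> Z"
  shows "wt D N = (\<Sum>v\<in>Z \<inter> D. lookup N v)"
  unfolding wt_def
  by (rule sum.mono_neutral_left) (use assms in \<open>auto simp: in_keys_iff\<close>)

lemma wt_add: "wt D (M + N) = wt D M + wt D N"
proof -
  let ?S = "keys M \<union> keys N"
  have "wt D (M + N) = (\<Sum>v\<in>?S \<inter> D. lookup (M + N) v)"
    by (rule wt_superset) (auto simp: in_keys_iff lookup_add)
  also have "\<dots> = wt D M + wt D N"
    by (simp add: lookup_add sum.distrib wt_superset[of ?S])
  finally show ?thesis .
qed

lemma wt_diff: "wt D (M - N) = wt D M - wt D N"
  using wt_add[of D "M - N" N] by simp

lemma wt_single [simp]: "wt D (expo v k) = (if v \<in> D then k else 0)"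
  by (auto simp: wt_def)

lemma lookup_eq_wt: "lookup N v = wt (insert v (sdown v)) N - wt (sdown v) N"
proof -
  have "wt (insert v (sdown v)) N = (\<Sum>u\<in>insert v ((insert v (keys N)) \<inter> sdown v). lookup N u)"
    by (subst wt_superset[of "insert v (keys N)"]) (auto intro!: sum.cong)
  also have "\<dots> = lookup N v + wt (sdown v) N"
    by (subst sum.insert) (auto simp: wt_def)
  finally show ?thesis by simp
qed

lemma cone_mono: "V \<subseteq> V' \<Longrightarrow> c \<le> c' \<Longrightarrow> cone V c \<subseteq> cone V' c'"
  unfolding cone_def by (auto intro: order_trans)

lemma cone_add: "M \<in> cone V c \<Longrightarrow> N \<in> cone V' c' \<Longrightarrow> M + N \<in> cone (V \<union> V') (c + c')"
  using keys_add[of M N] by (auto simp: cone_def wt_add intro!: add_mono)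

lemma finite_bounded_exponents:
  assumes "finite V"
  shows "finite {M :: var \<Rightarrow>\<^sub>0 int. keys M \<subseteq> V \<and> (\<forall>v\<in>V. l v \<le> lookup M v \<and> lookup M v \<le> u v)}"
proof -
  let ?S = "{M :: var \<Rightarrow>\<^sub>0 int. keys M \<subseteq> V \<and> (\<forall>v\<in>V. l v \<le> lookup M v \<and> lookup M v \<le> u v)}"
  have "finite (lookup ` ?S)"
  proof (rule finite_subset)
    show "lookup ` ?S \<subseteq> {f. \<forall>v. (v \<in> V \<longrightarrow> f v \<in> (\<Union>v\<in>V. {l v..u v})) \<and> (v \<notin> V \<longrightarrow> f v = 0)}"
      by (auto simp: in_keys_iff)
    show "finite {f. \<forall>v. (v \<in> V \<longrightarrow> f v \<in> (\<Union>v\<in>V. {l v..u v})) \<and> (v \<notin> V \<longrightarrow> f v = 0)}"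
      by (rule finite_set_of_finite_funs) (use assms in auto)
  qed
  then show ?thesis
    by (rule finite_imageD) (auto intro!: inj_onI poly_mapping_eqI)
qed

text \<open>This finiteness makes the convolution product well defined: on a splitting of \<open>N\<close> the partial sums of
  the exponents of one part are bounded above by its own cone and below by the cone of the other part.\<close>

lemma finite_cone_splittings:
  assumes "finite V"
  shows "finite {M. M \<in> cone V c \<and> N - M \<in> cone V' d}"
proof (rule finite_subset)
  let ?l = "\<lambda>v. wt (insert v (sdown v)) N - d - c" and ?u = "\<lambda>v. c - wt (sdown v) N + d"
  show "{M. M \<in> cone V c \<and> N - M \<in> cone V' d}
    \<subseteq> {M. keys M \<subseteq> V \<and> (\<forall>v\<in>V. ?l v \<le> lookup M v \<and> lookup M v \<le> ?u v)}"
  proof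
    fix M assume M: "M \<in> {M. M \<in> cone V c \<and> N - M \<in> cone V' d}"
    then have "wt (insert v (sdown v)) M \<le> c" "wt (sdown v) M \<le> c"
      "wt (insert v (sdown v)) (N - M) \<le> d" "wt (sdown v) (N - M) \<le> d" for v
      by (auto simp: cone_def)
    then have "?l v \<le> lookup M v \<and> lookup M v \<le> ?u v" for v
      unfolding lookup_eq_wt[of M v] wt_diff by (smt (verit))
    with M show "M \<in> {M. keys M \<subseteq> V \<and> (\<forall>v\<in>V. ?l v \<le> lookup M v \<and> lookup M v \<le> ?u v)}"
      by (auto simp: cone_def)
  qed
qed (rule finite_bounded_exponents[OF assms])

lemma cone_supported_common:
  assumes "cone_supported A" "cone_supported B"
  shows "\<exists>V c. finite V \<and> (\<forall>N. A N \<noteq> 0 \<or> B N \<noteq> 0 \<longrightarrow> N \<in> cone V c)"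
proof -
  from assms obtain V c V' c' where *: "finite V" "\<And>N. A N \<noteq> 0 \<Longrightarrow> N \<in> cone V c"
    "finite V'" "\<And>N. B N \<noteq> 0 \<Longrightarrow> N \<in> cone V' c'"
    unfolding cone_supported_def by blast
  have "cone V c \<subseteq> cone (V \<union> V') (max c c')" "cone V' c' \<subseteq> cone (V \<union> V') (max c c')"
    by (rule cone_mono; simp)+
  with * show ?thesis by (intro exI[of _ "V \<union> V'"] exI[of _ "max c c'"]) auto
qed

lemma cone_supportedI: "finite V \<Longrightarrow> (\<And>N. A N \<noteq> 0 \<Longrightarrow> N \<in> cone V c) \<Longrightarrow> cone_supported A"
  unfolding cone_supported_def by blast

lemma finite_conv_support:
  assumes "cone_supported A" "cone_supported B"
  shows "finite {M. A M \<noteq> 0 \<and> B (N - M) \<noteq> 0}"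
proof -
  obtain V c where "finite V" "\<forall>N. A N \<noteq> 0 \<or> B N \<noteq> 0 \<longrightarrow> N \<in> cone V c"
    using cone_supported_common[OF assms] by blast
  then show ?thesis
    by (intro finite_subset[OF _ finite_cone_splittings[of V c N V c]]) auto
qed

definition conv :: "((var \<Rightarrow>\<^sub>0 int) \<Rightarrow> 'a::semiring_0) \<Rightarrow> ((var \<Rightarrow>\<^sub>0 int) \<Rightarrow> 'a) \<Rightarrow> (var \<Rightarrow>\<^sub>0 int) \<Rightarrow> 'a" where
  "conv A B = (\<lambda>N. Sum_any (\<lambda>M. A M * B (N - M)))"

lemma finite_conv_terms:
  fixes A B :: "(var \<Rightarrow>\<^sub>0 int) \<Rightarrow> 'a::semiring_0"
  assumes "cone_supported A" "cone_supported B"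
  shows "finite {M. A M * B (N - M) \<noteq> 0}"
  by (rule finite_subset[OF _ finite_conv_support[OF assms, of N]]) auto

lemma conv_nonzeroE:
  assumes "conv A B N \<noteq> 0"
  obtains M where "A M \<noteq> 0" "B (N - M) \<noteq> 0"
proof -
  from assms obtain M where "A M * B (N - M) \<noteq> 0"
    unfolding conv_def by (rule Sum_any.not_neutral_obtains_not_neutral)
  then have "A M \<noteq> 0" "B (N - M) \<noteq> 0" by auto
  with that show ?thesis .
qed

lemma cone_supported_conv:
  assumes "cone_supported A" "cone_supported B"
  shows "cone_supported (conv A B)"
proof -
  obtain V c where *: "finite V" "\<forall>N. A N \<noteq> 0 \<or> B N \<noteq> 0 \<longrightarrow> N \<in> cone V c"
    using cone_supported_common[OF assms] by blast
  have "N \<in> cone V (c + c)" if "conv A B N \<noteq> 0" for N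
  proof -
    from that obtain M where "A M \<noteq> 0" "B (N - M) \<noteq> 0" by (rule conv_nonzeroE)
    then show ?thesis using cone_add[of M V c "N - M" V c] * by auto
  qed
  then show ?thesis using * by (intro cone_supportedI)
qed

lemma bij_shift: "bij (\<lambda>K::var \<Rightarrow>\<^sub>0 int. L + K)"
  by (rule bij_betw_byWitness[where f' = "\<lambda>K. K - L"]) auto

lemma bij_reflect: "bij (\<lambda>K::var \<Rightarrow>\<^sub>0 int. L - K)"
  by (rule bij_betw_byWitness[where f' = "\<lambda>K. L - K"]) auto

text \<open>A triple of exponents that contributes has its first two and its last two members add up
  to elements of bounded cones, so both intermediate sums range over finite sets and can be exchanged.\<close>

lemma conv_assoc:
  fixes A B C :: "(var \<Rightarrow>\<^sub>0 int) \<Rightarrow> 'a::semiring_0"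
  assumes "cone_supported A" "cone_supported B" "cone_supported C"
  shows "conv (conv A B) C = conv A (conv B C)"
proof
  fix N
  obtain V c where V: "finite V" "\<forall>N. A N \<noteq> 0 \<or> B N \<noteq> 0 \<longrightarrow> N \<in> cone V c"
    using cone_supported_common[OF assms(1,2)] by blast
  obtain U d where U: "finite U" "\<forall>N. B N \<noteq> 0 \<or> C N \<noteq> 0 \<longrightarrow> N \<in> cone U d"
    using cone_supported_common[OF assms(2,3)] by blast
  let ?P = "{L. L \<in> cone V c \<and> N - L \<in> cone (U \<union> U) (d + d)}"
  let ?Q = "{M. M \<in> cone (V \<union> V) (c + c) \<and> N - M \<in> cone U d}"
  have fin: "finite ((?Q \<times> ?P))"
    by (intro finite_cartesian_product finite_cone_splittings) (use V U in auto)
  have sub: "L \<in> ?P \<and> M \<in> ?Q" if "A L * B (M - L) * C (N - M) \<noteq> 0" for L M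
  proof -
    from that have nz: "A L \<noteq> 0" "B (M - L) \<noteq> 0" "C (N - M) \<noteq> 0" by auto
    have "L + (M - L) \<in> cone (V \<union> V) (c + c)" by (rule cone_add) (use nz V in auto)
    moreover have "(M - L) + (N - M) \<in> cone (U \<union> U) (d + d)" by (rule cone_add) (use nz U in auto)
    ultimately show ?thesis using nz V U by auto
  qed
  have "conv (conv A B) C N = Sum_any (\<lambda>M. Sum_any (\<lambda>L. A L * B (M - L) * C (N - M)))"
    unfolding conv_def by (simp add: Sum_any_left_distrib finite_conv_terms assms)
  also have "\<dots> = Sum_any (\<lambda>L. Sum_any (\<lambda>M. A L * B (M - L) * C (N - M)))"
    by (rule Sum_any.swap[OF fin]) (use sub in blast)
  also have "\<dots> = Sum_any (\<lambda>L. Sum_any (\<lambda>K. A L * (B K * C (N - L - K))))"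
  proof (rule Sum_any.cong)
    fix L
    show "Sum_any (\<lambda>M. A L * B (M - L) * C (N - M)) = Sum_any (\<lambda>K. A L * (B K * C (N - L - K)))"
      by (rule Sum_any.reindex_cong[OF bij_shift[of L]]) (auto simp: fun_eq_iff mult.assoc diff_diff_eq)
  qed
  also have "\<dots> = conv A (conv B C) N"
    unfolding conv_def by (simp add: Sum_any_right_distrib finite_conv_terms assms)
  finally show "conv (conv A B) C N = conv A (conv B C) N" .
qed

lemma conv_commute:
  fixes A B :: "(var \<Rightarrow>\<^sub>0 int) \<Rightarrow> 'a::comm_semiring_0"
  shows "conv A B = conv B A"
proof
  fix N show "conv A B N = conv B A N"
    unfolding conv_def
    by (rule Sum_any.reindex_cong[OF bij_reflect[of N]]) (auto simp: fun_eq_iff mult.commute)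
qed

lemma cone_supported_zero: "cone_supported (\<lambda>N. 0)"
  by (rule cone_supportedI[of "{}" _ 0]) auto

lemma single_in_cone: "N \<in> cone (keys N) (\<Sum>v\<in>keys N. \<bar>lookup N v\<bar>)"
proof -
  have "wt D N \<le> (\<Sum>v\<in>keys N. \<bar>lookup N v\<bar>)" for D
  proof -
    have "wt D N \<le> (\<Sum>v\<in>keys N \<inter> D. \<bar>lookup N v\<bar>)"
      unfolding wt_def by (rule sum_mono) auto
    also have "\<dots> \<le> (\<Sum>v\<in>keys N. \<bar>lookup N v\<bar>)"
      by (rule sum_mono2) auto
    finally show ?thesis .
  qed
  then show ?thesis by (auto simp: cone_def)
qed

lemma cone_supported_monomial: "cone_supported (\<lambda>N. if N = M then c else 0)"
  by (rule cone_supportedI[of "keys M"]) (auto split: if_splits intro: single_in_cone)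

lemma conv_monomial_left:
  "conv (\<lambda>N. if N = M then c else 0) A N = c * A (N - M)"
proof -
  have "conv (\<lambda>N. if N = M then c else 0) A N = Sum_any (\<lambda>L. if L = M then c * A (N - L) else 0)"
    unfolding conv_def by (rule Sum_any.cong) auto
  then show ?thesis by simp
qed

lemma conv_monomial_right:
  "conv A (\<lambda>N. if N = M then c else 0) N = A (N - M) * c"
proof -
  have "conv A (\<lambda>N. if N = M then c else 0) N = Sum_any (\<lambda>L. if L = N - M then A L * c else 0)"
    unfolding conv_def by (rule Sum_any.cong) auto
  then show ?thesis by simp
qed

lemma conv_add_left:
  fixes A B C :: "(var \<Rightarrow>\<^sub>0 int) \<Rightarrow> 'a::semiring_0"
  assumes "cone_supported A" "cone_supported B" "cone_supported C"
  shows "conv (\<lambda>N. A N + B N) C = (\<lambda>N. conv A C N + conv B C N)"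
proof
  fix N
  show "conv (\<lambda>N. A N + B N) C N = conv A C N + conv B C N"
    unfolding conv_def distrib_right
    using Sum_any.distrib[OF finite_conv_terms[OF assms(1,3)] finite_conv_terms[OF assms(2,3)]] .
qed

lemma conv_add_right:
  fixes A B C :: "(var \<Rightarrow>\<^sub>0 int) \<Rightarrow> 'a::semiring_0"
  assumes "cone_supported A" "cone_supported B" "cone_supported C"
  shows "conv A (\<lambda>N. B N + C N) = (\<lambda>N. conv A B N + conv A C N)"
proof
  fix N
  show "conv A (\<lambda>N. B N + C N) N = conv A B N + conv A C N"
    unfolding conv_def distrib_left
    using Sum_any.distrib[OF finite_conv_terms[OF assms(1,2)] finite_conv_terms[OF assms(1,3)]] .
qed

typedef (overloaded) 'a cseries = "{A :: (var \<Rightarrow>\<^sub>0 int) \<Rightarrow> 'a::zero. cone_supported A}"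
  morphisms cf Abs_cseries
  using cone_supported_zero by blast

setup_lifting type_definition_cseries

lemma cone_supported_cf [simp]: "cone_supported (cf Z)"
  using cf by auto

lemma cf_Abs [simp]: "cone_supported A \<Longrightarrow> cf (Abs_cseries A) = A"
  by (simp add: Abs_cseries_inverse)

lemma cseries_eqI: "(\<And>N. cf Z N = cf Y N) \<Longrightarrow> Z = Y"
  by (metis cf_inject ext)

instantiation cseries :: (ring_1) ring_1
begin

lift_definition zero_cseries :: "'a cseries" is "\<lambda>N. 0"
  by (rule cone_supported_zero)

lift_definition one_cseries :: "'a cseries" is "\<lambda>N. if N = 0 then 1 else 0"
  by (rule cone_supported_monomial)

lift_definition plus_cseries :: "'a cseries \<Rightarrow> 'a cseries \<Rightarrow> 'a cseries" is "\<lambda>A B N. A N + B N"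
proof -
  fix A B :: "(var \<Rightarrow>\<^sub>0 int) \<Rightarrow> 'a" assume AB: "cone_supported A" "cone_supported B"
  obtain V c where V: "finite V" "\<forall>N. A N \<noteq> 0 \<or> B N \<noteq> 0 \<longrightarrow> N \<in> cone V c"
    using cone_supported_common[OF AB] by blast
  show "cone_supported (\<lambda>N. A N + B N)"
  proof (rule cone_supportedI[OF V(1)])
    show "N \<in> cone V c" if "A N + B N \<noteq> 0" for N
      using that V(2)[rule_format, of N] by (cases "A N = 0") auto
  qed
qed

lift_definition minus_cseries :: "'a cseries \<Rightarrow> 'a cseries \<Rightarrow> 'a cseries" is "\<lambda>A B N. A N - B N"
proof -
  fix A B :: "(var \<Rightarrow>\<^sub>0 int) \<Rightarrow> 'a" assume AB: "cone_supported A" "cone_supported B"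
  obtain V c where V: "finite V" "\<forall>N. A N \<noteq> 0 \<or> B N \<noteq> 0 \<longrightarrow> N \<in> cone V c"
    using cone_supported_common[OF AB] by blast
  show "cone_supported (\<lambda>N. A N - B N)"
  proof (rule cone_supportedI[OF V(1)])
    show "N \<in> cone V c" if "A N - B N \<noteq> 0" for N
      using that V(2)[rule_format, of N] by (cases "A N = 0") auto
  qed
qed

lift_definition uminus_cseries :: "'a cseries \<Rightarrow> 'a cseries" is "\<lambda>A N. - A N"
  by (simp add: cone_supported_def)

lift_definition times_cseries :: "'a cseries \<Rightarrow> 'a cseries \<Rightarrow> 'a cseries" is conv
  by (rule cone_supported_conv)

instance
proof
  fix a b c :: "'a cseries"
  show "a * b * c = a * (b * c)" by transfer (rule conv_assoc)
  show "(1::'a cseries) * a = a"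
    by (rule cseries_eqI) (transfer, simp add: conv_monomial_left)
  show "a * 1 = a"
    by (rule cseries_eqI) (transfer, simp add: conv_monomial_right)
  show "a + b + c = a + (b + c)"
    by (rule cseries_eqI) (simp add: zero_cseries.rep_eq plus_cseries.rep_eq minus_cseries.rep_eq uminus_cseries.rep_eq ac_simps)
  show "a + b = b + a"
    by (rule cseries_eqI) (simp add: zero_cseries.rep_eq plus_cseries.rep_eq minus_cseries.rep_eq uminus_cseries.rep_eq ac_simps)
  show "0 + a = a"
    by (rule cseries_eqI) (simp add: zero_cseries.rep_eq plus_cseries.rep_eq minus_cseries.rep_eq uminus_cseries.rep_eq ac_simps)
  show "- a + a = 0"
    by (rule cseries_eqI) (simp add: zero_cseries.rep_eq plus_cseries.rep_eq minus_cseries.rep_eq uminus_cseries.rep_eq ac_simps)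
  show "a - b = a + - b"
    by (rule cseries_eqI) (simp add: zero_cseries.rep_eq plus_cseries.rep_eq minus_cseries.rep_eq uminus_cseries.rep_eq ac_simps)
  show "(a + b) * c = a * c + b * c"
    by (rule cseries_eqI) (simp only: plus_cseries.rep_eq times_cseries.rep_eq conv_add_left cone_supported_cf)
  show "a * (b + c) = a * b + a * c"
    by (rule cseries_eqI) (simp only: plus_cseries.rep_eq times_cseries.rep_eq conv_add_right cone_supported_cf)
  show "(0::'a cseries) \<noteq> 1"
    by (metis zero_cseries.rep_eq one_cseries.rep_eq zero_neq_one)
qed

end

instance cseries :: (comm_ring_1) comm_ring_1
proof
  fix a b c :: "'a cseries"
  show "a * b = b * a"
    by (rule cseries_eqI) (simp add: times_cseries.rep_eq conv_commute[of "cf a"])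
qed (simp_all add: distrib_right)

lemma cf_zero [simp]: "cf 0 N = 0" by transfer simp
lemma cf_one: "cf 1 N = (if N = 0 then 1 else 0)" by transfer simp
lemma cf_add [simp]: "cf (Z + Y) N = cf Z N + cf Y N" by transfer simp
lemma cf_diff [simp]: "cf (Z - Y) N = cf Z N - cf Y N" by transfer simp
lemma cf_uminus [simp]: "cf (- Z) N = - cf Z N" by transfer simp
lemma cf_mult: "cf (Z * Y) = conv (cf Z) (cf Y)" by transfer simp

lemma cf_mult_nonzeroE:
  assumes "cf (Z * Y) N \<noteq> 0"
  obtains M where "cf Z M \<noteq> 0" "cf Y (N - M) \<noteq> 0"
  using assms unfolding cf_mult by (rule conv_nonzeroE)

section \<open>Scalars, Laurent polynomials and inverses\<close>

lemma poly_mapping_single_induct: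
  assumes "P 0" "\<And>w c f. P f \<Longrightarrow> P (Poly_Mapping.single w c + f)"
  shows "P x"
proof (induction x rule: Poly_Mapping.update_induct)
  case (update f a b)
  have "Poly_Mapping.update a b f = Poly_Mapping.single a b + f"
    using update(1)
    by (intro poly_mapping_eqI) (auto simp: lookup_update lookup_add lookup_single when_def in_keys_iff)
  then show ?case using assms(2)[OF update(3), of a b] by simp
qed (rule assms(1))

lemma scal_0 [simp]: "scal 0 = 0" by (simp add: scal_def)
lemma scal_1 [simp]: "scal 1 = 1" by (simp add: scal_def)
lemma scal_add: "scal (a + b) = scal a + scal b" by (simp add: scal_def single_add)
lemma scal_diff: "scal (a - b) = scal a - scal b" by (simp add: scal_def single_diff)
lemma scal_uminus: "scal (- a) = - scal a" by (simp add: scal_def single_uminus)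
lemma scal_mult: "scal (a * b) = scal a * scal b" by (simp add: scal_def mult_single)
lemma scal_commute: "x * scal c = scal c * x"
proof (induction x rule: poly_mapping_single_induct)
  case (2 w d f)
  then show ?case by (simp add: distrib_left distrib_right scal_def mult_single mult.commute)
qed simp

lemma scal_left_commute: "x * (scal c * y) = scal c * (x * y)"
  by (metis mult.assoc scal_commute)

lemma Sum_any_additive:
  assumes "\<And>x y. h (x + y) = h x + h y" "h 0 = 0" "finite {a. g a \<noteq> 0}"
  shows "h (Sum_any g) = Sum_any (\<lambda>a. h (g a))"
proof -
  have *: "h (sum g I) = (\<Sum>i\<in>I. h (g i))" for I
    by (induction I rule: infinite_finite_induct) (simp_all add: assms)
  have "Sum_any (\<lambda>a. h (g a)) = (\<Sum>a\<in>{a. g a \<noteq> 0}. h (g a))"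
    by (rule Sum_any.expand_superset) (use assms in auto)
  then show ?thesis by (simp add: Sum_any.expand_set[of g] *)
qed

subsection \<open>Scalar series\<close>

text \<open>Scalar series act on series over the algebra through this embedding; its image is central.\<close>

lift_definition sc :: "complex cseries \<Rightarrow> falg cseries" is "\<lambda>A N. scal (A N)"
  by (metis (mono_tags, lifting) cone_supported_def scal_0)

lemma cf_sc [simp]: "cf (sc A) N = scal (cf A N)" by transfer simp

lemma sc_add: "sc (A + B) = sc A + sc B" by (rule cseries_eqI) (simp add: scal_add)
lemma sc_diff: "sc (A - B) = sc A - sc B" by (rule cseries_eqI) (simp add: scal_diff)
lemma sc_1 [simp]: "sc 1 = 1" by (rule cseries_eqI) (simp add: cf_one)

lemma sc_mult: "sc (A * B) = sc A * sc B"
proof (rule cseries_eqI)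
  fix N
  have "scal (Sum_any (\<lambda>M. cf A M * cf B (N - M))) = Sum_any (\<lambda>M. scal (cf A M * cf B (N - M)))"
  proof (rule Sum_any_additive)
    show "finite {M. cf A M * cf B (N - M) \<noteq> 0}" by (rule finite_conv_terms) simp_all
  qed (simp_all add: scal_add)
  then show "cf (sc (A * B)) N = cf (sc A * sc B) N"
    by (simp add: cf_mult conv_def scal_mult)
qed

lemma sc_commute: "B * sc A = sc A * B"
proof (rule cseries_eqI)
  fix N
  show "cf (B * sc A) N = cf (sc A * B) N"
    unfolding cf_mult conv_def
    by (rule Sum_any.reindex_cong[OF bij_reflect[of N]]) (auto simp: fun_eq_iff scal_commute)
qed

lemma sc_left_commute: "B * (sc A * C) = sc A * (B * C)"
  by (metis mult.assoc sc_commute)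

lemma sc_prod_list: "sc (prod_list As) = prod_list (map sc As)"
  by (induction As) (auto simp: sc_mult)

subsection \<open>Laurent polynomials and their action on two-sided series\<close>

type_synonym lpoly = "(var \<Rightarrow>\<^sub>0 int) \<Rightarrow>\<^sub>0 complex"

lemma cone_supported_finite:
  assumes "finite {N. A N \<noteq> 0}"
  shows "cone_supported A"
proof (rule cone_supportedI)
  let ?S = "{N. A N \<noteq> 0}"
  show "finite (\<Union>N\<in>?S. keys N)" using assms by auto
  fix N assume "A N \<noteq> 0"
  then have "cone (keys N) (\<Sum>v\<in>keys N. \<bar>lookup N v\<bar>)
    \<subseteq> cone (\<Union>N\<in>?S. keys N) (\<Sum>N\<in>?S. \<Sum>v\<in>keys N. \<bar>lookup N v\<bar>)"
    using assms by (intro cone_mono member_le_sum) (auto intro: sum_nonneg)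
  then show "N \<in> cone (\<Union>N\<in>?S. keys N) (\<Sum>N\<in>?S. \<Sum>v\<in>keys N. \<bar>lookup N v\<bar>)"
    using single_in_cone by blast
qed

definition emb :: "lpoly \<Rightarrow> complex cseries" where
  "emb p = Abs_cseries (lookup p)"

lemma cf_emb: "cf (emb p) = lookup p"
  by (simp add: emb_def cone_supported_finite)

lemma emb_add: "emb (p + q) = emb p + emb q" by (rule cseries_eqI) (simp add: cf_emb lookup_add)
lemma emb_diff: "emb (p - q) = emb p - emb q" by (rule cseries_eqI) (simp add: cf_emb lookup_minus)
lemma emb_uminus: "emb (- p) = - emb p" by (rule cseries_eqI) (simp add: cf_emb)
lemma emb_1 [simp]: "emb 1 = 1" by (rule cseries_eqI) (simp add: cf_emb cf_one lookup_one when_def)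

lemma emb_mult: "emb (p * q) = emb p * emb q"
proof (rule cseries_eqI)
  fix N
  have "(\<Sum>M. lookup q M when N = L + M) = lookup q (N - L)" for L
  proof -
    have "(\<lambda>M. lookup q M when N = L + M) = (\<lambda>M. lookup q M when M = N - L)"
      by (auto simp: fun_eq_iff when_def)
    then show ?thesis by (simp only: Sum_any_when_equal)
  qed
  then show "cf (emb (p * q)) N = cf (emb p * emb q) N"
    by (simp add: cf_emb cf_mult conv_def lookup_mult)
qed

lemma emb_prod_list: "emb (prod_list ps) = prod_list (map emb ps)"
  by (induction ps) (auto simp: emb_mult)

text \<open>Products of full currents are unbounded in both directions and have no convolution with series, but
  they can be multiplied by Laurent polynomials.\<close>

definition act :: "lpoly \<Rightarrow> series \<Rightarrow> series" where
  "act p A = (\<lambda>N. Sum_any (\<lambda>M. scal (lookup p M) * A (N - M)))"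

lemma act_eq_sum:
  assumes "finite I" "keys p \<subseteq> I"
  shows "act p A N = (\<Sum>M\<in>I. scal (lookup p M) * A (N - M))"
  unfolding act_def
proof (rule Sum_any.expand_superset)
  show "{M. scal (lookup p M) * A (N - M) \<noteq> 0} \<subseteq> I"
  proof
    fix M assume "M \<in> {M. scal (lookup p M) * A (N - M) \<noteq> 0}"
    then have "lookup p M \<noteq> 0" by auto
    then show "M \<in> I" using assms by (auto simp: in_keys_iff)
  qed
qed (rule assms)

lemma cf_sc_emb_mult: "cf (sc (emb p) * B) = act p (cf B)"
  by (simp add: cf_mult conv_def act_def cf_emb fun_eq_iff)

lemma act_0 [simp]: "act 0 A = (\<lambda>N. 0)" by (simp add: act_def)

lemma act_single: "act (Poly_Mapping.single M c) A N = scal c * A (N - M)"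
  by (subst act_eq_sum[of "{M}"]) auto

lemma act_1 [simp]: "act 1 A = A"
  by (simp add: act_single[of 0 1, simplified] fun_eq_iff)

lemma act_add: "act (p + q) A N = act p A N + act q A N"
proof -
  let ?I = "keys p \<union> keys q"
  have "keys (p + q) \<subseteq> ?I" by (rule keys_add)
  then show ?thesis
    by (simp add: act_eq_sum[of ?I] lookup_add scal_add distrib_right sum.distrib)
qed

lemma act_uminus: "act (- p) A N = - act p A N"
  by (simp add: act_eq_sum[of "keys p"] scal_uminus sum_negf)

lemma act_fun_add: "act p (\<lambda>N. A N + B N) N = act p A N + act p B N"
  by (simp add: act_eq_sum[of "keys p"] distrib_left sum.distrib)

lemma act_fun_uminus: "act p (\<lambda>N. - A N) N = - act p A N"
  by (simp add: act_eq_sum[of "keys p"] sum_negf)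

lemma act_fun_diff: "act p (\<lambda>N. A N - B N) N = act p A N - act p B N"
  by (simp add: act_eq_sum[of "keys p"] right_diff_distrib sum_subtractf)

lemma act_fun_zero [simp]: "act p (\<lambda>N. 0) = (\<lambda>N. 0)"
  by (simp add: act_def)

lemma act_mult: "act (p * q) A = act p (act q A)"
proof (induction p rule: poly_mapping_single_induct)
  case (2 w c f)
  have "act (Poly_Mapping.single w c * q) A = act (Poly_Mapping.single w c) (act q A)" for w c
  proof (induction q rule: poly_mapping_single_induct)
    case (2 w' c' f')
    then show ?case
      by (simp add: fun_eq_iff distrib_left act_add act_fun_add act_single mult_single scal_mult
          mult.assoc diff_diff_eq)
  qed simp
  with 2 show ?case by (simp add: fun_eq_iff distrib_right act_add)
qed simp

lemma act_commute: "act p (act q A) = act q (act p A)"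
  by (simp only: act_mult[symmetric] mult.commute)

lemma act_nonzeroE:
  assumes "act p A N \<noteq> 0"
  obtains M where "M \<in> keys p" "A (N - M) \<noteq> 0"
proof -
  from assms have "(\<Sum>M\<in>keys p. scal (lookup p M) * A (N - M)) \<noteq> 0"
    by (simp add: act_eq_sum[of "keys p"])
  then obtain M where "M \<in> keys p" "scal (lookup p M) * A (N - M) \<noteq> 0"
    by (rule sum.not_neutral_contains_not_neutral)
  with that show ?thesis by force
qed

text \<open>The linear form \<open>x u + y v\<close>.\<close>

definition lf :: "complex \<Rightarrow> var \<Rightarrow> complex \<Rightarrow> var \<Rightarrow> lpoly" where
  "lf x u y v = Poly_Mapping.single (expo u 1) x + Poly_Mapping.single (expo v 1) y"

abbreviation row :: "complex \<Rightarrow> complex \<Rightarrow> var \<Rightarrow> var list \<Rightarrow> lpoly" where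
  "row x y v us \<equiv> prod_list (map (\<lambda>u. lf x v y u) us)"

lemma act_lf: "act (lf x u y v) A N = scal x * A (N - expo u 1) + scal y * A (N - expo v 1)"
  by (simp add: lf_def act_add act_single)

lemma keys_lf: "keys (lf x u y v) \<subseteq> {expo u 1, expo v 1}"
  unfolding lf_def by (rule order.trans[OF keys_add]) auto

lemma lf_swap: "lf x u y v = lf y v x u"
  by (simp add: lf_def add.commute)

lemma lf_neg: "lf (- x) u (- y) v = - lf x u y v"
  by (simp add: lf_def single_uminus)

lemma sdown_asym: "u \<in> sdown v \<Longrightarrow> v \<notin> sdown u"
  using sdown_trans not_in_sdown by blast

lemma sdown_linear: "u \<noteq> v \<Longrightarrow> u \<in> sdown v \<or> v \<in> sdown u"
  by (auto simp: sdown_def split: var.splits)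

subsection \<open>Geometric series and inverses of linear forms\<close>

definition ratio :: "var \<Rightarrow> var \<Rightarrow> int \<Rightarrow> (var \<Rightarrow>\<^sub>0 int)" where
  "ratio v u k = expo v k - expo u k"

lemma lookup_ratio: "u \<noteq> v \<Longrightarrow> lookup (ratio v u k) v = k"
  by (simp add: ratio_def lookup_minus lookup_single)

lemma ratio_0 [simp]: "ratio v u 0 = 0" by (simp add: ratio_def)

lemma ratio_add: "ratio v u (j + k) = ratio v u j + ratio v u k"
  by (simp add: ratio_def single_add algebra_simps)

lemma ratio_diff: "ratio v u (j - k) = ratio v u j - ratio v u k"
  by (simp add: ratio_def single_diff algebra_simps)

lemma ratio_in_cone:
  assumes "u \<in> sdown v" "k \<ge> 0"
  shows "ratio v u k \<in> cone {u, v} 0"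
proof -
  have "keys (ratio v u k) \<subseteq> {u, v}"
    unfolding ratio_def by (rule order.trans[OF keys_diff]) auto
  moreover have "v \<in> sdown w \<Longrightarrow> u \<in> sdown w" for w
    using assms(1) sdown_trans by blast
  ultimately show ?thesis
    using assms sdown_asym[OF assms(1)] by (auto simp: cone_def ratio_def wt_diff)
qed

text \<open>The coefficients of \<open>1 / (1 - c v/u)\<close>; the exponent of \<open>v\<close> determines the only possible power.\<close>

definition geomf :: "complex \<Rightarrow> var \<Rightarrow> var \<Rightarrow> (var \<Rightarrow>\<^sub>0 int) \<Rightarrow> complex" where
  "geomf c v u N = (if lookup N v \<ge> 0 \<and> N = ratio v u (lookup N v) then c ^ nat (lookup N v) else 0)"

lemma cone_supported_geomf: "u \<in> sdown v \<Longrightarrow> cone_supported (geomf c v u)"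
  by (rule cone_supportedI[of "{u, v}" _ 0], simp)
    (metis geomf_def ratio_in_cone)

definition geomc :: "complex \<Rightarrow> var \<Rightarrow> var \<Rightarrow> complex cseries" where
  "geomc c v u = Abs_cseries (geomf c v u)"

lemma cf_geomc: "u \<in> sdown v \<Longrightarrow> cf (geomc c v u) = geomf c v u"
  by (simp add: geomc_def cone_supported_geomf)

lemma cf_emb_single_mult: "cf (emb (Poly_Mapping.single M c) * B) N = c * cf B (N - M)"
proof -
  have "cf (emb (Poly_Mapping.single M c)) = (\<lambda>N. if N = M then c else 0)"
    by (auto simp: cf_emb lookup_single when_def fun_eq_iff)
  then show ?thesis by (simp only: cf_mult conv_monomial_left)
qed

lemma geomc_inverse:
  assumes "u \<in> sdown v"
  shows "(1 - emb (Poly_Mapping.single (ratio v u 1) c)) * geomc c v u = 1"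
proof (rule cseries_eqI)
  fix N :: "var \<Rightarrow>\<^sub>0 int"
  have uv: "u \<noteq> v" using assms by auto
  let ?n = "lookup N v"
  have l: "lookup (N - ratio v u 1) v = ?n - 1"
    by (simp add: lookup_minus lookup_ratio uv)
  have shift: "N - ratio v u 1 = ratio v u (?n - 1) \<longleftrightarrow> N = ratio v u ?n"
    by (simp add: ratio_diff)
  have "geomf c v u N - c * geomf c v u (N - ratio v u 1) = (if N = 0 then 1 else 0)"
  proof (cases "N = ratio v u ?n")
    case True
    have N0: "N = 0 \<longleftrightarrow> ?n = 0" using True by (metis lookup_zero ratio_0)
    have "geomf c v u N = (if ?n \<ge> 0 then c ^ nat ?n else 0)"
      using True by (simp add: geomf_def)
    moreover have "geomf c v u (N - ratio v u 1) = (if ?n - 1 \<ge> 0 then c ^ nat (?n - 1) else 0)"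
      using True l shift by (simp only: geomf_def) simp
    moreover have "c * c ^ nat (?n - 1) = c ^ nat ?n" if "?n > 0"
    proof -
      have "nat ?n = Suc (nat (?n - 1))" using that by simp
      then show ?thesis by (metis power_Suc)
    qed
    ultimately show ?thesis
      using N0 by (cases "?n = 0"; cases "?n > 0") auto
  next
    case False
    then have "N \<noteq> 0" by auto
    with False shift l show ?thesis by (simp add: geomf_def)
  qed
  then show "cf ((1 - emb (Poly_Mapping.single (ratio v u 1) c)) * geomc c v u) N = cf 1 N"
    by (simp add: left_diff_distrib cf_emb_single_mult cf_geomc assms cf_one)
qed

text \<open>The inverse of the linear form \<open>x u + y v\<close>, expanded with respect to the larger of the two variables.\<close>

definition lf_inv :: "complex \<Rightarrow> var \<Rightarrow> complex \<Rightarrow> var \<Rightarrow> complex cseries" where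
  "lf_inv x u y v = (if u \<in> sdown v
     then emb (Poly_Mapping.single (expo u (- 1)) (1 / x)) * geomc (- y / x) v u
     else emb (Poly_Mapping.single (expo v (- 1)) (1 / y)) * geomc (- x / y) u v)"

abbreviation inv_row :: "complex \<Rightarrow> complex \<Rightarrow> var \<Rightarrow> var list \<Rightarrow> complex cseries" where
  "inv_row x y v us \<equiv> prod_list (map (\<lambda>u. lf_inv x v y u) us)"

lemma lf_inv_swap: "u \<noteq> v \<Longrightarrow> lf_inv x u y v = lf_inv y v x u"
  using sdown_linear[of u v] sdown_asym[of u v] sdown_asym[of v u] by (auto simp: lf_inv_def)

lemma lf_inv_inverse_aux:
  assumes "u \<in> sdown v" "x \<noteq> 0"
  shows "emb (lf x u y v) * lf_inv x u y v = 1"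
proof -
  have "lf x u y v * Poly_Mapping.single (expo u (- 1)) (1 / x)
    = 1 - Poly_Mapping.single (ratio v u 1) (- y / x)"
    using assms by (simp add: lf_def distrib_right mult_single ratio_def single_add[symmetric]
        single_uminus)
  then have "emb (lf x u y v) * emb (Poly_Mapping.single (expo u (- 1)) (1 / x))
    = 1 - emb (Poly_Mapping.single (ratio v u 1) (- y / x))"
    by (metis emb_mult emb_diff emb_1)
  then show ?thesis
    using geomc_inverse[OF assms(1), of "- y / x"] assms(1)
    by (simp only: lf_inv_def if_True mult.assoc[symmetric])
qed

text \<open>Taking out the larger variable leaves a geometric series in the ratio of the smaller to the larger one.\<close>

lemma lf_inv_inverse:
  assumes "u \<noteq> v" "x \<noteq> 0" "y \<noteq> 0"
  shows "emb (lf x u y v) * lf_inv x u y v = 1"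
  using sdown_linear[OF assms(1)] lf_inv_inverse_aux[of u v x y] lf_inv_inverse_aux[of v u y x] assms
    lf_inv_swap[of u v x y] lf_swap[of x u y v] by auto

subsection \<open>The series of the statement as cone-supported series\<close>

lemma sprod_cf: "cf A \<star> cf B = cf (A * B)"
  by (simp add: sprod_def cf_mult conv_def)

lemma monomial_cf: "monomial c M = cf (sc (emb (Poly_Mapping.single M c)))"
  by (auto simp: monomial_def cf_emb lookup_single when_def fun_eq_iff)

lemma sprod_list_cf: "sprod_list (map cf As) = cf (prod_list As)"
proof (induction As)
  case Nil
  show ?case by (simp add: sprod_list_def monomial_cf)
next
  case (Cons A As)
  then show ?case by (simp add: sprod_list_def sprod_cf)
qed

lemma sprod_list_map_cf: "sprod_list (map (\<lambda>x. cf (f x)) xs) = cf (prod_list (map f xs))"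
  using sprod_list_cf[of "map f xs"] by (simp add: comp_def)

lemma lin_cf: "lin x i y j = cf (sc (emb (lf x (T i) y (T j))))"
  by (simp add: lin_def lf_def emb_add sc_add monomial_cf fun_eq_iff)

lemma geom_cf:
  assumes "u \<in> sdown v"
  shows "geom c v u = cf (sc (geomc c v u))"
proof
  fix N
  have uv: "u \<noteq> v" using assms by auto
  have eq: "monomial (c ^ k) (expo v (int k) - expo u (int k)) N
    = (if k = nat (lookup N v) then scal (geomf c v u N) else 0)" for k
  proof (cases "N = ratio v u (int k)")
    case True
    then have "lookup N v = int k" by (simp add: lookup_ratio uv)
    with True show ?thesis by (simp add: monomial_def geomf_def ratio_def)
  next
    case False
    then show ?thesis by (auto simp: monomial_def geomf_def ratio_def)
  qed
  show "geom c v u N = cf (sc (geomc c v u)) N"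
    by (simp add: geom_def eq cf_geomc assms)
qed

lemma T_in_sdown [simp]: "T i \<in> sdown (T j) \<longleftrightarrow> i < j"
  by (simp add: sdown_def)

lemma T_sdown_W [simp]: "T i \<in> sdown (W j)"
  by (simp add: sdown_def)

lemma W_in_sdown [simp]: "W i \<in> sdown (W j) \<longleftrightarrow> j < i"
  by (auto simp: sdown_def)

lemma W_sdown_T [simp]: "W i \<notin> sdown (T j)"
  by (simp add: sdown_def)

lemma recip_cf:
  assumes "i \<noteq> j"
  shows "recip x i y j = cf (sc (lf_inv x (T i) y (T j)))"
  using assms
  by (auto simp: recip_def lf_inv_def monomial_cf geom_cf sprod_cf sc_mult)

lemma cone_supported_f_plus: "cone_supported (f_plus v)"
proof (rule cone_supportedI)
  fix N assume "f_plus v N \<noteq> 0"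
  then have "N = expo v (lookup N v)" "lookup N v < 0"
    by (auto simp: f_plus_def Let_def split: if_splits)
  moreover have "expo v k \<in> cone {v} 0" if "k < 0" for k
    using that by (auto simp: cone_def)
  ultimately show "N \<in> cone {v} 0" by metis
qed simp

definition fp :: "var \<Rightarrow> falg cseries" where
  "fp v = Abs_cseries (f_plus v)"

lemma cf_fp: "cf (fp v) = f_plus v"
  by (simp add: fp_def cone_supported_f_plus)

definition phi_series :: "complex \<Rightarrow> nat \<Rightarrow> nat \<Rightarrow> nat list \<Rightarrow> complex cseries" where
  "phi_series q m s ss =
     prod_list (map (\<lambda>i. emb (lf 1 (T s) (- 1) (T i)) * lf_inv 1 (T m) (- 1) (T i)) (filter (\<lambda>i. i \<noteq> m) ss))
   * prod_list (map (\<lambda>i. emb (lf (1 / q) (T m) (- q) (T i)) * lf_inv (1 / q) (T s) (- q) (T i)) ss)"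

lemma concat_map_if: "concat (map (\<lambda>i. if P i then [f i] else []) xs) = map f (filter P xs)"
  by (induction xs) auto

lemma phi_cf:
  assumes "s \<notin> set ss"
  shows "phi q m s ss = cf (sc (phi_series q m s ss))"
proof -
  let ?f = "\<lambda>i. sc (emb (lf 1 (T s) (- 1) (T i)) * lf_inv 1 (T m) (- 1) (T i))"
  let ?g = "\<lambda>i. sc (emb (lf (1 / q) (T m) (- q) (T i)) * lf_inv (1 / q) (T s) (- q) (T i))"
  have "[lin 1 s (- 1) i \<star> recip 1 m (- 1) i. i \<leftarrow> ss, i \<noteq> m] = map cf (map ?f (filter (\<lambda>i. i \<noteq> m) ss))"
    unfolding concat_map_if
    by (auto simp: lin_cf recip_cf sprod_cf sc_mult)
  moreover have "[lin (1 / q) m (- q) i \<star> recip (1 / q) s (- q) i. i \<leftarrow> ss] = map cf (map ?g ss)"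
  proof -
    have "recip (1 / q) s (- q) i = cf (sc (lf_inv (1 / q) (T s) (- q) (T i)))" if "i \<in> set ss" for i
      using that assms by (intro recip_cf) auto
    then show ?thesis by (auto simp: lin_cf sprod_cf sc_mult)
  qed
  ultimately show ?thesis
    by (simp only: phi_def sprod_list_map_cf sprod_cf phi_series_def sc_mult sc_prod_list map_map comp_def)
qed

definition fp_shifted :: "complex \<Rightarrow> nat \<Rightarrow> nat list \<Rightarrow> falg cseries" where
  "fp_shifted q s ss = fp (T s) - (\<Sum>m\<leftarrow>ss. sc (phi_series q m s ss) * fp (T m))"

lemma cf_sum_list: "cf (sum_list As) N = (\<Sum>A\<leftarrow>As. cf A N)"
  by (induction As) auto

lemma f_plus_shifted_cf:
  assumes "s \<notin> set ss"
  shows "f_plus_shifted q s ss = cf (fp_shifted q s ss)"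
  by (auto simp: f_plus_shifted_def fp_shifted_def cf_sum_list phi_cf[OF assms] cf_fp[symmetric] sprod_cf
      comp_def fun_eq_iff)

text \<open>The product over all pairs, the earlier entry of the list being the first argument.\<close>

primrec pairprod :: "('a \<Rightarrow> 'a \<Rightarrow> 'b::comm_monoid_mult) \<Rightarrow> 'a list \<Rightarrow> 'b" where
  "pairprod g [] = 1"
| "pairprod g (v # vs) = prod_list (map (g v) vs) * pairprod g vs"

lemma prod_list_pairs_upt:
  "prod_list (concat (map (\<lambda>i. map (g i) [i + 1..<n]) [m..<n])) = pairprod g [m..<n]"
proof (induction "n - m" arbitrary: m)
  case (Suc k)
  then have "m < n" "k = n - Suc m" by auto
  then show ?case using Suc(1)[of "Suc m"] by (simp add: upt_conv_Cons)
qed simp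

lemma pairprod_map: "pairprod g (map f vs) = pairprod (\<lambda>u v. g (f u) (f v)) vs"
  by (induction vs) (auto simp: comp_def)

lemma pairprod_mult: "pairprod (\<lambda>u v. g u v * h u v) vs = pairprod g vs * pairprod h vs"
proof -
  have "prod_list (map (\<lambda>v. g u v * h u v) ws) = prod_list (map (g u) ws) * prod_list (map (h u) ws)" for u ws
    by (induction ws) (auto simp: ac_simps)
  then show ?thesis by (induction vs) (auto simp: ac_simps)
qed

lemma emb_pairprod: "emb (pairprod g vs) = pairprod (\<lambda>u v. emb (g u v)) vs"
  by (induction vs) (auto simp: emb_mult emb_prod_list comp_def)

lemma pairprod_one:
  assumes "distinct vs" "\<And>u v. u \<in> set vs \<Longrightarrow> v \<in> set vs \<Longrightarrow> u \<noteq> v \<Longrightarrow> g u v = 1"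
  shows "pairprod g vs = 1"
  using assms
proof (induction vs)
  case (Cons v vs)
  have "prod_list (map (g v) vs) = prod_list (map (\<lambda>_. 1) vs)"
    by (rule arg_cong[of _ _ prod_list], rule map_cong) (use Cons.prems in auto)
  moreover have "prod_list (map (\<lambda>_. 1) vs) = (1 :: 'b)" by (induction vs) auto
  ultimately show ?case using Cons by simp
qed simp

abbreviation tvars :: "nat \<Rightarrow> var list" where
  "tvars a \<equiv> map T [1..<a + 1]"

definition rhs1 :: "complex \<Rightarrow> nat \<Rightarrow> falg cseries" where
  "rhs1 q a = sc (pairprod (\<lambda>u v. emb (lf (1 / q) u (- q) v)) (tvars a) * pairprod (\<lambda>u v. lf_inv q u (- 1 / q) v) (tvars a))
     * prod_list (map (\<lambda>i. fp_shifted q i [i + 1..<a + 1]) (rev [1..<a + 1]))"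

lemma pairs_cf:
  "sprod_list [lin x i y j \<star> recip x' i y' j. i \<leftarrow> [1..<a + 1], j \<leftarrow> [i + 1..<a + 1]]
   = cf (sc (pairprod (\<lambda>u v. emb (lf x u y v)) (tvars a) * pairprod (\<lambda>u v. lf_inv x' u y' v) (tvars a)))"
proof -
  let ?g = "\<lambda>i j. emb (lf x (T i) y (T j)) * lf_inv x' (T i) y' (T j)"
  have "[lin x i y j \<star> recip x' i y' j. i \<leftarrow> [1..<a + 1], j \<leftarrow> [i + 1..<a + 1]]
    = map cf (map sc (concat (map (\<lambda>i. map (?g i) [i + 1..<a + 1]) [1..<a + 1])))"
    unfolding map_concat
    by (rule arg_cong[of _ _ concat])
      (auto simp: lin_cf recip_cf sprod_cf sc_mult comp_def)
  then show ?thesis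
    by (simp only: sprod_list_cf sc_prod_list[symmetric] prod_list_pairs_upt pairprod_map pairprod_mult)
qed

lemma weight_rhs1_cf: "weight_rhs1 q a = cf (rhs1 q a)"
proof -
  have "[f_plus_shifted q i [i + 1..<a + 1]. i \<leftarrow> rev [1..<a + 1]]
     = map cf (map (\<lambda>i. fp_shifted q i [i + 1..<a + 1]) (rev [1..<a + 1]))"
    by (auto simp: f_plus_shifted_cf)
  then show ?thesis
    by (simp only: weight_rhs1_def pairs_cf sprod_list_cf sprod_cf rhs1_def)
qed

lift_definition oi :: "var \<Rightarrow> 'a::zero cseries \<Rightarrow> 'a cseries" is "\<lambda>v A N. if lookup N v = 0 then A N else 0"
proof -
  fix v and A :: "(var \<Rightarrow>\<^sub>0 int) \<Rightarrow> 'a" assume "cone_supported A"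
  then obtain V c where "finite V" "\<forall>N. A N \<noteq> 0 \<longrightarrow> N \<in> cone V c"
    unfolding cone_supported_def by blast
  then show "cone_supported (\<lambda>N. if lookup N v = 0 then A N else 0)"
    by (intro cone_supportedI[of V _ c]) (auto split: if_splits)
qed

lemma cf_oi: "cf (oi v A) N = (if lookup N v = 0 then cf A N else 0)"
  by transfer simp

abbreviation Zfactor :: "complex \<Rightarrow> nat \<Rightarrow> nat \<Rightarrow> complex cseries" where
  "Zfactor q i j \<equiv> emb (Poly_Mapping.single 0 q + Poly_Mapping.single (ratio (W j) (T i) 1) (- 1 / q)) * geomc 1 (W j) (T i)"

definition Zfac :: "complex \<Rightarrow> nat \<Rightarrow> complex cseries" where
  "Zfac q i = emb (Poly_Mapping.single (ratio (W i) (T i) 1) 1) * geomc 1 (W i) (T i)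
     * prod_list (map (\<lambda>j. Zfactor q i j) [1..<i])"

lemma Zkernel_cf: "Zkernel q a = cf (sc (prod_list (map (Zfac q) [1..<a + 1])))"
proof -
  have inner: "sprod_list [(\<lambda>N. monomial q 0 N + monomial (- 1 / q) (expo (W j) 1 - expo (T i) 1) N)
           \<star> geom 1 (W j) (T i). j \<leftarrow> [1..<i]]
     = cf (sc (prod_list (map (\<lambda>j. Zfactor q i j) [1..<i])))" for i
  proof -
    have lin: "(\<lambda>N. monomial q 0 N + monomial (- 1 / q) (expo (W j) 1 - expo (T i) 1) N)
      = cf (sc (emb (Poly_Mapping.single 0 q + Poly_Mapping.single (ratio (W j) (T i) 1) (- 1 / q))))" for j
      by (simp add: monomial_cf emb_add sc_add fun_eq_iff ratio_def)
    show ?thesis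
      unfolding lin
      by (simp add: geom_cf sprod_cf sprod_list_cf[symmetric] sc_mult sc_prod_list comp_def)
  qed
  have "[(monomial 1 (expo (W i) 1 - expo (T i) 1) \<star> geom 1 (W i) (T i))
      \<star> sprod_list
          [(\<lambda>N. monomial q 0 N + monomial (- 1 / q) (expo (W j) 1 - expo (T i) 1) N)
           \<star> geom 1 (W j) (T i). j \<leftarrow> [1..<i]].
      i \<leftarrow> [1..<a + 1]] = map cf (map sc (map (Zfac q) [1..<a + 1]))"
    unfolding inner
    by (simp add: monomial_cf geom_cf sprod_cf Zfac_def sc_mult ratio_def mult.assoc)
  then show ?thesis
    by (simp only: Zkernel_def sprod_list_cf sc_prod_list)
qed

section \<open>The quotient algebra and the projection\<close>

abbreviation falg_ring :: "falg ring" where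
  "falg_ring \<equiv> ring_of_type_algebra"

lemma falg_ring_simps [simp]:
  "carrier falg_ring = UNIV" "x \<otimes>\<^bsub>falg_ring\<^esub> y = x * y" "x \<oplus>\<^bsub>falg_ring\<^esub> y = x + y"
  "\<one>\<^bsub>falg_ring\<^esub> = 1" "\<zero>\<^bsub>falg_ring\<^esub> = 0"
  by (simp_all add: ring_of_type_algebra_def)

lemma ring_falg: "ring falg_ring"
proof -
  have "\<exists>y. x + y = 0" for x :: falg
    using add.right_inverse by blast
  then show ?thesis
    unfolding ring_of_type_algebra_def using add.right_inverse
    by unfold_locales (auto simp: algebra_simps Units_def)
qed

interpretation R: ring falg_ring
  by (rule ring_falg)

lemma falg_ring_uminus: "\<ominus>\<^bsub>falg_ring\<^esub> x = - x"
  by (rule R.minus_equality) auto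

lemma falg_ring_minus: "x \<ominus>\<^bsub>falg_ring\<^esub> y = x - y"
  by (simp add: a_minus_def falg_ring_uminus)

lemma ideal_rel: "ideal (rel_ideal q) falg_ring"
  unfolding rel_ideal_def by (rule R.genideal_ideal) simp

lemma relators_subset: "relators q \<subseteq> rel_ideal q"
  unfolding rel_ideal_def by (rule R.genideal_self) simp

lemma rel_ideal_mult:
  assumes "x \<in> rel_ideal q"
  shows "y * x \<in> rel_ideal q" "x * y \<in> rel_ideal q"
  using ideal.I_l_closed[OF ideal_rel assms, of y] ideal.I_r_closed[OF ideal_rel assms, of y] by auto

lemma ring_Uq: "ring (Uq q)"
  unfolding Uq_def by (rule ideal.quotient_is_ring[OF ideal_rel])

lemma cls_hom: "cls q \<in> ring_hom falg_ring (Uq q)"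
proof -
  have "cls q = (+>\<^bsub>falg_ring\<^esub>) (rel_ideal q)"
    by (simp add: cls_def fun_eq_iff)
  then show ?thesis
    unfolding Uq_def using ideal.rcos_ring_hom[OF ideal_rel, of q] by simp
qed

lemma cls_carrier [simp]: "cls q x \<in> carrier (Uq q)"
  using ring_hom_closed[OF cls_hom] by simp

lemma cls_mult: "cls q (x * y) = cls q x \<otimes>\<^bsub>Uq q\<^esub> cls q y"
  using ring_hom_mult[OF cls_hom, of x y q] by simp

lemma cls_add: "cls q (x + y) = cls q x \<oplus>\<^bsub>Uq q\<^esub> cls q y"
  using ring_hom_add[OF cls_hom, of x y q] by simp

lemma cls_zero: "cls q 0 = \<zero>\<^bsub>Uq q\<^esub>"
  using ring_hom_zero[OF cls_hom ring_falg ring_Uq, of q] by simp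

lemma cls_eqI:
  assumes "x - y \<in> rel_ideal q"
  shows "cls q x = cls q y"
  using R.quotient_eq_iff_same_a_r_cos[OF ideal_rel, of x y q] assms
  by (simp add: falg_ring_minus cls_def)

lemma cls_relator: "x \<in> rel_ideal q \<Longrightarrow> cls q x = \<zero>\<^bsub>Uq q\<^esub>"
  using cls_eqI[of x 0 q] cls_zero by simp

subsection \<open>The counit\<close>

lemma counit_free_superset:
  assumes "finite I" "keys x \<subseteq> I"
  shows "counit_free x = (\<Sum>w\<in>I. lookup x w * counit_word w)"
  unfolding counit_free_def
  by (rule sum.mono_neutral_left) (use assms in \<open>auto simp: in_keys_iff\<close>)

lemma counit_free_add: "counit_free (x + y) = counit_free x + counit_free y"
proof -
  let ?I = "keys x \<union> keys y"
  have "keys (x + y) \<subseteq> ?I" by (rule keys_add)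
  then show ?thesis
    by (simp add: counit_free_superset[of ?I] lookup_add distrib_right sum.distrib)
qed

lemma counit_free_0 [simp]: "counit_free 0 = 0"
  by (simp add: counit_free_def)

lemma counit_free_uminus: "counit_free (- x) = - counit_free x"
  using counit_free_add[of x "- x"] by (simp add: add_eq_0_iff)

lemma counit_free_diff: "counit_free (x - y) = counit_free x - counit_free y"
  using counit_free_add[of x "- y"] by (simp add: counit_free_uminus)

lemma counit_free_single: "counit_free (Poly_Mapping.single w c) = c * counit_word w"
  by (subst counit_free_superset[of "{w}"]) auto

lemma counit_word_add: "counit_word (u + v) = counit_word u * counit_word v"
  by (simp add: counit_word_def plus_word_def)

lemma counit_free_mult: "counit_free (x * y) = counit_free x * counit_free y"
proof (induction x rule: poly_mapping_single_induct)
  case (2 u c f)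
  have "counit_free (Poly_Mapping.single u c * y) = c * counit_word u * counit_free y" for u c
    by (induction y rule: poly_mapping_single_induct)
      (simp_all add: distrib_left counit_free_add mult_single counit_free_single counit_word_add)
  with 2 show ?case by (simp add: distrib_right counit_free_add counit_free_single)
qed simp

lemma counit_free_scal: "counit_free (scal c) = c"
  by (simp add: scal_def counit_free_single counit_word_def zero_word_def)

lemma counit_free_1: "counit_free 1 = 1"
  using counit_free_scal[of 1] by simp

lemma counit_free_gen: "counit_free (gen g) = (if g = K \<or> g = Kinv then 1 else 0)"
  by (simp add: gen_def counit_free_single counit_word_def)

lemma counit_free_sum: "counit_free (sum f I) = (\<Sum>i\<in>I. counit_free (f i))"
  by (induction I rule: infinite_finite_induct) (auto simp: counit_free_add)

lemma counit_free_fps_mult_zero: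
  fixes A B :: "falg fps"
  assumes "\<And>i. counit_free (A $ i) = 0"
  shows "counit_free ((A * B) $ n) = 0"
  by (simp add: fps_mult_nth counit_free_sum counit_free_mult assms)

lemma counit_free_falg_exp:
  assumes "\<And>i. counit_free (A $ i) = 0"
  shows "counit_free (falg_exp A $ n) = (if n = 0 then 1 else 0)"
proof -
  have pow: "counit_free ((A ^ j) $ n) = (if j = 0 \<and> n = 0 then 1 else 0)" for j
    by (cases j) (simp_all add: counit_free_fps_mult_zero assms counit_free_1)
  have "counit_free (falg_exp A $ n) = (\<Sum>j\<le>n. 1 / fact j * (if j = 0 \<and> n = 0 then 1 else 0))"
    by (simp add: falg_exp_def counit_free_sum counit_free_mult counit_free_scal pow)
  also have "\<dots> = (if n = 0 then 1 else 0)"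
    by (cases "n = 0") auto
  finally show ?thesis .
qed

lemma counit_free_psi: "counit_free (psi q s $ n) = (if n = 0 then 1 else 0)"
proof -
  have "counit_free (psi_arg q s $ i) = 0" for i
    by (simp add: psi_arg_def counit_free_mult counit_free_gen)
  then show ?thesis
    by (simp add: psi_def counit_free_mult counit_free_falg_exp kpow_def counit_free_gen)
qed

lemma counit_free_conj:
  assumes "counit_free x = 0"
  shows "counit_free ((A * fps_const x * B) $ n) = 0"
  by (rule counit_free_fps_mult_zero) (simp add: counit_free_mult assms)

lemma counit_free_psi_mode: "s \<in> {1, -1} \<Longrightarrow> counit_free (psi_mode q s k) = (if k = 0 then 1 else 0)"
  by (auto simp: psi_mode_def counit_free_psi)

text \<open>The terms of a relator either contain a letter \<open>E\<close>, \<open>F\<close> or \<open>H\<close>, and then have counit zero, or come in pairs of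
  opposite sign and equal counit.\<close>

lemma counit_free_relators: "x \<in> relators q \<Longrightarrow> counit_free x = 0"
  unfolding relators_def
  by (elim UnE CollectE exE conjE insertE emptyE; hypsubst;
      simp add: counit_free_diff counit_free_conj counit_free_mult counit_free_gen counit_free_1 counit_free_psi_mode mult.commute)

lemma counit_free_rel_ideal: "x \<in> rel_ideal q \<Longrightarrow> counit_free x = 0"
proof -
  have "ideal {x. counit_free x = 0} falg_ring"
  proof (rule idealI[OF ring_falg])
    show "subgroup {x. counit_free x = 0} (add_monoid falg_ring)"
      by (rule R.add.subgroupI)
        (auto simp: counit_free_add falg_ring_uminus counit_free_uminus
          intro: exI[of _ 0])
  qed (auto simp: counit_free_mult)
  then have "rel_ideal q \<subseteq> {x. counit_free x = 0}"
    unfolding rel_ideal_def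
    by (rule R.genideal_minimal) (auto dest: counit_free_relators)
  then show "x \<in> rel_ideal q \<Longrightarrow> counit_free x = 0" by auto
qed

text \<open>The kernel of the counit of the free algebra is an ideal that contains the relators.\<close>

lemma counit_cls: "counit (cls q x) = counit_free x"
proof -
  have "0 \<in> rel_ideal q"
    using additive_subgroup.zero_closed[OF ideal.axioms(1)[OF ideal_rel], of q] by simp
  then have "counit_free ` cls q x = {counit_free x}"
    by (force simp: cls_def a_r_coset_def' counit_free_add counit_free_rel_ideal)
  then show ?thesis by (simp add: counit_def)
qed

subsection \<open>Words in the modes of the current\<close>

definition fw :: "int list \<Rightarrow> falg" where
  "fw ns = prod_list (map (\<lambda>n. gen (F n)) ns)"

lemma fw_Nil [simp]: "fw [] = 1" by (simp add: fw_def)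
lemma fw_Cons: "fw (n # ns) = gen (F n) * fw ns" by (simp add: fw_def)
lemma fw_append: "fw (ms @ ns) = fw ms * fw ns" by (simp add: fw_def)

definition ffrel :: "complex \<Rightarrow> int \<Rightarrow> int \<Rightarrow> falg" where
  "ffrel q m n = (gen (F (m + 1)) * gen (F n) - scal (1 / q ^ 2) * gen (F m) * gen (F (n + 1)))
       - (scal (1 / q ^ 2) * gen (F n) * gen (F (m + 1)) - gen (F (n + 1)) * gen (F m))"

lemma ffrel_in_rel_ideal: "ffrel q m n \<in> rel_ideal q"
  using relators_subset[of q] unfolding ffrel_def relators_def by blast

lemma falg_vector_space: "vector_space (\<lambda>c x. scal c * (x :: falg))"
  by unfold_locales (simp_all add: distrib_left distrib_right scal_add scal_mult mult.assoc)

interpretation V: vector_space "\<lambda>c x. scal c * (x :: falg)"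
  by (rule falg_vector_space)

definition rel_words :: "complex \<Rightarrow> falg set" where
  "rel_words q = {fw us * ffrel q m n * fw vs | us m n vs. True}"

lemma not_sorted_descent:
  fixes xs :: "int list"
  assumes "\<not> sorted xs"
  obtains us x y vs where "xs = us @ x # y # vs" "y < x"
proof -
  have "\<exists>us x y vs. xs = us @ x # y # vs \<and> y < x"
    using assms
  proof (induction xs rule: induct_list012)
    case (3 x y zs)
    show ?case
    proof (cases "y < x")
      case True
      then have "x # y # zs = [] @ x # y # zs \<and> y < x" by simp
      then show ?thesis by blast
    next
      case False
      then have "\<not> sorted (y # zs)" using 3(3) by (simp only: sorted2) simp
      with 3(2) obtain us a b vs where "y # zs = us @ a # b # vs" "b < a" by blast
      then have "x # y # zs = (x # us) @ a # b # vs \<and> b < a" by simp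
      then show ?thesis by blast
    qed
  qed auto
  with that show ?thesis by blast
qed

text \<open>Length and sum are recorded because they are what the support estimates need.\<close>

definition sorted_words :: "int list \<Rightarrow> falg set" where
  "sorted_words ns = {fw ms | ms. sorted ms \<and> length ms = length ns \<and> sum_list ms = sum_list ns}"

lemma sorted_words_cong:
  "length ms = length ns \<Longrightarrow> sum_list ms = sum_list ns \<Longrightarrow> sorted_words ms = sorted_words ns"
  by (simp add: sorted_words_def)

text \<open>The quadratic relation as a rewriting rule for a descent. At distance one the relation contains the
  descent twice, which is the source of the factor \<open>1/2\<close>.\<close>

lemma exchange_eq:
  assumes "q \<noteq> 0"
  shows "fw (us @ (m + 1) # m # vs) =
      scal (1 / 2) * (fw us * ffrel q m m * fw vs) + scal (1 / q\<^sup>2) * fw (us @ m # (m + 1) # vs)"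
    and "fw (us @ (m + 1) # n # vs) = fw us * ffrel q m n * fw vs
      + scal (1 / q\<^sup>2) * fw (us @ m # (n + 1) # vs) + scal (1 / q\<^sup>2) * fw (us @ n # (m + 1) # vs)
      - fw (us @ (n + 1) # m # vs)"
proof -
  have word: "fw (us @ x # y # vs) = fw us * (gen (F x) * gen (F y)) * fw vs" for x y
    by (simp add: fw_append fw_Cons mult.assoc)
  have "gen (F (m + 1)) * gen (F n) = ffrel q m n + scal (1 / q\<^sup>2) * (gen (F m) * gen (F (n + 1)))
      + scal (1 / q\<^sup>2) * (gen (F n) * gen (F (m + 1))) - gen (F (n + 1)) * gen (F m)"
    by (simp add: ffrel_def mult.assoc)
  then show "fw (us @ (m + 1) # n # vs) = fw us * ffrel q m n * fw vs
      + scal (1 / q\<^sup>2) * fw (us @ m # (n + 1) # vs) + scal (1 / q\<^sup>2) * fw (us @ n # (m + 1) # vs)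
      - fw (us @ (n + 1) # m # vs)"
    unfolding word
    by (simp only: distrib_left distrib_right left_diff_distrib right_diff_distrib scal_left_commute mult.assoc)
  have "ffrel q m m = scal 2 * (gen (F (m + 1)) * gen (F m)) - scal 2 * (scal (1 / q\<^sup>2) * (gen (F m) * gen (F (m + 1))))"
    using scal_add[of 1 1] by (simp add: ffrel_def mult.assoc mult_2)
  then have "scal (1 / 2) * ffrel q m m = gen (F (m + 1)) * gen (F m) - scal (1 / q\<^sup>2) * (gen (F m) * gen (F (m + 1)))"
    by (simp add: right_diff_distrib mult.assoc[symmetric] scal_mult[symmetric])
  then have "gen (F (m + 1)) * gen (F m) = scal (1 / 2) * ffrel q m m + scal (1 / q\<^sup>2) * (gen (F m) * gen (F (m + 1)))"
    by simp
  then show "fw (us @ (m + 1) # m # vs) =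
      scal (1 / 2) * (fw us * ffrel q m m * fw vs) + scal (1 / q\<^sup>2) * fw (us @ m # (m + 1) # vs)"
    unfolding word
    by (simp only: distrib_left distrib_right scal_left_commute mult.assoc)
qed

text \<open>Each term on the right-hand side of the rewriting rule has its new letters between the two old ones and is
  lexicographically smaller at the place of rewriting. The letters stay above the minimum of the
  word, so rewriting terminates; it preserves length and sum of indices.\<close>

lemma word_in_span_sorted:
  assumes "q \<noteq> 0"
  shows "fw ns \<in> V.span (rel_words q \<union> sorted_words ns)"
proof -
  \<comment> \<open>Subtracting a lower bound of the letters turns words into lists of natural numbers, on which the lexicographic order is well-founded.\<close>
  define lo where "lo = Min (insert 0 (set ns))"
  define code where "code ms = map (\<lambda>n. nat (n - lo)) ms" for ms
  have "\<forall>ns. (\<forall>n\<in>set ns. lo \<le> n) \<longrightarrow> k = code ns \<longrightarrow> fw ns \<in> V.span (rel_words q \<union> sorted_words ns)" for k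
  proof (induction k rule: wf_induct_rule[OF wf_lex[OF wf_less_than]])
    case (1 k)
    show ?case
    proof (intro allI impI)
      fix ns assume lo: "\<forall>n\<in>set ns. lo \<le> n" and k: "k = code ns"
      show "fw ns \<in> V.span (rel_words q \<union> sorted_words ns)"
      proof (cases "sorted ns")
        case True
        then show ?thesis by (intro V.span_base) (auto simp: sorted_words_def)
      next
        case False
        then obtain us m' n vs where ns: "ns = us @ m' # n # vs" "n < m'"
          by (rule not_sorted_descent)
        define m where "m = m' - 1"
        have m: "m' = m + 1" by (simp add: m_def)
        have step: "fw (us @ x # y # vs) \<in> V.span (rel_words q \<union> sorted_words ns)"
          if "x + y = m' + n" "x < m'" "lo \<le> x" "lo \<le> y" for x y
        proof -
          have "(code (us @ x # y # vs), k) \<in> lex less_than"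
            unfolding k ns code_def using that lo ns
            by (auto simp: lex_append_left_iff intro!: lex_append_leftI)
          moreover have "\<forall>n\<in>set (us @ x # y # vs). lo \<le> n" using that lo ns by auto
          moreover have "sorted_words (us @ x # y # vs) = sorted_words ns"
            using that ns by (intro sorted_words_cong) auto
          ultimately show ?thesis using 1 by metis
        qed
        have rel: "fw us * ffrel q m n * fw vs \<in> V.span (rel_words q \<union> sorted_words ns)" for m n
          by (intro V.span_base) (auto simp: rel_words_def)
        have lon: "lo \<le> n" "lo \<le> m'" using lo ns by auto
        show ?thesis
        proof (cases "m = n")
          case True
          have eq: "fw ns = scal (1 / 2) * (fw us * ffrel q m m * fw vs) + scal (1 / q\<^sup>2) * fw (us @ m # (m + 1) # vs)"
            unfolding ns(1) m True[symmetric] by (rule exchange_eq(1)[OF assms])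
          have "fw (us @ m # (m + 1) # vs) \<in> V.span (rel_words q \<union> sorted_words ns)"
            by (rule step) (use lon True m in auto)
          then show ?thesis
            by (subst eq) (intro V.span_add V.span_scale rel)
        next
          case False
          have eq: "fw ns = fw us * ffrel q m n * fw vs
            + scal (1 / q\<^sup>2) * fw (us @ m # (n + 1) # vs) + scal (1 / q\<^sup>2) * fw (us @ n # (m + 1) # vs)
            - fw (us @ (n + 1) # m # vs)"
            unfolding ns(1) m by (rule exchange_eq(2)[OF assms])
          moreover have "fw (us @ m # (n + 1) # vs) \<in> V.span (rel_words q \<union> sorted_words ns)"
            "fw (us @ n # (m + 1) # vs) \<in> V.span (rel_words q \<union> sorted_words ns)"
            "fw (us @ (n + 1) # m # vs) \<in> V.span (rel_words q \<union> sorted_words ns)"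
            by (rule step; use lon m ns False in simp)+
          ultimately show ?thesis
            by (subst eq) (intro V.span_add V.span_diff V.span_scale rel)
        qed
      qed
    qed
  qed
  moreover have "\<forall>n\<in>set ns. lo \<le> n" unfolding lo_def by auto
  ultimately show ?thesis by blast
qed

subsection \<open>The right ideal killed by the projection\<close>

text \<open>Words starting with a nonpositive mode are killed by the projection since the counit vanishes on their first letter.\<close>

definition Jgen :: "complex \<Rightarrow> falg set" where
  "Jgen q = rel_words q \<union> {fw (n # ns) | n ns. n \<le> 0}"

definition J :: "complex \<Rightarrow> falg set" where
  "J q = V.span (Jgen q)"

lemma subspace_J: "V.subspace (J q)"
  unfolding J_def by (rule V.subspace_span)

lemma span_mult_right:
  assumes "\<And>b. b \<in> B \<Longrightarrow> b * y \<in> V.span B'" "x \<in> V.span B"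
  shows "x * y \<in> V.span B'"
  using assms(2)
proof (induction rule: V.span_induct_alt)
  case (step c b x)
  have "(scal c * b + x) * y = scal c * (b * y) + x * y"
    by (simp add: distrib_right mult.assoc)
  with step assms(1) show ?case by (simp add: V.span_add V.span_scale)
qed (simp add: V.span_zero)

lemma J_mult_fw: "x \<in> J q \<Longrightarrow> x * fw ns \<in> J q"
  unfolding J_def
proof (rule span_mult_right)
  fix b assume "b \<in> Jgen q"
  then consider us m n vs where "b = fw us * ffrel q m n * fw vs" | n ms where "b = fw (n # ms)" "n \<le> 0"
    by (auto simp: Jgen_def rel_words_def)
  then show "b * fw ns \<in> V.span (Jgen q)"
  proof cases
    case 1
    then have "b * fw ns = fw us * ffrel q m n * fw (vs @ ns)"
      by (simp add: fw_append mult.assoc)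
    then show ?thesis by (intro V.span_base) (auto simp: Jgen_def rel_words_def)
  next
    case 2
    then have "b * fw ns = fw (n # (ms @ ns))"
      by (simp add: fw_append fw_Cons mult.assoc)
    with 2 show ?thesis by (intro V.span_base) (auto simp: Jgen_def)
  qed
qed

lemma sum_list_ge_length: "(\<And>n. n \<in> set ns \<Longrightarrow> 1 \<le> n) \<Longrightarrow> int (length ns) \<le> sum_list ns"
  by (induction ns) (auto, force)

text \<open>A weakly increasing word whose sum is smaller than its length has a nonpositive letter, hence a
  nonpositive first letter.\<close>

lemma word_in_J:
  assumes "q \<noteq> 0" "sum_list us < int (length us)"
  shows "fw (us @ vs) \<in> J q"
proof -
  have "sorted_words us \<subseteq> J q"
  proof
    fix x assume "x \<in> sorted_words us"
    then obtain ms where ms: "x = fw ms" "sorted ms" "length ms = length us" "sum_list ms = sum_list us"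
      by (auto simp: sorted_words_def)
    from ms assms have "\<not> (\<forall>n\<in>set ms. 1 \<le> n)"
      using sum_list_ge_length[of ms] by force
    then obtain n0 where n0: "n0 \<in> set ms" "n0 \<le> 0" by force
    then obtain n ms' where "ms = n # ms'" by (cases ms) auto
    with n0 ms(2) have "n \<le> 0" by auto
    with \<open>ms = n # ms'\<close> ms(1) show "x \<in> J q"
      unfolding J_def by (intro V.span_base) (auto simp: Jgen_def)
  qed
  moreover have "rel_words q \<subseteq> J q"
    unfolding J_def Jgen_def using V.span_superset by blast
  ultimately have "V.span (rel_words q \<union> sorted_words us) \<subseteq> J q"
    by (intro V.span_minimal subspace_J) auto
  then have "fw us \<in> J q" using word_in_span_sorted[OF assms(1), of us] by blast
  then show ?thesis by (simp add: fw_append J_mult_fw)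
qed

lemma ffrel_word_in_J: "fw us * ffrel q m n * fw vs \<in> J q"
  unfolding J_def by (intro V.span_base) (auto simp: Jgen_def rel_words_def)

definition is_normalizer :: "complex \<Rightarrow> (falg \<Rightarrow> falg) \<Rightarrow> bool" where
  "is_normalizer q f \<longleftrightarrow> (\<forall>x y. f (x + y) = f x + f y) \<and> (\<forall>c x. f (scal c * x) = scal c * f x)
     \<and> (\<forall>x\<in>J q. f x = 0) \<and> (\<forall>x. x - f x \<in> J q)"

text \<open>A linear complement of \<open>J\<close> gives a linear map with kernel \<open>J\<close> whose values differ from the
  arguments by elements of \<open>J\<close>; congruences become equations.\<close>

lemma normalizer_exists: "\<exists>f. is_normalizer q f"
proof -
  interpret VV: vector_space_pair "\<lambda>c x. scal c * (x :: falg)" "\<lambda>c x. scal c * (x :: falg)" ..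
  have "\<exists>g. g ` UNIV \<subseteq> J q \<and> Vector_Spaces.linear (\<lambda>c x. scal c * x) (\<lambda>c x. scal c * x) g \<and> (\<forall>v\<in>J q. g (id v) = v)"
    by (rule VV.linear_exists_left_inverse_on) (auto simp: subspace_J V.linear_ident)
  then obtain g where g: "g ` UNIV \<subseteq> J q" "\<forall>v\<in>J q. g v = v"
    and lin: "Vector_Spaces.linear (\<lambda>c x. scal c * x) (\<lambda>c x. scal c * x) g" by auto
  have "g (x + y) = g x + g y" "g (scal c * x) = scal c * g x" for x y c
    using lin by (simp_all add: Vector_Spaces.linear_iff)
  with g have "is_normalizer q (\<lambda>x. x - g x)"
    by (auto simp: is_normalizer_def right_diff_distrib)
  then show ?thesis by blast
qed

definition nf :: "complex \<Rightarrow> falg \<Rightarrow> falg" where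
  "nf q = (SOME f. is_normalizer q f)"

lemma nf_normalizer: "is_normalizer q (nf q)"
  using someI_ex[OF normalizer_exists[of q]] by (simp add: nf_def)

lemma nf_add: "nf q (x + y) = nf q x + nf q y"
  and nf_scal: "nf q (scal c * x) = scal c * nf q x"
  and nf_J: "x \<in> J q \<Longrightarrow> nf q x = 0"
  and diff_nf_in_J: "x - nf q x \<in> J q"
  using nf_normalizer[of q] by (auto simp: is_normalizer_def)

lemma nf_0 [simp]: "nf q 0 = 0"
  using nf_add[of q 0 0] by simp

lemma nf_uminus: "nf q (- x) = - nf q x"
  using nf_add[of q x "- x"] by (simp add: add_eq_0_iff)

lemma nf_diff: "nf q (x - y) = nf q x - nf q y"
  using nf_add[of q x "- y"] by (simp add: nf_uminus)

lemma nf_eq_imp_diff_in_J: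
  assumes "nf q x = nf q y"
  shows "x - y \<in> J q"
proof -
  have "(x - nf q x) - (y - nf q y) \<in> J q"
    using subspace_J by (intro V.subspace_diff diff_nf_in_J)
  then show ?thesis using assms by simp
qed

text \<open>Reduction is compatible with right multiplication because \<open>J\<close> is a right ideal.\<close>

lemma nf_nf_mult_fw: "nf q (nf q x * fw ns) = nf q (x * fw ns)"
proof -
  have "(x - nf q x) * fw ns \<in> J q" by (intro J_mult_fw diff_nf_in_J)
  from nf_J[OF this] show ?thesis by (simp add: left_diff_distrib nf_diff)
qed

subsection \<open>Evaluation of the projection\<close>

lemma cls_scal_subalgebra: "cls q (scal c) \<in> subalgebra_gen q G"
  unfolding subalgebra_gen_def by (rule generate_ring.incl) auto

lemma cls_gen_subalgebra: "g \<in> G \<Longrightarrow> cls q (gen g) \<in> subalgebra_gen q G"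
  unfolding subalgebra_gen_def by (rule generate_ring.incl) auto

lemma cls_mult_subalgebra:
  "cls q x \<in> subalgebra_gen q G \<Longrightarrow> cls q y \<in> subalgebra_gen q G \<Longrightarrow> cls q (x * y) \<in> subalgebra_gen q G"
  unfolding subalgebra_gen_def cls_mult by (rule generate_ring.eng_mult)

lemma cls_add_subalgebra:
  "cls q x \<in> subalgebra_gen q G \<Longrightarrow> cls q y \<in> subalgebra_gen q G \<Longrightarrow> cls q (x + y) \<in> subalgebra_gen q G"
  unfolding subalgebra_gen_def cls_add by (rule generate_ring.eng_add)

lemma cls_fw_subalgebra:
  assumes "F ` set ns \<subseteq> G"
  shows "cls q (fw ns) \<in> subalgebra_gen q G"
  using assms
proof (induction ns)
  case Nil
  then show ?case using cls_scal_subalgebra[of q 1] by simp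
next
  case (Cons n ns)
  then show ?case unfolding fw_Cons by (intro cls_mult_subalgebra cls_gen_subalgebra) auto
qed

lemma cls_span_subalgebra:
  assumes "x \<in> V.span B" "\<And>b. b \<in> B \<Longrightarrow> cls q b \<in> subalgebra_gen q G"
  shows "cls q x \<in> subalgebra_gen q G"
  using assms(1)
proof (induction rule: V.span_induct_alt)
  case base
  show ?case using cls_scal_subalgebra[of q 0] by simp
next
  case (step c b x)
  then show ?case
    using assms(2)[of b] by (intro cls_add_subalgebra cls_mult_subalgebra cls_scal_subalgebra) auto
qed

definition fwords :: "falg set" where "fwords = V.span (range fw)"

definition fwords_pos :: "falg set" where
  "fwords_pos = V.span {fw ns | ns. \<forall>n\<in>set ns. 0 < n}"

lemma cls_fwords: "x \<in> fwords \<Longrightarrow> cls q x \<in> UF q"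
  unfolding fwords_def UF_def
  by (erule cls_span_subalgebra) (auto intro!: cls_fw_subalgebra)

lemma cls_fwords_pos: "x \<in> fwords_pos \<Longrightarrow> cls q x \<in> UF_plus q"
  unfolding fwords_pos_def UF_plus_def
  by (erule cls_span_subalgebra) (auto intro!: cls_fw_subalgebra)

lemma ffrel_in_fwords: "fw us * ffrel q m n * fw vs \<in> fwords"
proof -
  have eq: "fw us * ffrel q m n * fw vs = fw (us @ (m + 1) # n # vs) - scal (1 / q\<^sup>2) * fw (us @ m # (n + 1) # vs)
     - (scal (1 / q\<^sup>2) * fw (us @ n # (m + 1) # vs) - fw (us @ (n + 1) # m # vs))"
    by (simp only: ffrel_def fw_append fw_Cons left_diff_distrib right_diff_distrib mult.assoc scal_left_commute)
  show ?thesis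
    unfolding fwords_def eq by (intro V.span_diff V.span_scale V.span_base rangeI)
qed

context
  fixes q P
  assumes P: "is_projection q P"
begin

lemma P_add: "x \<in> UF q \<Longrightarrow> y \<in> UF q \<Longrightarrow> P (x \<oplus>\<^bsub>Uq q\<^esub> y) = P x \<oplus>\<^bsub>Uq q\<^esub> P y"
  and P_scal: "x \<in> UF q \<Longrightarrow> P (cls q (scal c) \<otimes>\<^bsub>Uq q\<^esub> x) = cls q (scal c) \<otimes>\<^bsub>Uq q\<^esub> P x"
  and P_mult: "x \<in> Uf_minus q \<Longrightarrow> y \<in> UF_plus q \<Longrightarrow> P (x \<otimes>\<^bsub>Uq q\<^esub> y) = cls q (scal (counit x)) \<otimes>\<^bsub>Uq q\<^esub> y"
  using P by (auto simp: is_projection_def)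

lemma P_pos:
  assumes "y \<in> fwords_pos"
  shows "P (cls q y) = cls q y"
proof -
  have "cls q 1 \<in> Uf_minus q"
    unfolding Uf_minus_def using cls_scal_subalgebra[of q 1] by simp
  then have "P (cls q (1 * y)) = cls q (scal (counit (cls q 1)) * y)"
    unfolding cls_mult by (rule P_mult) (rule cls_fwords_pos[OF assms])
  then show ?thesis by (simp add: counit_cls counit_free_1)
qed

lemma P_zero: "P (cls q 0) = \<zero>\<^bsub>Uq q\<^esub>"
  using P_pos[of 0] by (simp add: fwords_pos_def V.span_zero cls_zero)

definition killed :: "falg set" where
  "killed = {x \<in> fwords. P (cls q x) = \<zero>\<^bsub>Uq q\<^esub>}"

lemma subspace_killed: "V.subspace killed"
proof -
  interpret U: ring "Uq q" by (rule ring_Uq)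
  show ?thesis
    unfolding V.subspace_def
  proof (intro conjI ballI allI)
    show "0 \<in> killed" by (simp add: killed_def fwords_def V.span_zero P_zero)
    show "x + y \<in> killed" if "x \<in> killed" "y \<in> killed" for x y
      using that by (auto simp: killed_def fwords_def V.span_add cls_add P_add cls_fwords[unfolded fwords_def])
    show "scal c * x \<in> killed" if "x \<in> killed" for c x
      using that by (auto simp: killed_def fwords_def V.span_scale cls_mult P_scal cls_fwords[unfolded fwords_def])
  qed
qed

lemma rel_words_killed: "rel_words q \<subseteq> killed"
proof
  fix x assume "x \<in> rel_words q"
  then obtain us m n vs where x: "x = fw us * ffrel q m n * fw vs"
    by (auto simp: rel_words_def)
  have "x \<in> rel_ideal q"
    unfolding x by (intro rel_ideal_mult ffrel_in_rel_ideal)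
  then have "cls q x = cls q 0" by (simp add: cls_relator cls_zero)
  then show "x \<in> killed" using x ffrel_in_fwords P_zero by (simp add: killed_def)
qed

text \<open>After the rest of the word is sorted, the word splits into a word in nonpositive modes, which is not
  empty and therefore has counit zero, and a word in positive modes.\<close>

lemma fw_nonpos_killed:
  assumes "n \<le> 0" "q \<noteq> 0"
  shows "fw (n # ns) \<in> killed"
proof -
  interpret U: ring "Uq q" by (rule ring_Uq)
  have "gen (F n) * x \<in> killed" if "x \<in> V.span (rel_words q \<union> sorted_words ns)" for x
    using that
  proof (induction rule: V.span_induct_alt)
    case base
    show ?case using V.subspace_0[OF subspace_killed] by simp
  next
    case (step c b y)
    have "gen (F n) * b \<in> killed"
    proof (cases "b \<in> rel_words q")
      case True
      then obtain us m k vs where "b = fw us * ffrel q m k * fw vs" by (auto simp: rel_words_def)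
      then have "gen (F n) * b = fw (n # us) * ffrel q m k * fw vs" by (simp add: fw_Cons mult.assoc)
      then have "gen (F n) * b \<in> rel_words q" unfolding rel_words_def by blast
      then show ?thesis using rel_words_killed by blast
    next
      case False
      then obtain ms where ms: "b = fw ms" "sorted ms" using step by (auto simp: sorted_words_def)
      define as where "as = takeWhile (\<lambda>k. k \<le> 0) ms"
      define bs where "bs = dropWhile (\<lambda>k. k \<le> 0) ms"
      have "0 < k" if "k \<in> set bs" for k
      proof -
        have "bs \<noteq> []" using that by auto
        then have "\<not> hd bs \<le> 0" unfolding bs_def by (rule hd_dropWhile)
        moreover have "sorted bs" unfolding bs_def using ms(2) by (rule sorted_dropWhile)
        ultimately show ?thesis using that by (cases bs) auto
      qed
      then have pos: "fw bs \<in> fwords_pos" unfolding fwords_pos_def by (intro V.span_base) auto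
      have "as @ bs = ms" by (simp add: as_def bs_def)
      then have eq: "gen (F n) * b = fw (n # as) * fw bs"
        using ms by (simp add: fw_append[symmetric] fw_Cons[symmetric])
      have "set as \<subseteq> {k. k \<le> 0}" by (auto simp: as_def dest: set_takeWhileD)
      then have "cls q (fw (n # as)) \<in> Uf_minus q"
        unfolding Uf_minus_def using assms by (intro cls_fw_subalgebra) auto
      moreover have "counit_free (fw (n # as)) = 0"
        by (simp add: fw_Cons counit_free_mult counit_free_gen)
      ultimately have "P (cls q (gen (F n) * b)) = cls q (scal 0) \<otimes>\<^bsub>Uq q\<^esub> cls q (fw bs)"
        unfolding eq cls_mult[of q "fw (n # as)"] using P_mult cls_fwords_pos[OF pos] by (simp add: counit_cls)
      moreover have "gen (F n) * b \<in> fwords"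
        unfolding ms fw_Cons[symmetric] fwords_def by (intro V.span_base) auto
      ultimately show ?thesis by (simp add: killed_def cls_zero)
    qed
    with step subspace_killed show ?case
      by (simp add: distrib_left scal_left_commute V.subspace_add V.subspace_scale)
  qed
  then show ?thesis using word_in_span_sorted[OF assms(2)] by (simp add: fw_Cons)
qed

lemma J_killed: "q \<noteq> 0 \<Longrightarrow> J q \<subseteq> killed"
  unfolding J_def Jgen_def
  by (rule V.span_minimal) (use rel_words_killed fw_nonpos_killed subspace_killed in auto)

text \<open>This reduces the theorem to congruences modulo \<open>J\<close>.\<close>

lemma projection_eq:
  assumes "q \<noteq> 0" "y \<in> fwords_pos" "nf q x = nf q y"
  shows "P (cls q x) = cls q y"
proof -
  interpret U: ring "Uq q" by (rule ring_Uq)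
  have "x - y \<in> killed" using nf_eq_imp_diff_in_J[OF assms(3)] J_killed[OF assms(1)] by blast
  then have *: "x - y \<in> fwords" "P (cls q (x - y)) = \<zero>\<^bsub>Uq q\<^esub>" by (auto simp: killed_def)
  have "y \<in> fwords"
    using assms(2) V.span_mono[of "{fw ns | ns. \<forall>n\<in>set ns. 0 < n}" "range fw"]
    unfolding fwords_pos_def fwords_def by auto
  have "P (cls q (x - y + y)) = P (cls q (x - y)) \<oplus>\<^bsub>Uq q\<^esub> P (cls q y)"
    unfolding cls_add by (rule P_add) (use * \<open>y \<in> fwords\<close> cls_fwords in auto)
  then show ?thesis using * P_pos[OF assms(2)] by simp
qed

end

section \<open>Products of currents modulo the right ideal\<close>

text \<open>The current and its positive part differ only in the condition on the exponents.\<close>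

definition modes :: "(int \<Rightarrow> bool) \<Rightarrow> var \<Rightarrow> series" where
  "modes p v = (\<lambda>N. let k = lookup N v in if N = expo v k \<and> p k then gen (F (- k)) else 0)"

definition word_series :: "(int \<Rightarrow> bool) \<Rightarrow> var list \<Rightarrow> series" where
  "word_series p vs = (\<lambda>N. if keys N \<subseteq> set vs \<and> (\<forall>v\<in>set vs. p (lookup N v))
     then fw (map (\<lambda>v. - lookup N v) vs) else 0)"

lemma f_current_modes: "f_current v = modes (\<lambda>_. True) v"
  by (simp add: f_current_def modes_def)

lemma f_plus_modes: "f_plus v = modes (\<lambda>k. k < 0) v"
  by (simp add: f_plus_def modes_def)

lemma keys_subset_iff: "keys N \<subseteq> V \<longleftrightarrow> (\<forall>v. v \<notin> V \<longrightarrow> lookup N v = 0)"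
  by (auto simp: in_keys_iff)

lemma modes_sprod:
  assumes "\<And>M. B M \<noteq> 0 \<Longrightarrow> lookup M v = 0"
  shows "(modes p v \<star> B) N = (if p (lookup N v) then gen (F (- lookup N v)) * B (N - expo v (lookup N v)) else 0)"
proof -
  let ?M = "expo v (lookup N v)"
  have eq: "modes p v M * B (N - M)
    = (if M = ?M then if p (lookup N v) then gen (F (- lookup N v)) * B (N - ?M) else 0 else 0)" for M
  proof (cases "M = ?M")
    case True
    then have "modes p v M = (if p (lookup N v) then gen (F (- lookup N v)) else 0)"
      by (simp add: modes_def)
    then show ?thesis using True by simp
  next
    case False
    have "modes p v M = 0 \<or> B (N - M) = 0"
    proof (rule ccontr)
      assume *: "\<not> (modes p v M = 0 \<or> B (N - M) = 0)"
      then have "M = expo v (lookup M v)" by (auto simp: modes_def Let_def split: if_splits)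
      moreover have "lookup M v = lookup N v"
        using * assms[of "N - M"] by (auto simp: lookup_minus)
      ultimately show False using False by metis
    qed
    then show ?thesis using False by auto
  qed
  show ?thesis
    unfolding sprod_def eq by (rule Sum_any.delta[THEN trans]) simp
qed

lemma sprod_list_modes:
  "distinct vs \<Longrightarrow> sprod_list (map (modes p) vs) = word_series p vs"
proof (induction vs)
  case Nil
  have "keys N \<subseteq> {} \<longleftrightarrow> N = 0" for N :: "var \<Rightarrow>\<^sub>0 int" by auto
  then show ?case by (auto simp: sprod_list_def monomial_def word_series_def fun_eq_iff)
next
  case (Cons v vs)
  have step: "sprod_list (map (modes p) (v # vs)) = modes p v \<star> word_series p vs"
    using Cons by (simp add: sprod_list_def)
  show ?case
  proof
    fix N
    let ?N' = "N - expo v (lookup N v)"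
    have l: "lookup ?N' u = (if u = v then 0 else lookup N u)" for u
      by (simp add: lookup_minus lookup_single when_def)
    have "keys ?N' \<subseteq> set vs \<longleftrightarrow> keys N \<subseteq> set (v # vs)"
      using Cons.prems by (auto simp: keys_subset_iff l)
    moreover have "map (\<lambda>u. - lookup ?N' u) vs = map (\<lambda>u. - lookup N u) vs"
      using Cons.prems by (auto simp: l)
    moreover have "(\<forall>u\<in>set vs. p (lookup ?N' u)) \<longleftrightarrow> (\<forall>u\<in>set vs. p (lookup N u))"
      using Cons.prems by (auto simp: l)
    ultimately have "word_series p vs ?N' = (if keys N \<subseteq> set (v # vs) \<and> (\<forall>u\<in>set vs. p (lookup N u))
        then fw (map (\<lambda>u. - lookup N u) vs) else 0)"
      by (simp only: word_series_def)
    moreover have "(modes p v \<star> word_series p vs) N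
      = (if p (lookup N v) then gen (F (- lookup N v)) * word_series p vs ?N' else 0)"
      by (rule modes_sprod) (use Cons.prems in \<open>auto simp: word_series_def keys_subset_iff split: if_splits\<close>)
    ultimately show "sprod_list (map (modes p) (v # vs)) N = word_series p (v # vs) N"
      unfolding step by (simp add: word_series_def fw_Cons)
  qed
qed

abbreviation cur :: "var list \<Rightarrow> series" where
  "cur \<equiv> word_series (\<lambda>_. True)"

lemma cur_def: "cur vs N = (if keys N \<subseteq> set vs then fw (map (\<lambda>v. - lookup N v) vs) else 0)"
  by (simp add: word_series_def)

lemma current_product_eq: "current_product a = cur (tvars a)"
  using sprod_list_modes[of "tvars a" "\<lambda>_. True"]
  by (simp add: current_product_def f_current_modes distinct_map comp_def inj_on_def)

definition Phi :: "complex \<Rightarrow> var list \<Rightarrow> series" where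
  "Phi q vs = (\<lambda>N. nf q (cur vs N))"

text \<open>The denominator of the weight function.\<close>

definition D :: "complex \<Rightarrow> var list \<Rightarrow> lpoly" where
  "D q vs = pairprod (\<lambda>u v. lf q u (- 1 / q) v) vs"

text \<open>The product of currents with its denominator cleared; a two-sided series in any order of the variables.\<close>

definition Gam :: "complex \<Rightarrow> var list \<Rightarrow> series" where
  "Gam q vs = act (D q vs) (Phi q vs)"

definition Vdm :: "var list \<Rightarrow> lpoly" where
  "Vdm vs = pairprod (\<lambda>u v. lf 1 u (- 1) v) vs"

text \<open>This is the quadratic current relation \<open>(q a - q\<^sup>-\<^sup>1 b) f(a) f(b) = (q\<^sup>-\<^sup>1 a - q b) f(b) f(a)\<close> inside a
  longer product.\<close>

lemma Phi_exchange:
  assumes "distinct (us @ a # b # vs)" "q \<noteq> 0"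
  shows "act (lf q a (- 1 / q) b) (Phi q (us @ a # b # vs)) = act (lf (1 / q) a (- q) b) (Phi q (us @ b # a # vs))"
proof
  fix N :: "var \<Rightarrow>\<^sub>0 int"
  let ?U = "map (\<lambda>v. - lookup N v) us" and ?V = "map (\<lambda>v. - lookup N v) vs"
  define m where "m = - lookup N a"
  define n where "n = - lookup N b"
  let ?w = "\<lambda>x y. nf q (fw (?U @ x # y # ?V))"
  have ab: "a \<noteq> b" using assms by auto
  show "act (lf q a (- 1 / q) b) (Phi q (us @ a # b # vs)) N = act (lf (1 / q) a (- q) b) (Phi q (us @ b # a # vs)) N"
  proof (cases "keys N \<subseteq> set (us @ a # b # vs)")
    case True
    then have k: "keys (N - expo a 1) \<subseteq> set (us @ a # b # vs)" "keys (N - expo b 1) \<subseteq> set (us @ a # b # vs)"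
      by (auto simp: keys_subset_iff lookup_minus lookup_single when_def)
    have mapa: "map (\<lambda>v. - lookup (N - expo a 1) v) us = ?U" "map (\<lambda>v. - lookup (N - expo a 1) v) vs = ?V"
      "map (\<lambda>v. - lookup (N - expo b 1) v) us = ?U" "map (\<lambda>v. - lookup (N - expo b 1) v) vs = ?V"
      using assms(1) by (auto simp: lookup_minus lookup_single when_def)
    have la: "- lookup (N - expo a 1) a = m + 1" "- lookup (N - expo a 1) b = n"
      "- lookup (N - expo b 1) a = m" "- lookup (N - expo b 1) b = n + 1"
      using ab by (auto simp: m_def n_def lookup_minus lookup_single)
    have Phi: "Phi q (us @ a # b # vs) (N - expo a 1) = ?w (m + 1) n"
      "Phi q (us @ a # b # vs) (N - expo b 1) = ?w m (n + 1)"
      "Phi q (us @ b # a # vs) (N - expo a 1) = ?w n (m + 1)"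
      "Phi q (us @ b # a # vs) (N - expo b 1) = ?w (n + 1) m"
      using k by (auto simp only: Phi_def cur_def map_append list.map mapa la set_append list.set insert_commute if_True)
    have "?w (m + 1) n = scal (1 / q\<^sup>2) * ?w m (n + 1) + scal (1 / q\<^sup>2) * ?w n (m + 1) - ?w (n + 1) m"
      using arg_cong[OF exchange_eq(2)[OF assms(2), of ?U m n ?V], of "nf q"]
      by (simp only: nf_add nf_diff nf_scal nf_J[OF ffrel_word_in_J] add_0)
    then have "scal q * ?w (m + 1) n = scal q * (scal (1 / q\<^sup>2) * ?w m (n + 1))
      + scal q * (scal (1 / q\<^sup>2) * ?w n (m + 1)) - scal q * ?w (n + 1) m"
      by (simp add: distrib_left right_diff_distrib)
    moreover have "scal q * (scal (1 / q\<^sup>2) * z) = scal (1 / q) * z" for z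
    proof -
      have "q * (1 / q\<^sup>2) = 1 / q" using assms(2) by (simp add: power2_eq_square)
      then show ?thesis by (simp only: mult.assoc[symmetric] scal_mult[symmetric])
    qed
    ultimately have "scal q * ?w (m + 1) n = scal (1 / q) * ?w m (n + 1)
      + scal (1 / q) * ?w n (m + 1) - scal q * ?w (n + 1) m" by (simp only:)
    then show ?thesis
      by (simp add: act_lf Phi scal_uminus)
  next
    case False
    then have "\<not> keys (N - expo a 1) \<subseteq> set (us @ a # b # vs)" "\<not> keys (N - expo b 1) \<subseteq> set (us @ a # b # vs)"
      by (auto simp: keys_subset_iff lookup_minus lookup_single when_def split: if_splits)
    then have "Phi q (us @ a # b # vs) (N - expo a 1) = 0"
      "Phi q (us @ a # b # vs) (N - expo b 1) = 0"
      "Phi q (us @ b # a # vs) (N - expo a 1) = 0"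
      "Phi q (us @ b # a # vs) (N - expo b 1) = 0"
      by (auto simp: Phi_def cur_def)
    then show ?thesis by (simp add: act_lf)
  qed
qed

lemma pairprod_adjacent:
  "\<exists>R. pairprod g (us @ a # b # vs) = R * g a b \<and> pairprod g (us @ b # a # vs) = R * g b a"
proof (induction us)
  case Nil
  show ?case
    by (rule exI[of _ "prod_list (map (g a) vs) * prod_list (map (g b) vs) * pairprod g vs"]) (simp add: ac_simps)
next
  case (Cons u us)
  then obtain R where "pairprod g (us @ a # b # vs) = R * g a b" "pairprod g (us @ b # a # vs) = R * g b a"
    by blast
  then show ?case
    by (intro exI[of _ "prod_list (map (g u) (us @ a # b # vs)) * R"]) (simp add: ac_simps)
qed

text \<open>The linear form that the relation produces on the right is minus the form belonging to the
  exchanged order, and the other factors of the denominator do not change.\<close>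

lemma Gam_adjacent:
  assumes "distinct (us @ a # b # vs)" "q \<noteq> 0"
  shows "Gam q (us @ a # b # vs) N = - Gam q (us @ b # a # vs) N"
proof -
  let ?g = "\<lambda>u v. lf q u (- 1 / q) v"
  obtain R where R: "D q (us @ a # b # vs) = R * ?g a b" "D q (us @ b # a # vs) = R * ?g b a"
    unfolding D_def using pairprod_adjacent[of ?g us a b vs] by blast
  have "?g b a = - lf (1 / q) a (- q) b"
    using lf_swap[of q b "- 1 / q" a] lf_neg[of "1 / q" a "- q" b] by simp
  then have "act (?g b a) A = (\<lambda>N. - act (lf (1 / q) a (- q) b) A N)" for A
    by (simp add: fun_eq_iff act_uminus)
  then show ?thesis
    unfolding Gam_def R act_mult Phi_exchange[OF assms] by (simp add: act_fun_uminus)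
qed

text \<open>The scalar is a sign: every current passed on the way to the front contributes a factor \<open>-1\<close>.\<close>

lemma Gam_move:
  assumes "distinct (us @ v # ws)" "q \<noteq> 0"
  shows "\<exists>s. s \<noteq> 0 \<and> (\<forall>N. Gam q (us @ v # ws) N = scal s * Gam q (v # us @ ws) N)"
  using assms
proof (induction us arbitrary: ws rule: rev_induct)
  case Nil
  show ?case by (rule exI[of _ 1]) simp
next
  case (snoc u us)
  have "distinct (us @ v # u # ws)" using snoc.prems(1) by auto
  with snoc.IH[of "u # ws"] snoc.prems(2) obtain s
    where "s \<noteq> 0" "\<forall>N. Gam q (us @ v # u # ws) N = scal s * Gam q (v # us @ u # ws) N" by auto
  then show ?case
    using Gam_adjacent[of us u v ws q] snoc.prems
    by (intro exI[of _ "- s"]) (auto simp: scal_uminus)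
qed

text \<open>Moving \<open>f(a)\<close> through all the currents behind it.\<close>

lemma Phi_cycle:
  assumes "distinct (ws @ a # us)" "q \<noteq> 0"
  shows "act (row q (- 1 / q) a us) (Phi q (ws @ a # us))
       = act (row (1 / q) (- q) a us) (Phi q (ws @ us @ [a]))"
  using assms
proof (induction us arbitrary: ws)
  case (Cons u us)
  have "distinct ((ws @ [u]) @ a # us)" using Cons.prems(1) by auto
  note IH = Cons.IH[OF this Cons.prems(2)]
  have "act (row q (- 1 / q) a (u # us)) (Phi q (ws @ a # u # us))
    = act (row q (- 1 / q) a us) (act (lf q a (- 1 / q) u) (Phi q (ws @ a # u # us)))"
    by (simp add: act_mult[symmetric] mult.commute)
  also have "\<dots> = act (lf (1 / q) a (- q) u) (act (row q (- 1 / q) a us) (Phi q (ws @ u # a # us)))"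
    unfolding Phi_exchange[OF Cons.prems] by (rule act_commute)
  also have "\<dots> = act (row (1 / q) (- q) a (u # us)) (Phi q (ws @ (u # us) @ [a]))"
    using IH by (simp add: act_mult)
  finally show ?case by simp
qed simp

subsection \<open>Exchanging two variables\<close>

definition swap_var :: "var \<Rightarrow> var \<Rightarrow> var \<Rightarrow> var" where
  "swap_var a b v = (if v = a then b else if v = b then a else v)"

text \<open>Exchanging the exponents of \<open>a\<close> and \<open>b\<close>, written as a shift along the line in direction \<open>a/b\<close>. This form makes
  it a reflection of that line.\<close>

definition swap_exp :: "var \<Rightarrow> var \<Rightarrow> (var \<Rightarrow>\<^sub>0 int) \<Rightarrow> (var \<Rightarrow>\<^sub>0 int)" where
  "swap_exp a b N = N + ratio a b (lookup N b - lookup N a)"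

lemma lookup_swap_exp: "a \<noteq> b \<Longrightarrow> lookup (swap_exp a b N) v = lookup N (swap_var a b v)"
  by (auto simp: swap_exp_def ratio_def swap_var_def lookup_add lookup_minus lookup_single when_def)

lemma swap_var_swap_var [simp]: "swap_var a b (swap_var a b v) = v"
  by (auto simp: swap_var_def)

lemma swap_var_eq_iff: "swap_var a b u = swap_var a b v \<longleftrightarrow> u = v"
  by (metis swap_var_swap_var)

lemma cur_rename:
  assumes "a \<noteq> b"
  shows "cur (map (swap_var a b) vs) N = cur vs (swap_exp a b N)"
proof -
  have "swap_var a b v \<in> set vs \<longleftrightarrow> v \<in> swap_var a b ` set vs" for v
    by (metis image_iff swap_var_swap_var)
  then have "keys N \<subseteq> set (map (swap_var a b) vs) \<longleftrightarrow> keys (swap_exp a b N) \<subseteq> set vs"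
    using assms by (simp add: keys_subset_iff lookup_swap_exp) (metis swap_var_swap_var)
  then show ?thesis using assms by (simp add: cur_def lookup_swap_exp comp_def)
qed

text \<open>\<open>p'\<close> is the Laurent polynomial \<open>p\<close> with the variables \<open>a\<close> and \<open>b\<close> exchanged.\<close>

definition renames :: "var \<Rightarrow> var \<Rightarrow> lpoly \<Rightarrow> lpoly \<Rightarrow> bool" where
  "renames a b p p' \<longleftrightarrow> (\<forall>A. (\<lambda>N. act p A (swap_exp a b N)) = act p' (\<lambda>N. A (swap_exp a b N)))"

lemma renames_1: "renames a b 1 1"
  by (simp add: renames_def)

lemma renames_mult: "renames a b p p' \<Longrightarrow> renames a b r r' \<Longrightarrow> renames a b (p * r) (p' * r')"
  unfolding renames_def by (simp add: act_mult)

lemma renames_lf: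
  assumes "a \<noteq> b"
  shows "renames a b (lf x u y v) (lf x (swap_var a b u) y (swap_var a b v))"
proof -
  have "swap_exp a b N - expo u 1 = swap_exp a b (N - expo (swap_var a b u) 1)" for N u
    by (rule poly_mapping_eqI)
      (use assms swap_var_eq_iff[of a b] in \<open>auto simp: lookup_swap_exp lookup_minus lookup_single when_def\<close>)
  then show ?thesis by (simp add: renames_def act_lf fun_eq_iff)
qed

lemma renames_pairprod:
  assumes "a \<noteq> b"
  shows "renames a b (pairprod (\<lambda>u v. lf x u y v) vs) (pairprod (\<lambda>u v. lf x u y v) (map (swap_var a b) vs))"
proof (induction vs)
  case (Cons v vs)
  have "renames a b (prod_list (map (lf x v y) ws)) (prod_list (map (lf x (swap_var a b v) y) (map (swap_var a b) ws)))" for ws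
    by (induction ws) (auto intro: renames_1 renames_mult renames_lf[OF assms])
  then show ?case using Cons by (simp add: renames_mult del: map_map)
qed (simp add: renames_1)

lemma Gam_rename:
  assumes "a \<noteq> b"
  shows "Gam q (map (swap_var a b) vs) N = Gam q vs (swap_exp a b N)"
proof -
  have "(\<lambda>N. Phi q vs (swap_exp a b N)) = Phi q (map (swap_var a b) vs)"
    by (simp add: Phi_def cur_rename[OF assms] fun_eq_iff)
  moreover have "(\<lambda>N. act (D q vs) (Phi q vs) (swap_exp a b N)) = act (D q (map (swap_var a b) vs)) (\<lambda>N. Phi q vs (swap_exp a b N))"
    using renames_pairprod[OF assms, of q "- 1 / q" vs] unfolding renames_def D_def by (rule spec)
  ultimately show ?thesis
    unfolding Gam_def by (metis (no_types, lifting))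
qed

text \<open>Exchanging the variables amounts to exchanging the order of the currents; for
  \<open>a\<close> and \<open>b\<close> moved to the front this costs one sign.\<close>

lemma Gam_antisymmetric:
  assumes "distinct vs" "a \<in> set vs" "b \<in> set vs" "a \<noteq> b" "q \<noteq> 0"
  shows "Gam q vs (swap_exp a b N) = - Gam q vs N"
proof -
  obtain us ws where vs: "vs = us @ a # ws" using assms(2) by (meson split_list)
  with assms have "b \<in> set (us @ ws)" by auto
  then obtain us' ws' where usws: "us @ ws = us' @ b # ws'" by (meson split_list)
  obtain s where s: "\<forall>N. Gam q vs N = scal s * Gam q (a # us' @ b # ws') N"
    using Gam_move[of us a ws q] assms vs usws by auto
  have dist: "distinct ((a # us') @ b # ws')"
  proof -
    have "distinct (a # (us @ ws))" using assms(1) vs by auto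
    then show ?thesis unfolding usws by simp
  qed
  obtain s' where "\<forall>N. Gam q (a # us' @ b # ws') N = scal s' * Gam q (b # a # us' @ ws') N"
    using Gam_move[OF dist assms(5)] by auto
  with s have eq: "Gam q vs N = scal s * (scal s' * Gam q (b # a # us' @ ws') N)" for N by simp
  have "map (swap_var a b) (us' @ ws') = us' @ ws'"
    using dist by (intro map_idI) (auto simp: swap_var_def)
  then have "map (swap_var a b) (b # a # us' @ ws') = a # b # us' @ ws'"
    by (simp add: swap_var_def)
  then have "Gam q (b # a # us' @ ws') (swap_exp a b N) = Gam q (a # b # us' @ ws') N" for N
    using Gam_rename[OF assms(4), of q "b # a # us' @ ws'" N] by simp
  moreover have "Gam q (b # a # us' @ ws') N = - Gam q (a # b # us' @ ws') N" for N
    using Gam_adjacent[of "[]" b a "us' @ ws'" q N] dist assms(5) by auto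
  ultimately show ?thesis by (simp add: eq)
qed

subsection \<open>Bounds on exponents\<close>

definition additive_fun :: "((var \<Rightarrow>\<^sub>0 int) \<Rightarrow> int) \<Rightarrow> bool" where
  "additive_fun f \<longleftrightarrow> (\<forall>M N. f (M + N) = f M + f N)"

lemma additive_lookup [simp]: "additive_fun (\<lambda>M. lookup M v)"
  by (simp add: additive_fun_def lookup_add)

lemma additive_uminus_lookup [simp]: "additive_fun (\<lambda>M. - lookup M v)"
  by (simp add: additive_fun_def lookup_add)

lemma additive_fun_0: "additive_fun f \<Longrightarrow> f 0 = 0"
  unfolding additive_fun_def by (metis add_cancel_right_right add.right_neutral)

definition pbound :: "((var \<Rightarrow>\<^sub>0 int) \<Rightarrow> int) \<Rightarrow> int \<Rightarrow> lpoly \<Rightarrow> bool" where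
  "pbound f n p \<longleftrightarrow> (\<forall>M\<in>keys p. f M \<le> n)"

definition sbound :: "((var \<Rightarrow>\<^sub>0 int) \<Rightarrow> int) \<Rightarrow> int \<Rightarrow> series \<Rightarrow> bool" where
  "sbound f n A \<longleftrightarrow> (\<forall>N. A N \<noteq> 0 \<longrightarrow> f N \<le> n)"

definition pvars :: "var set \<Rightarrow> lpoly \<Rightarrow> bool" where
  "pvars V p \<longleftrightarrow> (\<forall>M\<in>keys p. keys M \<subseteq> V)"

definition svars :: "var set \<Rightarrow> series \<Rightarrow> bool" where
  "svars V A \<longleftrightarrow> (\<forall>N. A N \<noteq> 0 \<longrightarrow> keys N \<subseteq> V)"

lemma pbound_mono: "pbound f n p \<Longrightarrow> n \<le> m \<Longrightarrow> pbound f m p"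
  by (force simp: pbound_def)

lemma sbound_mono: "sbound f n p \<Longrightarrow> n \<le> m \<Longrightarrow> sbound f m p"
  by (force simp: sbound_def)

lemma pbound_1: "additive_fun f \<Longrightarrow> pbound f 0 1"
  by (auto simp: pbound_def additive_fun_0)

lemma pbound_mult:
  assumes "additive_fun f" "pbound f m p" "pbound f n r"
  shows "pbound f (m + n) (p * r)"
  unfolding pbound_def
proof
  fix M assume "M \<in> keys (p * r)"
  then obtain a b where "M = a + b" "a \<in> keys p" "b \<in> keys r" using keys_mult[of p r] by blast
  then show "f M \<le> m + n" using assms by (auto simp: pbound_def additive_fun_def intro: add_mono)
qed

lemma pbound_prod_list:
  assumes "additive_fun f" "\<And>p. p \<in> set ps \<Longrightarrow> pbound f n p"
  shows "pbound f (n * int (length ps)) (prod_list ps)"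
  using assms(2)
proof (induction ps)
  case (Cons p ps)
  then have "pbound f (n + n * int (length ps)) (p * prod_list ps)"
    by (intro pbound_mult assms(1)) auto
  then show ?case by (simp add: algebra_simps)
qed (simp add: pbound_1 assms(1))

lemma pbound_pairprod:
  assumes "additive_fun f" "\<And>u v. u \<in> set vs \<Longrightarrow> v \<in> set vs \<Longrightarrow> pbound f 0 (g u v)"
  shows "pbound f 0 (pairprod g vs)"
  using assms(2)
proof (induction vs)
  case (Cons v vs)
  have "pbound f (0 * int (length (map (g v) vs))) (prod_list (map (g v) vs))"
    by (rule pbound_prod_list[OF assms(1)]) (use Cons.prems in auto)
  then have "pbound f (0 + 0) (prod_list (map (g v) vs) * pairprod g vs)"
    using Cons by (intro pbound_mult assms(1)) auto
  then show ?case by simp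
qed (simp add: pbound_1 assms(1))

lemma pvars_1: "pvars V 1" by (auto simp: pvars_def)

lemma pvars_mult: "pvars V p \<Longrightarrow> pvars V r \<Longrightarrow> pvars V (p * r)"
  unfolding pvars_def
proof
  assume *: "\<forall>M\<in>keys p. keys M \<subseteq> V" "\<forall>M\<in>keys r. keys M \<subseteq> V"
  fix M assume "M \<in> keys (p * r)"
  then obtain a b where "M = a + b" "a \<in> keys p" "b \<in> keys r" using keys_mult[of p r] by blast
  moreover from this * have "keys a \<union> keys b \<subseteq> V" by auto
  ultimately show "keys M \<subseteq> V" using keys_add[of a b] by blast
qed

lemma pvars_lf: "u \<in> V \<Longrightarrow> v \<in> V \<Longrightarrow> pvars V (lf x u y v)"
  using keys_lf[of x u y v] by (auto simp: pvars_def)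

lemma pvars_prod_list: "(\<And>p. p \<in> set ps \<Longrightarrow> pvars V p) \<Longrightarrow> pvars V (prod_list ps)"
  by (induction ps) (auto simp: pvars_1 pvars_mult)

lemma pvars_pairprod:
  "(\<And>u v. u \<in> set vs \<Longrightarrow> v \<in> set vs \<Longrightarrow> pvars V (g u v)) \<Longrightarrow> pvars V (pairprod g vs)"
  by (induction vs) (auto intro!: pvars_1 pvars_mult pvars_prod_list)

lemma pbound_lf_lookup: "pbound (\<lambda>M. lookup M w) (if w = u \<or> w = v then 1 else 0) (lf x u y v)"
  using keys_lf[of x u y v] by (auto simp: pbound_def lookup_single when_def)

lemma pbound_lf_uminus_lookup: "pbound (\<lambda>M. - lookup M w) 0 (lf x u y v)"
  using keys_lf[of x u y v] by (auto simp: pbound_def lookup_single when_def)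

lemma sbound_act:
  assumes "additive_fun f" "pbound f m p" "sbound f n A"
  shows "sbound f (m + n) (act p A)"
  unfolding sbound_def
proof (intro allI impI)
  fix N assume "act p A N \<noteq> 0"
  then obtain M where M: "M \<in> keys p" "A (N - M) \<noteq> 0" by (rule act_nonzeroE)
  then have "f M \<le> m" "f (N - M) \<le> n" using assms by (auto simp: pbound_def sbound_def)
  moreover have "f (M + (N - M)) = f M + f (N - M)" using assms(1) unfolding additive_fun_def by blast
  ultimately show "f N \<le> m + n" by simp
qed

lemma svars_act:
  assumes "pvars V p" "svars V A"
  shows "svars V (act p A)"
  unfolding svars_def
proof (intro allI impI)
  fix N assume "act p A N \<noteq> 0"
  then obtain M where M: "M \<in> keys p" "A (N - M) \<noteq> 0" by (rule act_nonzeroE)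
  then have "keys M \<subseteq> V" "keys (N - M) \<subseteq> V" using assms by (auto simp: pvars_def svars_def)
  then show "keys N \<subseteq> V" by (auto simp: keys_subset_iff lookup_minus)
qed

lemma svars_Phi: "svars (set vs) (Phi q vs)"
  by (auto simp: svars_def Phi_def cur_def split: if_splits)

lemma svars_Gam: "svars (set vs) (Gam q vs)"
  unfolding Gam_def D_def by (intro svars_act pvars_pairprod pvars_lf svars_Phi)

text \<open>If the first variable has a nonnegative exponent, the word starts with a nonpositive mode.\<close>

lemma sbound_Phi_head:
  assumes "q \<noteq> 0"
  shows "sbound (\<lambda>N. lookup N v) (- 1) (Phi q (v # vs))"
  unfolding sbound_def
proof (intro allI impI, rule ccontr)
  fix N assume N: "Phi q (v # vs) N \<noteq> 0" "\<not> lookup N v \<le> - 1"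
  then have "fw ([- lookup N v] @ map (\<lambda>v. - lookup N v) vs) \<in> J q"
    by (intro word_in_J assms) auto
  then show False using N by (auto simp: Phi_def cur_def nf_J split: if_splits)
qed

text \<open>For the first variable the bound comes from the degree of the denominator and the positivity of the
  first mode. Any variable can be moved to the front.\<close>

lemma sbound_Gam:
  assumes "distinct vs" "v \<in> set vs" "q \<noteq> 0"
  shows "sbound (\<lambda>N. lookup N v) (int (length vs) - 2) (Gam q vs)"
proof -
  obtain us ws where vs: "vs = us @ v # ws" using assms(2) by (meson split_list)
  obtain s where s: "\<forall>N. Gam q vs N = scal s * Gam q (v # us @ ws) N"
    using Gam_move[of us v ws q] assms vs by auto
  have nin: "v \<notin> set (us @ ws)" using assms(1) vs by auto
  have "pbound (\<lambda>N. lookup N v) (1 * int (length (map (\<lambda>u. lf q v (- 1 / q) u) (us @ ws)))) (row q (- 1 / q) v (us @ ws))"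
    by (intro pbound_prod_list) (auto intro: pbound_mono[OF pbound_lf_lookup])
  moreover have "pbound (\<lambda>N. lookup N v) 0 (D q (us @ ws))"
    unfolding D_def
    by (intro pbound_pairprod additive_lookup pbound_mono[OF pbound_lf_lookup]) (use nin in auto)
  ultimately have "pbound (\<lambda>N. lookup N v) (1 * int (length (map (\<lambda>u. lf q v (- 1 / q) u) (us @ ws))) + 0) (D q (v # us @ ws))"
    unfolding D_def pairprod.simps by (intro pbound_mult) auto
  then have "sbound (\<lambda>N. lookup N v) (1 * int (length (map (\<lambda>u. lf q v (- 1 / q) u) (us @ ws))) + 0 + (- 1)) (Gam q (v # us @ ws))"
    unfolding Gam_def by (intro sbound_act sbound_Phi_head assms) auto
  then show ?thesis using s by (auto simp: sbound_def vs)
qed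

section \<open>Division by the Vandermonde product\<close>

text \<open>The substitution \<open>a := b\<close> gives zero: it sums the coefficients along the lines in direction \<open>a/b\<close>.\<close>

definition diag_zero :: "var \<Rightarrow> var \<Rightarrow> series \<Rightarrow> bool" where
  "diag_zero a b A \<longleftrightarrow> (\<forall>N. Sum_any (\<lambda>k::int. A (N + ratio a b k)) = 0)"

text \<open>Series in the variables \<open>V\<close> with exponents bounded above in each variable. No order of the variables is involved,
  and substitutions of one variable for another are defined.\<close>

definition bdd :: "var set \<Rightarrow> (var \<Rightarrow> int) \<Rightarrow> series \<Rightarrow> bool" where
  "bdd V n A \<longleftrightarrow> svars V A \<and> (\<forall>w\<in>V. sbound (\<lambda>N. lookup N w) (n w) A)"

lemma bddD:
  assumes "bdd V n A" "A N \<noteq> 0"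
  shows "keys N \<subseteq> V" "w \<in> V \<Longrightarrow> lookup N w \<le> n w"
  using assms by (auto simp: bdd_def svars_def sbound_def)

lemma bdd_mono:
  assumes "bdd V n A" "\<And>w. w \<in> V \<Longrightarrow> n w \<le> m w"
  shows "bdd V m A"
  using assms unfolding bdd_def by (meson sbound_mono)

lemma lookup_ratio': "a \<noteq> b \<Longrightarrow> lookup (ratio a b k) v = (if v = a then k else if v = b then - k else 0)"
  by (auto simp: ratio_def lookup_minus lookup_single when_def)

lemma Sum_any_uminus: "Sum_any (\<lambda>k. - f k) = - Sum_any (f :: 'b \<Rightarrow> 'a::ab_group_add)"
  by (simp add: Sum_any.expand_set sum_negf)

lemma falg_eq_uminus_imp_0:
  fixes x :: falg
  assumes "x = - x"
  shows "x = 0"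
proof -
  have "scal (1 / 2) * (x + x) = 0" using assms by (metis add.right_inverse mult_zero_right)
  moreover have "scal (1 / 2) * (x + x) = x"
  proof -
    have "scal (1 / 2) + scal (1 / 2) = 1" using scal_add[of "1 / 2" "1 / 2"] by simp
    then have "(scal (1 / 2) + scal (1 / 2)) * x = x" by (simp only: mult_1)
    then show ?thesis by (simp only: distrib_left distrib_right)
  qed
  ultimately show ?thesis by simp
qed

lemma bij_int_reflect: "bij (\<lambda>k::int. c - k)"
  by (rule bij_betw_byWitness[where f' = "\<lambda>k. c - k"]) auto

text \<open>The exchange of \<open>a\<close> and \<open>b\<close> reflects each line in direction \<open>a/b\<close> and changes the sign.\<close>

lemma diag_zero_Gam:
  assumes "distinct vs" "a \<in> set vs" "b \<in> set vs" "a \<noteq> b" "q \<noteq> 0"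
  shows "diag_zero a b (Gam q vs)"
  unfolding diag_zero_def
proof
  fix N :: "var \<Rightarrow>\<^sub>0 int"
  let ?c = "\<lambda>k. Gam q vs (N + ratio a b k)" and ?K = "lookup N b - lookup N a"
  have "swap_exp a b (N + ratio a b k) = N + ratio a b (?K - k)" for k
    using assms(4)
    by (intro poly_mapping_eqI) (auto simp: swap_exp_def lookup_add lookup_ratio' algebra_simps)
  then have refl: "?c (?K - k) = - ?c k" for k
    using Gam_antisymmetric[OF assms, of "N + ratio a b k"] by simp
  have "Sum_any ?c = Sum_any (\<lambda>k. ?c (?K - k))"
    by (rule Sum_any.reindex_cong[OF bij_int_reflect[of ?K]]) (simp add: fun_eq_iff)
  also have "\<dots> = - Sum_any ?c"
    by (simp only: refl Sum_any_uminus)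
  finally show "Sum_any ?c = 0" by (rule falg_eq_uminus_imp_0)
qed

lemma finite_line:
  assumes "bdd V n A" "a \<in> V" "b \<in> V" "a \<noteq> b"
  shows "finite {k. A (N + ratio a b k) \<noteq> 0}"
proof (rule finite_subset)
  show "{k. A (N + ratio a b k) \<noteq> 0} \<subseteq> {lookup N b - n b..n a - lookup N a}"
  proof
    fix k assume "k \<in> {k. A (N + ratio a b k) \<noteq> 0}"
    then have "lookup (N + ratio a b k) a \<le> n a" "lookup (N + ratio a b k) b \<le> n b"
      using bddD[OF assms(1)] assms(2,3) by auto
    then show "k \<in> {lookup N b - n b..n a - lookup N a}"
      using assms(4) by (auto simp: lookup_add lookup_ratio')
  qed
qed simp

lemma Sum_any_nat_shift:
  fixes f :: "nat \<Rightarrow> 'a::comm_monoid_add"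
  assumes "finite {k. f k \<noteq> 0}"
  shows "Sum_any f = f 0 + Sum_any (\<lambda>k. f (Suc k))"
proof -
  obtain K where K: "{k. f k \<noteq> 0} \<subseteq> {..K}"
    using assms finite_nat_iff_bounded_le by blast
  then have "Sum_any f = (\<Sum>k\<le>Suc K. f k)"
    by (intro Sum_any.expand_superset) auto
  also have "\<dots> = f 0 + (\<Sum>k\<le>K. f (Suc k))" by (rule sum.atMost_Suc_shift)
  also have "(\<Sum>k\<le>K. f (Suc k)) = Sum_any (\<lambda>k. f (Suc k))"
    by (rule Sum_any.expand_superset[symmetric]) (use K in auto)
  finally show ?thesis .
qed

lemma Sum_any_int_split:
  fixes f :: "int \<Rightarrow> 'a::comm_monoid_add"
  assumes "finite {k. f k \<noteq> 0}"
  shows "Sum_any f = Sum_any (\<lambda>k::nat. f (int k)) + Sum_any (\<lambda>k::nat. f (- 1 - int k))"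
proof -
  let ?S = "{k. f k \<noteq> 0}"
  have pos: "Sum_any (\<lambda>k::nat. f (int k)) = sum f (?S \<inter> {0..})"
  proof -
    have "Sum_any (\<lambda>k::nat. f (int k)) = (\<Sum>k\<in>nat ` (?S \<inter> {0..}). f (int k))"
      by (rule Sum_any.expand_superset) (use assms in \<open>auto simp: image_iff intro!: bexI[of _ "int _"]\<close>)
    also have "\<dots> = sum f (?S \<inter> {0..})"
      by (subst sum.reindex) (auto simp: inj_on_def)
    finally show ?thesis .
  qed
  have neg: "Sum_any (\<lambda>k::nat. f (- 1 - int k)) = sum f (?S \<inter> {..<0})"
  proof -
    have "Sum_any (\<lambda>k::nat. f (- 1 - int k)) = (\<Sum>k\<in>(\<lambda>j. nat (- 1 - j)) ` (?S \<inter> {..<0}). f (- 1 - int k))"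
      by (rule Sum_any.expand_superset) (use assms in \<open>auto simp: image_iff intro!: bexI[of _ "- 1 - int _"]\<close>)
    also have "\<dots> = sum f (?S \<inter> {..<0})"
      by (subst sum.reindex) (auto simp: inj_on_def)
    finally show ?thesis .
  qed
  have "Sum_any f = sum f ((?S \<inter> {0..}) \<union> (?S \<inter> {..<0}))"
    by (rule Sum_any.expand_superset) (use assms in auto)
  also have "\<dots> = sum f (?S \<inter> {0..}) + sum f (?S \<inter> {..<0})"
    by (rule sum.union_disjoint) (use assms in auto)
  finally show ?thesis by (simp add: pos neg)
qed

text \<open>The quotient is the partial sum of the coefficients along lines in direction \<open>a/b\<close>. Since the full sums vanish, the partial sum
  from the other end is its negative, and this bounds the exponents of the quotient in both variables.\<close>

lemma divide_by_difference:
  assumes A: "bdd V n A" and ab: "a \<in> V" "b \<in> V" "a \<noteq> b" and diag_zero: "diag_zero a b A"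
  obtains B where "act (lf 1 a (- 1) b) B = A"
    "bdd V (\<lambda>w. n w - (if w = a \<or> w = b then 1 else 0)) B"
    "\<And>l. sbound (\<lambda>N. - lookup N a) l A \<Longrightarrow> sbound (\<lambda>N. - lookup N a) l B"
proof -
  define B where "B N = Sum_any (\<lambda>k::nat. A (N + expo a 1 + ratio a b (int k)))" for N
  have fin: "finite {k::nat. A (N + ratio a b (int k)) \<noteq> 0}" for N
  proof -
    have "finite (int -` {k. A (N + ratio a b k) \<noteq> 0})"
      by (rule finite_vimageI[OF finite_line[OF A ab]]) auto
    then show ?thesis by (simp add: vimage_def)
  qed
  have "act (lf 1 a (- 1) b) B N = A N" for N
  proof -
    have "B (N - expo a 1) = Sum_any (\<lambda>k::nat. A (N + ratio a b (int k)))"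
      by (simp add: B_def)
    also have "\<dots> = A N + Sum_any (\<lambda>k::nat. A (N + ratio a b (int (Suc k))))"
      by (subst Sum_any_nat_shift[OF fin]) simp
    also have "(\<lambda>k::nat. A (N + ratio a b (int (Suc k)))) = (\<lambda>k. A (N - expo b 1 + expo a 1 + ratio a b (int k)))"
    proof
      fix k :: nat
      have "N + ratio a b (int (Suc k)) = N - expo b 1 + expo a 1 + ratio a b (int k)"
        using ab(3) by (intro poly_mapping_eqI) (auto simp: lookup_add lookup_minus lookup_ratio' lookup_single when_def)
      then show "A (N + ratio a b (int (Suc k))) = A (N - expo b 1 + expo a 1 + ratio a b (int k))" by (simp only:)
    qed
    finally show ?thesis by (simp add: act_lf B_def scal_uminus)
  qed
  then have 1: "act (lf 1 a (- 1) b) B = A" by auto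
  \<comment> \<open>A nonzero value needs a nonzero coefficient on either side of the starting point, since the two half sums are opposite.\<close>
  have wit: "\<exists>k\<ge>0. A (N + expo a 1 + ratio a b k) \<noteq> 0" "\<exists>k<0. A (N + expo a 1 + ratio a b k) \<noteq> 0"
    if "B N \<noteq> 0" for N
  proof -
    have "\<exists>k::nat. A (N + expo a 1 + ratio a b (int k)) \<noteq> 0"
      using that unfolding B_def by (metis Sum_any.not_neutral_obtains_not_neutral)
    then show "\<exists>k\<ge>0. A (N + expo a 1 + ratio a b k) \<noteq> 0" by (metis of_nat_0_le_iff)
    have "B N + Sum_any (\<lambda>k::nat. A (N + expo a 1 + ratio a b (- 1 - int k))) = 0"
      using diag_zero[unfolded diag_zero_def, rule_format, of "N + expo a 1"]
      by (simp add: Sum_any_int_split[OF finite_line[OF A ab]] B_def)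
    then have "Sum_any (\<lambda>k::nat. A (N + expo a 1 + ratio a b (- 1 - int k))) \<noteq> 0"
      using that by auto
    then obtain k :: nat where "A (N + expo a 1 + ratio a b (- 1 - int k)) \<noteq> 0"
      by (metis Sum_any.not_neutral_obtains_not_neutral)
    then show "\<exists>k<0. A (N + expo a 1 + ratio a b k) \<noteq> 0"
      by (intro exI[of _ "- 1 - int k"]) auto
  qed
  have l: "lookup (N + expo a 1 + ratio a b k) v
      = (if v = a then lookup N a + 1 + k else if v = b then lookup N b - k else lookup N v)" for N k v
    using ab(3) by (simp add: lookup_add lookup_ratio' lookup_single when_def)
  have 2: "bdd V (\<lambda>w. n w - (if w = a \<or> w = b then 1 else 0)) B"
    unfolding bdd_def svars_def sbound_def
  proof (intro conjI allI impI ballI)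
    fix N assume "B N \<noteq> 0"
    then obtain k where k: "k \<ge> 0" "A (N + expo a 1 + ratio a b k) \<noteq> 0" using wit by blast
    show "keys N \<subseteq> V"
      using bddD(1)[OF A k(2)] ab unfolding keys_subset_iff l by metis
  next
    fix N w assume BN: "B N \<noteq> 0" and w: "w \<in> V"
    obtain k where k: "k \<ge> 0" "A (N + expo a 1 + ratio a b k) \<noteq> 0" using wit BN by blast
    obtain j where j: "j < 0" "A (N + expo a 1 + ratio a b j) \<noteq> 0" using wit BN by blast
    show "lookup N w \<le> n w - (if w = a \<or> w = b then 1 else 0)"
      using bddD(2)[OF A k(2) w] bddD(2)[OF A j(2) w] k(1) j(1) ab(3) unfolding l by (auto split: if_splits)
  qed
  have 3: "sbound (\<lambda>N. - lookup N a) l B" if "sbound (\<lambda>N. - lookup N a) l A" for l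
    unfolding sbound_def
  proof (intro allI impI)
    fix N assume "B N \<noteq> 0"
    then obtain j where j: "j < 0" "A (N + expo a 1 + ratio a b j) \<noteq> 0" using wit by blast
    then have "- lookup (N + expo a 1 + ratio a b j) a \<le> l" using that unfolding sbound_def by blast
    then show "- lookup N a \<le> l" using j(1) unfolding l by auto
  qed
  from 1 2 3 show ?thesis by (rule that)
qed

text \<open>Iterating the invariance raises the exponent of \<open>u\<close> without bound.\<close>

lemma translation_invariant_zero:
  assumes inv: "\<And>N. f (N - expo u 1) = f (N - expo v 1)" and uv: "u \<noteq> v"
    and bound: "\<And>N. f N \<noteq> 0 \<Longrightarrow> lookup N u \<le> m"
  shows "f N = (0::'a::zero)"
proof (rule ccontr)
  assume nz: "f N \<noteq> 0"
  have step: "f (N + ratio u v 1) = f N" for N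
  proof -
    have "N + ratio u v 1 = N + expo u 1 - expo v 1" by (simp add: ratio_def)
    moreover have "f N = f (N + expo u 1 - expo v 1)" using inv[of "N + expo u 1"] by simp
    ultimately show ?thesis by (simp only:)
  qed
  have "f (N + ratio u v (int k)) = f N" for k
  proof (induction k)
    case (Suc k)
    have "N + ratio u v (int (Suc k)) = (N + ratio u v (int k)) + ratio u v 1"
      using ratio_add[of u v "int k" 1] by (simp add: add.assoc add.commute)
    then show ?case using Suc step[of "N + ratio u v (int k)"] by (simp only:)
  qed simp
  then have "lookup (N + ratio u v (int k)) u \<le> m" for k using bound nz by metis
  from this[of "nat (m - lookup N u + 1)"] show False
    using uv by (simp add: lookup_add lookup_ratio' split: if_splits)
qed

text \<open>Substituting \<open>a := b\<close> turns the difference of \<open>u\<close> and \<open>v\<close> into a nonzero form, which is not a zero divisor on series with bounded exponents.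
  One of \<open>u\<close> and \<open>v\<close> is different from \<open>a\<close> and \<open>b\<close>, and its exponents remain bounded after the substitution.\<close>

lemma diag_zero_divide:
  assumes B: "bdd V n B" and ab: "a \<in> V" "b \<in> V" "a \<noteq> b" and uv: "u \<in> V" "v \<in> V" "u \<noteq> v" "{u, v} \<noteq> {a, b}"
    and diag_zero: "diag_zero a b (act (lf 1 u (- 1) v) B)"
  shows "diag_zero a b B"
proof -
  define s where "s N = Sum_any (\<lambda>k. B (N + ratio a b k))" for N
  have inv: "s (N - expo u 1) = s (N - expo v 1)" for N
  proof -
    have fin: "finite {k. B (N + ratio a b k - expo w 1) \<noteq> 0}" for w
      using finite_line[OF B ab, of "N - expo w 1"] by (simp add: algebra_simps)
    have swap_exp: "s (N - expo w 1) = Sum_any (\<lambda>k. B (N + ratio a b k - expo w 1))" for w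
      by (simp add: s_def algebra_simps)
    have "0 = Sum_any (\<lambda>k. act (lf 1 u (- 1) v) B (N + ratio a b k))"
      using diag_zero unfolding diag_zero_def by simp
    also have "\<dots> = Sum_any (\<lambda>k. B (N + ratio a b k - expo u 1) + - B (N + ratio a b k - expo v 1))"
      by (simp add: act_lf scal_uminus)
    also have "\<dots> = s (N - expo u 1) + - s (N - expo v 1)"
      unfolding swap_exp Sum_any_uminus[symmetric] by (rule Sum_any.distrib) (use fin in auto)
    finally show ?thesis by simp
  qed
  have bound: "lookup N w \<le> n w" if "s N \<noteq> 0" "w \<in> V" "w \<noteq> a" "w \<noteq> b" for N w
  proof -
    from that(1) obtain k where "B (N + ratio a b k) \<noteq> 0"
      unfolding s_def by (rule Sum_any.not_neutral_obtains_not_neutral)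
    from bddD(2)[OF B this that(2)] show ?thesis
      using that ab(3) by (simp add: lookup_add lookup_ratio')
  qed
  have "s N = 0" for N
  proof (cases "u \<noteq> a \<and> u \<noteq> b")
    case True
    then show ?thesis using translation_invariant_zero[of s u v "n u"] inv uv bound by metis
  next
    case False
    then have "v \<noteq> a \<and> v \<noteq> b" using uv ab by auto
    then show ?thesis using translation_invariant_zero[of s v u "n v"] inv uv bound by metis
  qed
  then show ?thesis by (simp add: diag_zero_def s_def)
qed

text \<open>The vanishing conditions are inherited by the quotients, so the differences can be divided out one after another. The lower bound on
  the exponents of \<open>v\<close> is carried along for the interpolation argument.\<close>

lemma divide_by_row:
  assumes "distinct (v # us)" "set (v # us) \<subseteq> V" "bdd V n A" "\<forall>u\<in>set us. diag_zero v u A"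
  shows "\<exists>B. act (row 1 (- 1) v us) B = A
      \<and> bdd V (\<lambda>w. n w - (if w = v then int (length us) else if w \<in> set us then 1 else 0)) B
      \<and> (\<forall>a\<in>V. \<forall>b\<in>V. a \<noteq> b \<longrightarrow> a \<noteq> v \<longrightarrow> b \<noteq> v \<longrightarrow> diag_zero a b A \<longrightarrow> diag_zero a b B)
      \<and> (\<forall>l. sbound (\<lambda>N. - lookup N v) l A \<longrightarrow> sbound (\<lambda>N. - lookup N v) l B)"
  using assms
proof (induction us arbitrary: n A)
  case Nil
  then show ?case by (intro exI[of _ A]) (auto elim: bdd_mono)
next
  case (Cons u us)
  have V: "v \<in> V" "u \<in> V" "v \<noteq> u" using Cons.prems by auto
  obtain A' where A': "act (lf 1 v (- 1) u) A' = A"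
    "bdd V (\<lambda>w. n w - (if w = v \<or> w = u then 1 else 0)) A'"
    "\<And>l. sbound (\<lambda>N. - lookup N v) l A \<Longrightarrow> sbound (\<lambda>N. - lookup N v) l A'"
    by (rule divide_by_difference[OF Cons.prems(3) V, of thesis]) (use Cons.prems in auto)
  have vanA': "diag_zero a b A'" if "a \<in> V" "b \<in> V" "a \<noteq> b" "{v, u} \<noteq> {a, b}" "diag_zero a b A" for a b
    using diag_zero_divide[OF A'(2) that(1-3) V that(4)] A'(1) that(5) by simp
  have "\<forall>u'\<in>set us. diag_zero v u' A'"
  proof
    fix u' assume "u' \<in> set us"
    then show "diag_zero v u' A'" using Cons.prems by (intro vanA') (auto simp: doubleton_eq_iff)
  qed
  with Cons.IH[OF _ _ A'(2)] Cons.prems obtain B where B: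
    "act (row 1 (- 1) v us) B = A'"
    "bdd V (\<lambda>w. n w - (if w = v \<or> w = u then 1 else 0) - (if w = v then int (length us) else if w \<in> set us then 1 else 0)) B"
    "\<forall>a\<in>V. \<forall>b\<in>V. a \<noteq> b \<longrightarrow> a \<noteq> v \<longrightarrow> b \<noteq> v \<longrightarrow> diag_zero a b A' \<longrightarrow> diag_zero a b B"
    "\<forall>l. sbound (\<lambda>N. - lookup N v) l A' \<longrightarrow> sbound (\<lambda>N. - lookup N v) l B"
    by auto
  show ?case
  proof (intro exI[of _ B] conjI ballI allI impI)
    show "act (row 1 (- 1) v (u # us)) B = A"
      using B(1) A'(1) by (simp add: act_mult)
    show "bdd V (\<lambda>w. n w - (if w = v then int (length (u # us)) else if w \<in> set (u # us) then 1 else 0)) B"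
      by (rule bdd_mono[OF B(2)]) (use Cons.prems(1) in auto)
    show "diag_zero a b B" if "a \<in> V" "b \<in> V" "a \<noteq> b" "a \<noteq> v" "b \<noteq> v" "diag_zero a b A" for a b
      using that B(3) vanA'[of a b] by (auto simp: doubleton_eq_iff)
    show "sbound (\<lambda>N. - lookup N v) l B" if "sbound (\<lambda>N. - lookup N v) l A" for l
      using that B(4) A'(3) by blast
  qed
qed

lemma divide_by_Vdm:
  assumes "distinct vs" "set vs \<subseteq> V" "bdd V n A" "\<forall>a\<in>set vs. \<forall>b\<in>set vs. a \<noteq> b \<longrightarrow> diag_zero a b A"
  shows "\<exists>B. act (Vdm vs) B = A \<and> bdd V (\<lambda>w. n w - (if w \<in> set vs then int (length vs) - 1 else 0)) B"
  using assms
proof (induction vs arbitrary: n A)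
  case Nil
  then show ?case by (intro exI[of _ A]) (auto simp: Vdm_def elim: bdd_mono)
next
  case (Cons v vs)
  have "\<forall>u\<in>set vs. diag_zero v u A" using Cons.prems by auto
  from divide_by_row[OF Cons.prems(1-3) this] obtain A' where A':
    "act (row 1 (- 1) v vs) A' = A"
    "bdd V (\<lambda>w. n w - (if w = v then int (length vs) else if w \<in> set vs then 1 else 0)) A'"
    "\<forall>a\<in>V. \<forall>b\<in>V. a \<noteq> b \<longrightarrow> a \<noteq> v \<longrightarrow> b \<noteq> v \<longrightarrow> diag_zero a b A \<longrightarrow> diag_zero a b A'"
    by blast
  have "\<forall>a\<in>set vs. \<forall>b\<in>set vs. a \<noteq> b \<longrightarrow> diag_zero a b A'"
  proof (intro ballI impI)
    fix a b assume ab: "a \<in> set vs" "b \<in> set vs" "a \<noteq> b"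
    then have "a \<in> V" "b \<in> V" "a \<noteq> v" "b \<noteq> v" using Cons.prems(1,2) by auto
    moreover have "diag_zero a b A" using ab Cons.prems(4) by simp
    ultimately show "diag_zero a b A'" using A'(3) ab(3) by blast
  qed
  from Cons.IH[OF _ _ A'(2) this] Cons.prems obtain B where B: "act (Vdm vs) B = A'"
    "bdd V (\<lambda>w. n w - (if w = v then int (length vs) else if w \<in> set vs then 1 else 0)
      - (if w \<in> set vs then int (length vs) - 1 else 0)) B"
    by auto
  have "act (Vdm (v # vs)) B = A"
    using A'(1) B(1) by (simp add: Vdm_def act_mult)
  moreover have "bdd V (\<lambda>w. n w - (if w \<in> set (v # vs) then int (length (v # vs)) - 1 else 0)) B"
    by (rule bdd_mono[OF B(2)]) (use Cons.prems(1) in auto)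
  ultimately show ?case by blast
qed

lemma act_difference_injective:
  assumes B: "bdd V n B" and uv: "u \<in> V" "v \<in> V" "u \<noteq> v" and zero: "act (lf 1 u (- 1) v) B = (\<lambda>N. 0)"
  shows "B = (\<lambda>N. 0)"
proof
  fix N
  have "B (N - expo u 1) = B (N - expo v 1)" for N
    using fun_cong[OF zero, of N] by (simp add: act_lf scal_uminus)
  then show "B N = 0"
    using translation_invariant_zero[of B u v "n u" N] uv bddD(2)[OF B] by blast
qed

lemma bdd_act:
  assumes "bdd V n A" "\<And>w. w \<in> V \<Longrightarrow> pbound (\<lambda>M. lookup M w) (m w) p" "pvars V p"
  shows "bdd V (\<lambda>w. m w + n w) (act p A)"
  using assms unfolding bdd_def by (auto intro: svars_act sbound_act)

lemma bdd_act_lf: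
  assumes "bdd V n A" "u \<in> V" "v \<in> V"
  shows "bdd V (\<lambda>w. 1 + n w) (act (lf x u y v) A)"
  by (rule bdd_act) (auto intro: assms pvars_lf pbound_mono[OF pbound_lf_lookup])

lemma bdd_act_row:
  assumes "bdd V n A" "v \<in> V" "set us \<subseteq> V"
  shows "bdd V (\<lambda>w. int (length us) + n w) (act (row x y v us) A)"
  using assms(3)
proof (induction us)
  case (Cons u us)
  then have "bdd V (\<lambda>w. 1 + (int (length us) + n w)) (act (lf x v y u) (act (row x y v us) A))"
    by (intro bdd_act_lf) (use assms in auto)
  then show ?case by (simp add: act_mult add.assoc)
qed (use assms in simp)

lemma act_row_injective:
  assumes "bdd V n B" "distinct (v # us)" "set (v # us) \<subseteq> V"
    "act (row 1 (- 1) v us) B = (\<lambda>N. 0)"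
  shows "B = (\<lambda>N. 0)"
  using assms(2-)
proof (induction us)
  case (Cons u us)
  have b: "bdd V (\<lambda>w. int (length us) + n w) (act (row 1 (- 1) v us) B)"
    by (rule bdd_act_row) (use assms(1) Cons.prems in auto)
  have z: "act (lf 1 v (- 1) u) (act (row 1 (- 1) v us) B) = (\<lambda>N. 0)"
    using Cons.prems(3) by (simp add: act_mult)
  have "act (row 1 (- 1) v us) B = (\<lambda>N. 0)"
    by (rule act_difference_injective[OF b _ _ _ z]) (use Cons.prems(1,2) in auto)
  then show ?case using Cons by auto
qed simp

lemma bdd_act_Vdm:
  assumes "bdd V n A" "set vs \<subseteq> V"
  shows "\<exists>m. bdd V m (act (Vdm vs) A)"
  using assms(2)
proof (induction vs)
  case (Cons v vs)
  then obtain m where "bdd V m (act (Vdm vs) A)" by auto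
  then have "bdd V (\<lambda>w. int (length vs) + m w) (act (row 1 (- 1) v vs) (act (Vdm vs) A))"
    by (rule bdd_act_row) (use Cons.prems in auto)
  then show ?case by (auto simp: Vdm_def act_mult)
qed (use assms in \<open>auto simp: Vdm_def\<close>)

lemma act_Vdm_injective:
  assumes "bdd V n B" "distinct vs" "set vs \<subseteq> V" "act (Vdm vs) B = (\<lambda>N. 0)"
  shows "B = (\<lambda>N. 0)"
  using assms(2-)
proof (induction vs)
  case (Cons v vs)
  obtain m where "bdd V m (act (Vdm vs) B)" using bdd_act_Vdm[OF assms(1)] Cons.prems by auto
  then have "act (Vdm vs) B = (\<lambda>N. 0)"
    using act_row_injective[of V m "act (Vdm vs) B" v vs] Cons.prems
    by (simp add: Vdm_def act_mult)
  then show ?case using Cons by auto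
qed (simp add: Vdm_def)

lemma bdd_diff:
  assumes "bdd V n A" "bdd V m B"
  shows "bdd V (\<lambda>w. max (n w) (m w)) (\<lambda>N. A N - B N)"
  unfolding bdd_def svars_def sbound_def
proof (intro conjI allI impI ballI)
  fix N assume "A N - B N \<noteq> 0"
  then have "A N \<noteq> 0 \<or> B N \<noteq> 0" by auto
  then show "keys N \<subseteq> V" using bddD(1)[OF assms(1)] bddD(1)[OF assms(2)] by blast
next
  fix N w assume w: "w \<in> V" and "A N - B N \<noteq> 0"
  then have "A N \<noteq> 0 \<or> B N \<noteq> 0" by auto
  then have "lookup N w \<le> n w \<or> lookup N w \<le> m w"
    using bddD(2)[OF assms(1) _ w] bddD(2)[OF assms(2) _ w] by blast
  then show "lookup N w \<le> max (n w) (m w)" by linarith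
qed

section \<open>The symmetric factor\<close>

text \<open>Each variable occurs in \<open>a - 1\<close> differences, so division lowers the bound \<open>a - 2\<close> to \<open>-1\<close>.\<close>

definition sym_factor :: "complex \<Rightarrow> var list \<Rightarrow> series \<Rightarrow> bool" where
  "sym_factor q vs B \<longleftrightarrow> act (Vdm vs) B = Gam q vs \<and> bdd (set vs) (\<lambda>_. - 1) B"

lemma bdd_Gam:
  assumes "distinct vs" "q \<noteq> 0"
  shows "bdd (set vs) (\<lambda>_. int (length vs) - 2) (Gam q vs)"
  unfolding bdd_def using svars_Gam sbound_Gam assms by auto

lemma sym_factor_exists:
  assumes "distinct vs" "q \<noteq> 0"
  shows "\<exists>B. sym_factor q vs B"
proof -
  from divide_by_Vdm[OF assms(1) order_refl bdd_Gam[OF assms]] obtain B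
    where B: "act (Vdm vs) B = Gam q vs"
      "bdd (set vs) (\<lambda>w. int (length vs) - 2 - (if w \<in> set vs then int (length vs) - 1 else 0)) B"
    using diag_zero_Gam[OF assms(1)] assms(2) by auto
  have "bdd (set vs) (\<lambda>_. - 1) B" by (rule bdd_mono[OF B(2)]) auto
  with B show ?thesis by (auto simp: sym_factor_def)
qed

lemma sym_factor_unique:
  assumes "distinct vs" "sym_factor q vs B" "sym_factor q vs B'"
  shows "B = B'"
proof -
  have "bdd (set vs) (\<lambda>_. max (- 1) (- 1)) (\<lambda>N. B N - B' N)"
    using assms by (intro bdd_diff) (auto simp: sym_factor_def)
  moreover have "act (Vdm vs) (\<lambda>N. B N - B' N) = (\<lambda>N. 0)"
    using assms by (simp add: sym_factor_def act_fun_diff fun_eq_iff)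
  ultimately have "(\<lambda>N. B N - B' N) = (\<lambda>N. 0)"
    using act_Vdm_injective[OF _ assms(1)] by blast
  then show ?thesis by (simp add: fun_eq_iff)
qed

definition Sf :: "complex \<Rightarrow> var list \<Rightarrow> series" where
  "Sf q vs = (SOME B. sym_factor q vs B)"

lemma sym_factor_Sf: "distinct vs \<Longrightarrow> q \<noteq> 0 \<Longrightarrow> sym_factor q vs (Sf q vs)"
  unfolding Sf_def by (metis someI_ex sym_factor_exists)

lemma Sf_eqI: "distinct vs \<Longrightarrow> sym_factor q vs B \<Longrightarrow> Sf q vs = B"
  unfolding Sf_def by (metis someI_ex sym_factor_unique)

text \<open>Numerator and denominator both change sign.\<close>

lemma Sf_adjacent:
  assumes "distinct (us @ a # b # vs)" "q \<noteq> 0"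
  shows "Sf q (us @ a # b # vs) = Sf q (us @ b # a # vs)"
proof (rule Sf_eqI[OF assms(1)])
  let ?S = "Sf q (us @ b # a # vs)"
  have "sym_factor q (us @ b # a # vs) ?S" by (rule sym_factor_Sf) (use assms in auto)
  then have S: "act (Vdm (us @ b # a # vs)) ?S = Gam q (us @ b # a # vs)"
    "bdd (set (us @ b # a # vs)) (\<lambda>_. - 1) ?S" by (auto simp: sym_factor_def)
  obtain R where R: "Vdm (us @ a # b # vs) = R * lf 1 a (- 1) b" "Vdm (us @ b # a # vs) = R * lf 1 b (- 1) a"
    unfolding Vdm_def using pairprod_adjacent[of "\<lambda>u v. lf 1 u (- 1) v" us a b vs] by blast
  have "lf 1 a (- 1) b = - lf 1 b (- 1) a"
    using lf_swap[of 1 a "- 1" b] lf_neg[of 1 b "- 1" a] by simp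
  then have "Vdm (us @ a # b # vs) = - Vdm (us @ b # a # vs)" using R by simp
  then have "act (Vdm (us @ a # b # vs)) ?S = Gam q (us @ a # b # vs)"
    using S(1) Gam_adjacent[OF assms] by (simp add: fun_eq_iff act_uminus)
  moreover have "set (us @ a # b # vs) = set (us @ b # a # vs)" by auto
  ultimately show "sym_factor q (us @ a # b # vs) ?S" using S(2) by (simp add: sym_factor_def)
qed

lemma Sf_move:
  assumes "distinct (pre @ us @ v # ws)" "q \<noteq> 0"
  shows "Sf q (pre @ us @ v # ws) = Sf q (pre @ v # us @ ws)"
  using assms
proof (induction us arbitrary: ws rule: rev_induct)
  case (snoc u us)
  have "Sf q (pre @ (us @ [u]) @ v # ws) = Sf q (pre @ us @ v # u # ws)"
    using Sf_adjacent[of "pre @ us" u v ws q] snoc.prems by simp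
  also have "\<dots> = Sf q (pre @ v # us @ u # ws)"
    using snoc.IH[of "u # ws"] snoc.prems by auto
  finally show ?case by simp
qed simp

lemma Sf_permute:
  assumes "distinct (pre @ xs)" "mset xs = mset ys" "q \<noteq> 0"
  shows "Sf q (pre @ xs) = Sf q (pre @ ys)"
  using assms
proof (induction xs arbitrary: pre ys)
  case (Cons x xs)
  have "x \<in> set ys" using Cons.prems(2) by (metis list.set_intros(1) set_mset_mset)
  then obtain us ws where ys: "ys = us @ x # ws" by (meson split_list)
  with Cons.prems(2) have m: "mset xs = mset (us @ ws)" by simp
  have dys: "distinct (pre @ us @ x # ws)"
    using Cons.prems(1,2) ys by (metis mset_append mset_eq_imp_distinct_iff)
  have "Sf q (pre @ x # xs) = Sf q ((pre @ [x]) @ us @ ws)"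
    using Cons.IH[of "pre @ [x]" "us @ ws"] Cons.prems m by simp
  also have "\<dots> = Sf q (pre @ us @ x # ws)"
    using Sf_move[OF dys Cons.prems(3)] by simp
  finally show ?case by (simp add: ys)
qed simp

lemma Sf_rename:
  assumes "distinct vs" "a \<noteq> b" "q \<noteq> 0"
  shows "Sf q (map (swap_var a b) vs) N = Sf q vs (swap_exp a b N)"
proof -
  have S: "act (Vdm vs) (Sf q vs) = Gam q vs" "bdd (set vs) (\<lambda>_. - 1) (Sf q vs)"
    using sym_factor_Sf[OF assms(1,3)] by (auto simp: sym_factor_def)
  let ?S = "\<lambda>N. Sf q vs (swap_exp a b N)"
  have "(\<lambda>N. act (Vdm vs) (Sf q vs) (swap_exp a b N)) = act (Vdm (map (swap_var a b) vs)) ?S"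
    using renames_pairprod[OF assms(2), of 1 "- 1" vs] unfolding renames_def Vdm_def by (rule spec)
  then have "act (Vdm (map (swap_var a b) vs)) ?S = Gam q (map (swap_var a b) vs)"
    using S(1) Gam_rename[OF assms(2)] by (auto simp: fun_eq_iff)
  moreover have "bdd (set (map (swap_var a b) vs)) (\<lambda>_. - 1) ?S"
    unfolding bdd_def svars_def sbound_def
  proof (intro conjI allI impI ballI)
    fix N assume N: "?S N \<noteq> 0"
    then have *: "keys (swap_exp a b N) \<subseteq> set vs" using bddD(1)[OF S(2)] by blast
    show "keys N \<subseteq> set (map (swap_var a b) vs)"
    proof
      fix v assume "v \<in> keys N"
      then have "swap_var a b v \<in> keys (swap_exp a b N)" using assms(2) by (simp add: in_keys_iff lookup_swap_exp)
      then have "swap_var a b (swap_var a b v) \<in> swap_var a b ` set vs" using * by blast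
      then show "v \<in> set (map (swap_var a b) vs)" by simp
    qed
    fix w assume "w \<in> set (map (swap_var a b) vs)"
    then obtain v where "v \<in> set vs" "w = swap_var a b v" by auto
    then show "lookup N w \<le> - 1" using bddD(2)[OF S(2) N, of v] assms(2) by (simp add: lookup_swap_exp)
  qed
  moreover have "distinct (map (swap_var a b) vs)"
    using assms(1) by (simp add: distinct_map inj_on_def swap_var_eq_iff)
  ultimately have "Sf q (map (swap_var a b) vs) = ?S" by (intro Sf_eqI) (auto simp: sym_factor_def)
  then show ?thesis by simp
qed

section \<open>Currents in a decreasing chain of variables\<close>

lemma cone_supported_bdd:
  assumes "finite V" "bdd V n A"
  shows "cone_supported A"
proof (rule cone_supportedI[OF assms(1)])
  fix N assume N: "A N \<noteq> 0"
  have "wt S N \<le> (\<Sum>v\<in>V. max 0 (n v))" for S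
  proof -
    have "wt S N = (\<Sum>v\<in>V \<inter> S. lookup N v)"
      by (rule wt_superset) (use assms bddD(1)[OF assms(2) N] in auto)
    also have "\<dots> \<le> (\<Sum>v\<in>V \<inter> S. max 0 (n v))"
      by (rule sum_mono) (use bddD(2)[OF assms(2) N] in force)
    also have "\<dots> \<le> (\<Sum>v\<in>V. max 0 (n v))"
      by (rule sum_mono2) (use assms in auto)
    finally show ?thesis .
  qed
  then show "N \<in> cone V (\<Sum>v\<in>V. max 0 (n v))"
    using bddD(1)[OF assms(2) N] by (simp add: cone_def)
qed

abbreviation chain :: "var list \<Rightarrow> bool" where
  "chain vs \<equiv> sorted_wrt (\<lambda>u v. u \<in> sdown v) vs"

lemma chain_distinct: "chain vs \<Longrightarrow> distinct vs"
  by (induction vs) auto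

definition down_closed :: "var set \<Rightarrow> bool" where
  "down_closed S \<longleftrightarrow> (\<forall>u v. v \<in> S \<longrightarrow> u \<in> sdown v \<longrightarrow> u \<in> S)"

lemma down_closed_chain:
  assumes "chain vs" "down_closed S"
  shows "\<exists>us ws. vs = us @ ws \<and> set us \<subseteq> S \<and> set ws \<inter> S = {}"
  using assms(1)
proof (induction vs)
  case (Cons v vs)
  then obtain us ws where usws: "vs = us @ ws" "set us \<subseteq> S" "set ws \<inter> S = {}" by auto
  show ?case
  proof (cases "v \<in> S")
    case True
    then have "v # vs = (v # us) @ ws \<and> set (v # us) \<subseteq> S \<and> set ws \<inter> S = {}" using usws by simp
    then show ?thesis by blast
  next
    case False
    then have "set (v # vs) \<inter> S = {}"
      using Cons.prems assms(2) unfolding down_closed_def by auto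
    then have "v # vs = [] @ (v # vs) \<and> set [] \<subseteq> S \<and> set (v # vs) \<inter> S = {}" by simp
    then show ?thesis by blast
  qed
qed simp

text \<open>The exponents of the first \<open>k\<close> variables of a decreasing chain add up to at most \<open>-k\<close> unless the
  word lies in \<open>J\<close>.\<close>

lemma cone_supported_Phi:
  assumes "chain vs" "q \<noteq> 0"
  shows "cone_supported (Phi q vs)"
proof (rule cone_supportedI[of "set vs" _ 0])
  fix N assume N: "Phi q vs N \<noteq> 0"
  then have keys: "keys N \<subseteq> set vs" by (auto simp: Phi_def cur_def split: if_splits)
  have "wt S N \<le> 0" if S: "down_closed S" for S
  proof (rule ccontr)
    assume pos: "\<not> wt S N \<le> 0"
    obtain us ws where usws: "vs = us @ ws" "set us \<subseteq> S" "set ws \<inter> S = {}"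
      using down_closed_chain[OF assms(1) S] by blast
    have "wt S N = (\<Sum>v\<in>set vs \<inter> S. lookup N v)" by (rule wt_superset) (use keys in auto)
    also have "set vs \<inter> S = set us" using usws by auto
    also have "(\<Sum>v\<in>set us. lookup N v) = sum_list (map (lookup N) us)"
      using chain_distinct[OF assms(1)] usws by (simp add: sum_list_distinct_conv_sum_set)
    finally have "sum_list (map (\<lambda>v. - lookup N v) us) = - wt S N"
      by (simp add: uminus_sum_list_map comp_def)
    with pos have "sum_list (map (\<lambda>v. - lookup N v) us) < int (length (map (\<lambda>v. - lookup N v) us))"
      by simp
    then have "fw (map (\<lambda>v. - lookup N v) us @ map (\<lambda>v. - lookup N v) ws) \<in> J q"
      by (rule word_in_J[OF assms(2)])
    then show False using N keys usws by (simp add: Phi_def cur_def nf_J)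
  qed
  moreover have "down_closed (sdown v)" "down_closed (insert v (sdown v))" for v
    by (auto simp: down_closed_def intro: sdown_trans)
  ultimately show "N \<in> cone (set vs) 0" using keys by (simp add: cone_def)
qed simp

definition Phic :: "complex \<Rightarrow> var list \<Rightarrow> falg cseries" where
  "Phic q vs = Abs_cseries (Phi q vs)"

definition Sc :: "complex \<Rightarrow> var list \<Rightarrow> falg cseries" where
  "Sc q vs = Abs_cseries (Sf q vs)"

definition Gamc :: "complex \<Rightarrow> var list \<Rightarrow> falg cseries" where
  "Gamc q vs = Abs_cseries (Gam q vs)"

lemma cf_Phic: "chain vs \<Longrightarrow> q \<noteq> 0 \<Longrightarrow> cf (Phic q vs) = Phi q vs"
  by (simp add: Phic_def cone_supported_Phi)

lemma cf_Sc: "distinct vs \<Longrightarrow> q \<noteq> 0 \<Longrightarrow> cf (Sc q vs) = Sf q vs"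
  unfolding Sc_def using sym_factor_Sf[of vs q] cone_supported_bdd[of "set vs"]
  by (auto simp: sym_factor_def)

lemma cf_Gamc: "distinct vs \<Longrightarrow> q \<noteq> 0 \<Longrightarrow> cf (Gamc q vs) = Gam q vs"
  unfolding Gamc_def using bdd_Gam[of vs q] cone_supported_bdd[of "set vs"] by auto

lemma D_Phic: "chain vs \<Longrightarrow> q \<noteq> 0 \<Longrightarrow> sc (emb (D q vs)) * Phic q vs = Gamc q vs"
  by (rule cseries_eqI) (simp add: cf_sc_emb_mult cf_Phic cf_Gamc chain_distinct Gam_def)

lemma Vdm_Sc: "distinct vs \<Longrightarrow> q \<noteq> 0 \<Longrightarrow> sc (emb (Vdm vs)) * Sc q vs = Gamc q vs"
  using sym_factor_Sf[of vs q]
  by (intro cseries_eqI) (simp add: cf_sc_emb_mult cf_Sc cf_Gamc sym_factor_def)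

lemma emb_pairprod_inverse:
  assumes "distinct vs" "x \<noteq> 0" "y \<noteq> 0"
  shows "emb (pairprod (\<lambda>u v. lf x u y v) vs) * pairprod (\<lambda>u v. lf_inv x u y v) vs = 1"
  unfolding emb_pairprod pairprod_mult[symmetric]
  by (rule pairprod_one) (use assms lf_inv_inverse in auto)

text \<open>On cone-supported series the denominator can be inverted.\<close>

lemma Phic_eq:
  assumes "chain vs" "q \<noteq> 0"
  shows "Phic q vs = sc (pairprod (\<lambda>u v. lf_inv q u (- 1 / q) v) vs) * Gamc q vs"
proof -
  have "emb (D q vs) * pairprod (\<lambda>u v. lf_inv q u (- 1 / q) v) vs = 1"
    unfolding D_def by (rule emb_pairprod_inverse) (use assms chain_distinct in auto)
  then have "sc (pairprod (\<lambda>u v. lf_inv q u (- 1 / q) v) vs) * sc (emb (D q vs)) = 1"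
    by (metis sc_mult sc_1 mult.commute)
  then show ?thesis
    unfolding D_Phic[OF assms, symmetric] by (simp add: mult.assoc[symmetric])
qed

section \<open>Reduction modulo the right ideal, coefficientwise\<close>

lift_definition nfs :: "complex \<Rightarrow> falg cseries \<Rightarrow> falg cseries" is "\<lambda>q A N. nf q (A N)"
proof -
  fix q and A :: series assume "cone_supported A"
  then obtain V c where V: "finite V" "\<forall>N. A N \<noteq> 0 \<longrightarrow> N \<in> cone V c"
    unfolding cone_supported_def by blast
  show "cone_supported (\<lambda>N. nf q (A N))"
  proof (rule cone_supportedI[OF V(1)])
    fix N assume "nf q (A N) \<noteq> 0"
    then have "A N \<noteq> 0" by auto
    then show "N \<in> cone V c" using V(2) by blast
  qed
qed

lemma cf_nfs: "cf (nfs q A) N = nf q (cf A N)"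
  by transfer simp

lemma nf_Sum_any:
  assumes "finite {M. g M \<noteq> 0}"
  shows "nf q (Sum_any g) = Sum_any (\<lambda>M. nf q (g M))"
  by (rule Sum_any_additive) (simp_all add: nf_add assms)

lemma nfs_diff: "nfs q (A - B) = nfs q A - nfs q B"
  by (rule cseries_eqI) (simp add: cf_nfs nf_diff)

lemma nfs_sc_mult: "nfs q (sc c * A) = sc c * nfs q A"
proof (rule cseries_eqI)
  fix N
  have "finite {M. cf (sc c) M * cf A (N - M) \<noteq> 0}"
    by (rule finite_conv_terms[OF cone_supported_cf cone_supported_cf])
  then show "cf (nfs q (sc c * A)) N = cf (sc c * nfs q A) N"
    unfolding cf_mult cf_nfs conv_def by (subst nf_Sum_any) (simp_all add: nf_scal)
qed

lemma nf_mult_fwords: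
  assumes "y \<in> fwords"
  shows "nf q (nf q x * y) = nf q (x * y)"
  using assms unfolding fwords_def
proof (induction rule: V.span_induct_alt)
  case (step c b y)
  then obtain ns where "b = fw ns" by auto
  then show ?case using step(2)
    by (simp add: distrib_left nf_add scal_left_commute nf_scal nf_nf_mult_fw)
qed simp

text \<open>Products of series inherit the compatibility of reduction with right multiplication.\<close>

lemma nfs_nfs_mult:
  assumes "\<And>N. cf B N \<in> fwords"
  shows "nfs q (nfs q A * B) = nfs q (A * B)"
proof (rule cseries_eqI)
  fix N
  have "finite {M. cf (nfs q A) M * cf B (N - M) \<noteq> 0}" "finite {M. cf A M * cf B (N - M) \<noteq> 0}"
    by (rule finite_conv_terms; simp)+
  then show "cf (nfs q (nfs q A * B)) N = cf (nfs q (A * B)) N"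
    unfolding cf_mult cf_nfs conv_def
    by (simp add: nf_Sum_any cf_nfs[abs_def] nf_mult_fwords assms)
qed

text \<open>All coefficients are combinations of words in positive modes, which the projection fixes.\<close>

definition pos :: "falg cseries \<Rightarrow> bool" where
  "pos A \<longleftrightarrow> (\<forall>N. cf A N \<in> fwords_pos)"

lemma fwords_pos_fw: "\<forall>n\<in>set ns. 0 < n \<Longrightarrow> fw ns \<in> fwords_pos"
  unfolding fwords_pos_def by (intro V.span_base) auto

lemma fwords_pos_mult:
  assumes "x \<in> fwords_pos" "y \<in> fwords_pos"
  shows "x * y \<in> fwords_pos"
proof -
  have *: "fw ms * y \<in> fwords_pos" if "\<forall>n\<in>set ms. 0 < n" for ms
    using assms(2) unfolding fwords_pos_def
  proof (induction rule: V.span_induct_alt)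
    case base
    then show ?case by (simp add: V.span_zero)
  next
    case (step c b y)
    then obtain ns where "b = fw ns" "\<forall>n\<in>set ns. 0 < n" by auto
    then have "fw ms * b \<in> fwords_pos"
      using that fwords_pos_fw[of "ms @ ns"] by (auto simp: fw_append)
    with step show ?case
      by (simp add: distrib_left scal_left_commute V.span_add V.span_scale fwords_pos_def)
  qed
  show ?thesis
    unfolding fwords_pos_def
    by (rule span_mult_right[OF _ assms(1)[unfolded fwords_pos_def]]) (use * in \<open>auto simp: fwords_pos_def\<close>)
qed

lemma fwords_pos_scal: "scal c \<in> fwords_pos"
  using V.span_scale[of 1 _ c] fwords_pos_fw[of "[]"] unfolding fwords_pos_def by simp

lemma fwords_pos_Sum_any: "(\<And>M. g M \<in> fwords_pos) \<Longrightarrow> Sum_any g \<in> fwords_pos"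
  unfolding Sum_any.expand_set fwords_pos_def by (rule V.span_sum) auto

lemma pos_mult: "pos A \<Longrightarrow> pos B \<Longrightarrow> pos (A * B)"
  unfolding pos_def cf_mult conv_def by (auto intro!: fwords_pos_Sum_any fwords_pos_mult)

lemma pos_sc: "pos (sc c)"
  by (simp add: pos_def fwords_pos_scal)

lemma pos_1: "pos 1"
  using pos_sc[of 1] by simp

lemma pos_diff: "pos A \<Longrightarrow> pos B \<Longrightarrow> pos (A - B)"
  by (simp add: pos_def fwords_pos_def V.span_diff)

lemma pos_sum_list: "(\<And>A. A \<in> set As \<Longrightarrow> pos A) \<Longrightarrow> pos (sum_list As)"
  by (induction As) (auto simp: pos_def fwords_pos_def V.span_add V.span_zero)

lemma pos_prod_list: "(\<And>A. A \<in> set As \<Longrightarrow> pos A) \<Longrightarrow> pos (prod_list As)"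
  by (induction As) (auto intro: pos_1 pos_mult)

lemma pos_fp: "pos (fp v)"
proof -
  have "f_plus v N \<in> fwords_pos" for N
    using fwords_pos_fw[of "[- lookup N v]"] fwords_pos_scal[of 0]
    by (simp add: f_plus_def Let_def fw_Cons)
  then show ?thesis by (simp add: pos_def cf_fp)
qed

lemma fwords_pos_subset: "fwords_pos \<subseteq> fwords"
  unfolding fwords_pos_def fwords_def by (rule V.span_mono) auto

section \<open>The formal integrals\<close>

definition cbound :: "((var \<Rightarrow>\<^sub>0 int) \<Rightarrow> int) \<Rightarrow> int \<Rightarrow> 'a::zero cseries \<Rightarrow> bool" where
  "cbound f n A \<longleftrightarrow> (\<forall>N. cf A N \<noteq> 0 \<longrightarrow> f N \<le> n)"

lemma cbound_mult:
  assumes "additive_fun f" "cbound f m A" "cbound f n B"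
  shows "cbound f (m + n) (A * B)"
  unfolding cbound_def
proof (intro allI impI)
  fix N assume "cf (A * B) N \<noteq> 0"
  then obtain M where M: "cf A M \<noteq> 0" "cf B (N - M) \<noteq> 0" by (rule cf_mult_nonzeroE)
  then have "f M \<le> m" "f (N - M) \<le> n" using assms by (auto simp: cbound_def)
  moreover have "f (M + (N - M)) = f M + f (N - M)" using assms(1) unfolding additive_fun_def by blast
  ultimately show "f N \<le> m + n" by simp
qed

lemma cbound_1: "additive_fun f \<Longrightarrow> cbound f 0 (1 :: 'a::ring_1 cseries)"
  by (auto simp: cbound_def cf_one additive_fun_0)

lemma cbound_prod_list:
  fixes As :: "'a::ring_1 cseries list"
  assumes "additive_fun f" "\<And>A. A \<in> set As \<Longrightarrow> cbound f n A"
  shows "cbound f (n * int (length As)) (prod_list As)"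
  using assms(2)
proof (induction As)
  case (Cons A As)
  then have "cbound f (n + n * int (length As)) (A * prod_list As)"
    by (intro cbound_mult assms(1)) auto
  then show ?case by (simp add: algebra_simps)
qed (simp add: cbound_1 assms(1))

lemma cbound_sc: "cbound f n A \<Longrightarrow> cbound f n (sc A)"
  unfolding cbound_def by (metis cf_sc scal_0)

lemma cbound_emb: "pbound f n p \<Longrightarrow> cbound f n (emb p)"
  by (auto simp: cbound_def pbound_def cf_emb in_keys_iff)

lemma cbound_mono: "cbound f n A \<Longrightarrow> n \<le> m \<Longrightarrow> cbound f m A"
  by (force simp: cbound_def)

lemma cbound_single: "f M \<le> n \<Longrightarrow> cbound f n (emb (Poly_Mapping.single M c))"
  by (rule cbound_emb) (auto simp: pbound_def)

lemma cbound_geomc: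
  assumes "u \<in> sdown v" "\<And>k. k \<ge> 0 \<Longrightarrow> f (ratio v u k) \<le> n"
  shows "cbound f n (geomc c v u)"
  unfolding cbound_def cf_geomc[OF assms(1)]
proof (intro allI impI)
  fix N assume "geomf c v u N \<noteq> 0"
  then have "lookup N v \<ge> 0" "N = ratio v u (lookup N v)" by (auto simp: geomf_def split: if_splits)
  then show "f N \<le> n" using assms(2) by metis
qed

definition free :: "var \<Rightarrow> complex cseries \<Rightarrow> bool" where
  "free w A \<longleftrightarrow> cbound (\<lambda>N. lookup N w) 0 A \<and> cbound (\<lambda>N. - lookup N w) 0 A"

lemma freeD: "free w A \<Longrightarrow> cf A N \<noteq> 0 \<Longrightarrow> lookup N w = 0"
  unfolding free_def cbound_def by force

lemma free_mult: "free w A \<Longrightarrow> free w B \<Longrightarrow> free w (A * B)"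
  unfolding free_def using cbound_mult[of _ 0 A 0 B] by fastforce

lemma free_1: "free w 1"
  unfolding free_def by (simp add: cbound_1)

lemma free_prod_list: "(\<And>A. A \<in> set As \<Longrightarrow> free w A) \<Longrightarrow> free w (prod_list As)"
  by (induction As) (auto intro: free_1 free_mult)

lemma free_pairprod:
  assumes "distinct vs" "\<And>u v. u \<in> set vs \<Longrightarrow> v \<in> set vs \<Longrightarrow> u \<noteq> v \<Longrightarrow> free w (g u v)"
  shows "free w (pairprod g vs)"
  using assms
proof (induction vs)
  case (Cons v vs)
  have "free w (prod_list (map (g v) vs))"
    by (rule free_prod_list) (use Cons.prems in auto)
  then show ?case using Cons by (auto intro!: free_mult)
qed (simp add: free_1)

lemma free_single: "lookup M w = 0 \<Longrightarrow> free w (emb (Poly_Mapping.single M c))"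
  unfolding free_def by (auto intro: cbound_single)

lemma free_emb_add: "free w (emb p) \<Longrightarrow> free w (emb r) \<Longrightarrow> free w (emb (p + r))"
  unfolding free_def cbound_def by (auto simp: emb_add) (metis add_cancel_left_right)+

lemma free_emb_lf: "u \<noteq> w \<Longrightarrow> v \<noteq> w \<Longrightarrow> free w (emb (lf x u y v))"
  unfolding lf_def by (intro free_emb_add free_single) (auto simp: lookup_single)

lemma free_geomc: "u \<in> sdown v \<Longrightarrow> u \<noteq> w \<Longrightarrow> v \<noteq> w \<Longrightarrow> free w (geomc c v u)"
  unfolding free_def by (auto intro!: cbound_geomc simp: ratio_def lookup_minus lookup_single)

lemma free_lf_inv: "u \<noteq> v \<Longrightarrow> u \<noteq> w \<Longrightarrow> v \<noteq> w \<Longrightarrow> free w (lf_inv x u y v)"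
  using sdown_linear[of u v]
  by (auto simp: lf_inv_def lookup_single intro!: free_mult free_single free_geomc)

lemma oi_diff: "oi w (A - B) = oi w A - oi w (B :: falg cseries)"
  by (rule cseries_eqI) (simp add: cf_oi)

lemma oi_add: "oi w (A + B) = oi w A + oi w (B :: falg cseries)"
  by (rule cseries_eqI) (simp add: cf_oi)

lemma oi_free_mult:
  assumes "free w c"
  shows "oi w (sc c * A) = sc c * oi w A"
proof (rule cseries_eqI)
  fix N
  have "(if lookup N w = 0 then cf (sc c) M * cf A (N - M) else 0) = cf (sc c) M * cf (oi w A) (N - M)" for M
  proof (cases "cf c M = 0")
    case False
    then have "lookup (N - M) w = lookup N w" using freeD[OF assms] by (simp add: lookup_minus)
    then show ?thesis by (simp add: cf_oi)
  qed simp
  then have "Sum_any (\<lambda>M. if lookup N w = 0 then cf (sc c) M * cf A (N - M) else 0)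
    = Sum_any (\<lambda>M. cf (sc c) M * cf (oi w A) (N - M))"
    by (rule Sum_any.cong)
  then show "cf (oi w (sc c * A)) N = cf (sc c * oi w A) N"
    unfolding cf_oi[of w "sc c * A"] cf_mult conv_def by (cases "lookup N w = 0") (simp_all only: if_True if_False simp_thms Sum_any.neutral)
qed

text \<open>The kernel \<open>(w/t) / (1 - w/t)\<close> of the substitution of \<open>t = t\<^sub>k\<close> for \<open>w = w\<^sub>k\<close>.\<close>

definition Kf :: "nat \<Rightarrow> complex cseries" where
  "Kf k = emb (Poly_Mapping.single (ratio (W k) (T k) 1) 1) * geomc 1 (W k) (T k)"

abbreviation xv :: "var \<Rightarrow> complex cseries" where
  "xv v \<equiv> emb (Poly_Mapping.single (expo v 1) 1)"

abbreviation cst :: "complex \<Rightarrow> complex cseries" where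
  "cst c \<equiv> emb (Poly_Mapping.single 0 c)"

lemma emb_lf: "emb (lf x u y v) = cst x * xv u + cst y * xv v"
  by (simp add: lf_def emb_add emb_mult[symmetric] mult_single)

lemma X_ratio: "xv u * (1 - emb (Poly_Mapping.single (ratio v u 1) c)) = emb (lf 1 u (- c) v)"
  by (simp add: right_diff_distrib lf_def emb_add emb_mult[symmetric] mult_single ratio_def
      single_uminus emb_uminus emb_diff)

lemma X_geomc:
  assumes "u \<in> sdown v"
  shows "emb (lf 1 u (- c) v) * geomc c v u = xv u"
  unfolding X_ratio[symmetric] mult.assoc geomc_inverse[OF assms] by simp

lemma Kf_X: "Kf k * xv (W k) = xv (T k) * Kf k - xv (W k)"
proof -
  let ?r = "emb (Poly_Mapping.single (ratio (W k) (T k) 1) 1)"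
  have "xv (T k) - xv (W k) = emb (lf 1 (T k) (- 1) (W k))"
    by (simp add: lf_def emb_add emb_diff[symmetric] single_uminus)
  then have "(xv (T k) - xv (W k)) * Kf k = ?r * (emb (lf 1 (T k) (- 1) (W k)) * geomc 1 (W k) (T k))"
    unfolding Kf_def by (simp only: mult.left_commute)
  also have "\<dots> = xv (T k) * ?r"
    by (subst X_geomc[of "T k" "W k" 1]) (simp_all add: mult.commute)
  also have "\<dots> = xv (W k)"
    by (simp add: emb_mult[symmetric] mult_single ratio_def)
  finally show ?thesis by (simp add: left_diff_distrib mult.commute algebra_simps)
qed

text \<open>On series with negative exponents of \<open>w\<^sub>k\<close> this is the substitution of \<open>t\<^sub>k\<close> for \<open>w\<^sub>k\<close>.\<close>

definition L :: "nat \<Rightarrow> falg cseries \<Rightarrow> falg cseries" where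
  "L k A = oi (W k) (sc (Kf k) * A)"

lemma L_add: "L k (A + B) = L k A + L k B"
  by (simp add: L_def distrib_left oi_add)

lemma L_free: "free (W k) c \<Longrightarrow> L k (sc c * A) = sc c * L k A"
  unfolding L_def sc_left_commute[of "sc (Kf k)"] by (rule oi_free_mult)

text \<open>The kernel satisfies \<open>K w = t K - w\<close>, and the term without \<open>K\<close> has no coefficient at \<open>w\<^sup>0\<close>.\<close>

lemma L_X:
  assumes "cbound (\<lambda>N. lookup N (W k)) (- 2) A"
  shows "L k (sc (xv (W k)) * A) = sc (xv (T k)) * L k A"
proof -
  have "oi (W k) (sc (xv (W k)) * A) = 0"
  proof (rule cseries_eqI)
    fix N
    have "cf (sc (xv (W k)) * A) N = 0" if "lookup N (W k) = 0"
    proof -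
      have "lookup (N - expo (W k) 1) (W k) = - 1" using that by (simp add: lookup_minus)
      then have "cf A (N - expo (W k) 1) = 0" using assms unfolding cbound_def by force
      then show ?thesis by (simp add: cf_sc_emb_mult act_single)
    qed
    then show "cf (oi (W k) (sc (xv (W k)) * A)) N = cf 0 N" by (simp add: cf_oi)
  qed
  moreover have "sc (Kf k) * (sc (xv (W k)) * A) = sc (xv (T k)) * (sc (Kf k) * A) - sc (xv (W k)) * A"
    unfolding mult.assoc[symmetric] sc_mult[symmetric] Kf_X sc_diff left_diff_distrib ..
  moreover have "free (W k) (xv (T k))" by (rule free_single) (simp add: lookup_single)
  ultimately show ?thesis
    by (simp add: L_def oi_diff oi_free_mult)
qed

lemma L_lf:
  assumes "cbound (\<lambda>N. lookup N (W k)) (- 2) A" "u \<noteq> W k"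
  shows "L k (sc (emb (lf x (W k) y u)) * A) = sc (emb (lf x (T k) y u)) * L k A"
proof -
  have fr: "free (W k) (cst x)" "free (W k) (cst y * xv u)"
    using assms(2) by (auto intro!: free_mult free_single simp: lookup_single)
  have "L k (sc (emb (lf x (W k) y u)) * A) = sc (cst x) * L k (sc (xv (W k)) * A) + sc (cst y * xv u) * L k A"
    unfolding emb_lf sc_add distrib_right L_add L_free[OF fr(2)] sc_mult[of "cst x"] mult.assoc[of "sc (cst x)"] L_free[OF fr(1)] ..
  also have "\<dots> = sc (emb (lf x (T k) y u)) * L k A"
    unfolding L_X[OF assms(1)] emb_lf sc_add distrib_right sc_mult[of "cst x"] mult.assoc ..
  finally show ?thesis .
qed

text \<open>The bound on the exponents leaves room for all the linear forms, so that every intermediate product still has negative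
  exponents.\<close>

lemma L_prod:
  assumes "cbound (\<lambda>N. lookup N (W k)) (- 1 - int (length us)) A" "W k \<notin> set us"
  shows "L k (sc (emb (row x y (W k) us)) * A)
    = sc (emb (row x y (T k) us)) * L k A"
  using assms
proof (induction us)
  case (Cons u us)
  let ?P = "\<lambda>v. emb (row x y v us)"
  have "pbound (\<lambda>M. lookup M (W k)) (1 * int (length (map (\<lambda>u. lf x (W k) y u) us))) (row x y (W k) us)"
    by (rule pbound_prod_list) (auto intro: pbound_mono[OF pbound_lf_lookup])
  then have "cbound (\<lambda>N. lookup N (W k)) (int (length us) + (- 1 - int (length (u # us)))) (sc (?P (W k)) * A)"
    using Cons.prems(1) by (intro cbound_mult cbound_sc cbound_emb) auto
  then have b: "cbound (\<lambda>N. lookup N (W k)) (- 2) (sc (?P (W k)) * A)" by simp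
  have "cbound (\<lambda>N. lookup N (W k)) (- 1 - int (length us)) A"
    by (rule cbound_mono[OF Cons.prems(1)]) simp
  then have IH: "L k (sc (?P (W k)) * A) = sc (?P (T k)) * L k A"
    using Cons.IH Cons.prems(2) by simp
  have "L k (sc (emb (lf x (W k) y u)) * (sc (?P (W k)) * A)) = sc (emb (lf x (T k) y u)) * (sc (?P (T k)) * L k A)"
    using L_lf[OF b, of u x y] Cons.prems(2) IH by auto
  then show ?case by (simp add: emb_mult sc_mult mult.assoc)
qed simp

lemma cf_Kf: "cf (Kf k) N = (if lookup N (W k) \<ge> 1 \<and> N = ratio (W k) (T k) (lookup N (W k)) then 1 else 0)"
proof -
  have "cf (Kf k) N = geomf 1 (W k) (T k) (N - ratio (W k) (T k) 1)"
    by (simp add: Kf_def cf_emb_single_mult cf_geomc)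
  moreover have "lookup (N - ratio (W k) (T k) 1) (W k) = lookup N (W k) - 1"
    by (simp add: lookup_minus lookup_ratio')
  moreover have "N - ratio (W k) (T k) 1 = ratio (W k) (T k) (lookup N (W k) - 1) \<longleftrightarrow> N = ratio (W k) (T k) (lookup N (W k))"
    by (simp add: ratio_diff)
  ultimately show ?thesis by (auto simp: geomf_def)
qed

text \<open>Every exponent of \<open>w\<^sub>k\<close> in the symmetric factor is negative, so the kernel contributes exactly one term to each coefficient:
  the one that moves the whole exponent of \<open>w\<^sub>k\<close> to \<open>t\<^sub>k\<close>.\<close>

lemma L_Sc:
  assumes "distinct (us @ W k # vs)" "T k \<notin> set (us @ vs)" "q \<noteq> 0"
  shows "L k (Sc q (us @ W k # vs)) = Sc q (us @ T k # vs)"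
proof (rule cseries_eqI)
  fix N
  let ?w = "W k" and ?t = "T k" and ?ws = "us @ W k # vs"
  let ?S = "Sf q ?ws"
  have bS: "bdd (set ?ws) (\<lambda>_. - 1) ?S"
    using sym_factor_Sf[OF assms(1,3)] by (simp add: sym_factor_def)
  have dt: "distinct (us @ ?t # vs)" using assms(1,2) by auto
  have "map (swap_var ?w ?t) us = us" "map (swap_var ?w ?t) vs = vs"
    using assms(1,2) by (auto intro!: map_idI simp: swap_var_def)
  then have "map (swap_var ?w ?t) ?ws = us @ ?t # vs" by (simp add: swap_var_def)
  then have rhs: "cf (Sc q (us @ ?t # vs)) N = ?S (swap_exp ?w ?t N)"
    using Sf_rename[OF assms(1), of ?w ?t q N] assms(3) by (simp add: cf_Sc[OF dt])
  have lsw: "lookup (swap_exp ?w ?t N) ?w = lookup N ?t" "lookup (swap_exp ?w ?t N) ?t = lookup N ?w"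
    by (simp_all add: lookup_swap_exp swap_var_def)
  show "cf (L k (Sc q ?ws)) N = cf (Sc q (us @ ?t # vs)) N"
  proof (cases "lookup N ?w = 0")
    case False
    have "?S (swap_exp ?w ?t N) = 0"
    proof (rule ccontr)
      assume "?S (swap_exp ?w ?t N) \<noteq> 0"
      then have "keys (swap_exp ?w ?t N) \<subseteq> set ?ws" by (rule bddD(1)[OF bS])
      moreover have "?t \<in> keys (swap_exp ?w ?t N)" using False lsw by (simp add: in_keys_iff)
      ultimately show False using assms(2) by auto
    qed
    then show ?thesis using False by (simp add: rhs L_def cf_oi)
  next
    case True
    let ?M = "ratio ?w ?t (- lookup N ?t)"
    have NM: "N - ?M = swap_exp ?w ?t N"
      using True by (intro poly_mapping_eqI) (auto simp: lookup_minus lookup_swap_exp swap_var_def lookup_ratio')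
    have tm: "cf (sc (Kf k)) M * cf (Sc q ?ws) (N - M)
      = (if M = ?M then cf (sc (Kf k)) ?M * ?S (swap_exp ?w ?t N) else 0)" for M
    proof (cases "M = ?M")
      case True
      then show ?thesis by (simp add: NM cf_Sc[OF assms(1,3)])
    next
      case False
      have "cf (Kf k) M = 0 \<or> ?S (N - M) = 0"
      proof (rule ccontr)
        assume *: "\<not> (cf (Kf k) M = 0 \<or> ?S (N - M) = 0)"
        then have M: "M = ratio ?w ?t (lookup M ?w)" by (auto simp: cf_Kf split: if_splits)
        have "keys (N - M) \<subseteq> set ?ws" using * bddD(1)[OF bS] by blast
        then have "lookup (N - M) ?t = 0" using assms(2) by (auto simp: keys_subset_iff)
        moreover have "lookup M ?t = - lookup M ?w" by (subst M) (simp add: lookup_ratio')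
        ultimately have "lookup M ?w = - lookup N ?t" by (simp add: lookup_minus)
        then show False using M False by simp
      qed
      then show ?thesis using False by (auto simp: cf_Sc[OF assms(1,3)])
    qed
    have "cf (sc (Kf k) * Sc q ?ws) N = cf (sc (Kf k)) ?M * ?S (swap_exp ?w ?t N)"
      unfolding cf_mult conv_def tm by (rule Sum_any.delta)
    also have "\<dots> = ?S (swap_exp ?w ?t N)"
    proof (cases "?S (swap_exp ?w ?t N) = 0")
      case False
      then have "lookup (swap_exp ?w ?t N) ?w \<le> - 1" by (rule bddD(2)[OF bS]) simp
      then show ?thesis by (simp add: cf_Kf lookup_ratio' lsw)
    qed simp
    finally show ?thesis using True by (simp add: L_def cf_oi rhs)
  qed
qed

text \<open>The factors of the kernel that contain \<open>t\<^sub>i\<close> and the earlier integration variables.\<close>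

definition Zrest :: "complex \<Rightarrow> nat \<Rightarrow> complex cseries" where
  "Zrest q i = prod_list (map (\<lambda>j. Zfactor q i j) [1..<i])"

lemma Zfac_eq: "Zfac q i = Kf i * Zrest q i"
  by (simp add: Zfac_def Kf_def Zrest_def)

text \<open>The factor \<open>(q - q\<^sup>-\<^sup>1 w/t) / (1 - w/t)\<close> of the kernel is inverse to \<open>(t - w) / (q t - q\<^sup>-\<^sup>1 w)\<close>.\<close>

lemma Zrest_cancel:
  assumes "q \<noteq> 0"
  shows "Zrest q i * (emb (row 1 (- 1) (T i) (map W [1..<i]))
    * inv_row q (- 1 / q) (T i) (map W [1..<i])) = 1"
proof -
  have "Zfactor q i j
      * (emb (lf 1 (T i) (- 1) (W j)) * lf_inv q (T i) (- 1 / q) (W j)) = 1" (is "?c * ?g * (?l * ?r) = 1") for j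
  proof -
    have "?c * ?g * (?l * ?r) = ?c * (?l * ?g) * ?r" by (simp add: ac_simps)
    also have "?l * ?g = xv (T i)" using X_geomc[of "T i" "W j" 1] by simp
    also have "?c * xv (T i) = emb (lf q (T i) (- 1 / q) (W j))"
      by (simp add: emb_mult[symmetric] lf_def distrib_right mult_single ratio_def)
    also have "emb (lf q (T i) (- 1 / q) (W j)) * ?r = 1"
      by (rule lf_inv_inverse) (use assms in auto)
    finally show ?thesis .
  qed
  then have one: "prod_list (map (\<lambda>j. Zfactor q i j
      * (emb (lf 1 (T i) (- 1) (W j)) * lf_inv q (T i) (- 1 / q) (W j))) js) = 1" for js
    by (induction js) (simp_all only: list.map prod_list.Nil prod_list.Cons mult_1)
  have split: "prod_list (map (\<lambda>j. f j * (g j * h j)) js) = prod_list (map f js) * (prod_list (map g js) * prod_list (map h js))"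
    for f g h :: "nat \<Rightarrow> complex cseries" and js
    by (induction js) (simp_all add: ac_simps)
  show ?thesis
    using one[of "[1..<i]"] unfolding split Zrest_def emb_prod_list map_map comp_def .
qed

text \<open>The ratio of the Vandermonde product to the denominator of the weight function.\<close>

definition Rat :: "complex \<Rightarrow> var list \<Rightarrow> complex cseries" where
  "Rat q vs = pairprod (\<lambda>u v. emb (lf 1 u (- 1) v)) vs * pairprod (\<lambda>u v. lf_inv q u (- 1 / q) v) vs"

lemma Phic_eq_Sc:
  assumes "chain vs" "q \<noteq> 0"
  shows "Phic q vs = sc (Rat q vs) * Sc q vs"
proof -
  let ?P = "pairprod (\<lambda>u v. lf_inv q u (- 1 / q) v) vs"
  have "Phic q vs = sc ?P * (sc (emb (Vdm vs)) * Sc q vs)"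
    using Phic_eq[OF assms] Vdm_Sc[OF chain_distinct[OF assms(1)] assms(2)] by simp
  also have "\<dots> = sc (?P * emb (Vdm vs)) * Sc q vs"
    by (simp only: sc_mult mult.assoc)
  also have "?P * emb (Vdm vs) = Rat q vs"
    by (simp only: Rat_def Vdm_def emb_pairprod mult.commute)
  finally show ?thesis .
qed

lemma cbound_lf_inv:
  assumes "u \<in> sdown v"
  shows "cbound (\<lambda>N. lookup N u) (- 1) (lf_inv x u y v)"
proof -
  have uv: "u \<noteq> v" using assms by auto
  have "cbound (\<lambda>N. lookup N u) (- 1 + 0) (emb (Poly_Mapping.single (expo u (- 1)) (1 / x)) * geomc (- y / x) v u)"
    using assms uv by (intro cbound_mult cbound_single cbound_geomc) (auto simp: lookup_ratio')
  then show ?thesis using assms by (simp add: lf_inv_def)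
qed

lemma row_inverse:
  assumes "t \<notin> set us" "x \<noteq> 0" "y \<noteq> 0"
  shows "emb (row x y t us) * inv_row x y t us = 1"
  using assms(1)
proof (induction us)
  case (Cons u us)
  then have *: "emb (lf x t y u) * lf_inv x t y u = 1"
    by (intro lf_inv_inverse) (use assms in auto)
  have "emb (row x y t (u # us)) * inv_row x y t (u # us)
    = (emb (lf x t y u) * lf_inv x t y u) * (emb (row x y t us) * inv_row x y t us)"
    by (simp add: emb_mult ac_simps)
  then show ?case using Cons * by simp
qed simp

text \<open>Substitution commutes with these fractions: after division by the denominators the exponents of \<open>w\<^sub>k\<close> are so
  low that the linear forms of the numerator, and those of the denominator, can be pulled out one by one.\<close>

lemma L_row:
  assumes "q \<noteq> 0" "distinct (us @ W k # vs)" "T k \<notin> set (us @ vs)"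
  defines "ws \<equiv> map W [1..<k]"
  shows "L k (sc (emb (row 1 (- 1) (W k) ws) * inv_row q (- 1 / q) (W k) ws)
        * Sc q (us @ W k # vs))
    = sc (emb (row 1 (- 1) (T k) ws) * inv_row q (- 1 / q) (T k) ws)
        * Sc q (us @ T k # vs)"
proof -
  let ?S = "Sc q (us @ W k # vs)"
  let ?r = "\<lambda>t. inv_row q (- 1 / q) t ws"
  let ?d = "\<lambda>t. emb (row q (- 1 / q) t ws)"
  have w: "W k \<notin> set ws" by (auto simp: ws_def)
  have inv: "?d t * ?r t = 1" if "t \<notin> set ws" for t
    using row_inverse[OF that, of q "- 1 / q"] assms(1) by simp
  have "cbound (\<lambda>N. lookup N (W k)) (- 1) ?S"
    using sym_factor_Sf[OF assms(2,1)] by (auto simp: cbound_def cf_Sc[OF assms(2,1)] sym_factor_def bdd_def sbound_def)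
  moreover have "cbound (\<lambda>N. lookup N (W k)) (- 1 * int (length (map (\<lambda>v. lf_inv q (W k) (- 1 / q) v) ws))) (?r (W k))"
    by (rule cbound_prod_list) (auto simp: ws_def intro!: cbound_lf_inv)
  ultimately have "cbound (\<lambda>N. lookup N (W k)) (- 1 * int (length (map (\<lambda>v. lf_inv q (W k) (- 1 / q) v) ws)) + (- 1)) (sc (?r (W k)) * ?S)"
    by (intro cbound_mult cbound_sc) auto
  then have b: "cbound (\<lambda>N. lookup N (W k)) (- 1 - int (length ws)) (sc (?r (W k)) * ?S)"
    by (rule cbound_mono) simp
  have "sc (?d (W k)) * (sc (?r (W k)) * ?S) = ?S"
    using inv[OF w] by (simp add: mult.assoc[symmetric] sc_mult[symmetric])
  then have "Sc q (us @ T k # vs) = sc (?d (T k)) * L k (sc (?r (W k)) * ?S)"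
    using L_prod[OF b w, of q "- 1 / q"] L_Sc[OF assms(2,3,1)] by simp
  moreover have "?r (T k) * ?d (T k) = 1" using inv[of "T k"] by (auto simp: ws_def mult.commute)
  ultimately have "sc (?r (T k)) * Sc q (us @ T k # vs) = L k (sc (?r (W k)) * ?S)"
    by (simp only: mult.assoc[symmetric] sc_mult[symmetric] sc_1 mult_1_left)
  then show ?thesis
    using L_prod[OF b w, of 1 "- 1"] by (simp add: sc_mult mult.assoc)
qed

text \<open>The variables that are left when the integrations over the \<open>w\<^sub>i\<close> with \<open>i > k\<close> have been carried out.\<close>

definition mix :: "nat \<Rightarrow> nat \<Rightarrow> var list" where
  "mix a k = map W [1..<k + 1] @ map T [k + 1..<a + 1]"

abbreviation wrev :: "nat \<Rightarrow> var list" where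
  "wrev k \<equiv> rev (map W [1..<k + 1])"

text \<open>The innermost integration concerns the largest index. Apart from its own kernel, one fraction and the symmetric factor,
  everything under it is free of that variable, and after the substitution the fraction cancels against the remaining factors of the
  kernel that contain \<open>t\<close> with this index.\<close>

lemma integrate_all:
  assumes "q \<noteq> 0" "k \<le> a"
  shows "foldr oi (map W [1..<k + 1]) (sc (prod_list (map (Zfac q) [1..<k + 1]) * Rat q (wrev k)) * Sc q (mix a k)) = Sc q (tvars a)"
  using assms(2)
proof (induction k)
  case 0
  show ?case by (simp add: mix_def Rat_def)
next
  case (Suc k)
  let ?w = "W (Suc k)" and ?t = "T (Suc k)" and ?us = "map W [1..<k + 1]" and ?vs = "map T [Suc k + 1..<a + 1]"
  have mixS: "mix a (Suc k) = ?us @ ?w # ?vs"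
    by (simp add: mix_def)
  have mix: "mix a k = ?us @ ?t # ?vs"
    using Suc.prems by (simp add: mix_def upt_conv_Cons)
  let ?row = "\<lambda>t. emb (row 1 (- 1) t ?us) * inv_row q (- 1 / q) t ?us"
  have rat: "Rat q (wrev (Suc k)) = ?row ?w * Rat q (wrev k)"
  proof -
    have "wrev (Suc k) = ?w # wrev k" by simp
    moreover have "prod_list (map f (rev vs)) = prod_list (map f vs)" for f :: "var \<Rightarrow> complex cseries" and vs
      by (induction vs) (simp_all add: mult.commute)
    ultimately show ?thesis
      by (simp only: Rat_def pairprod.simps emb_prod_list map_map comp_def rev_map[symmetric]) (simp add: ac_simps comp_def)
  qed
  let ?Z = "prod_list (map (Zfac q) [1..<k + 1])"
  \<comment> \<open>Of the integrand only the kernel factor, the last row and the symmetric factor contain the variable of integration.\<close>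
  have frZ: "free ?w ?Z"
    by (intro free_prod_list)
      (auto simp: Zfac_def lookup_ratio' lookup_single intro!: free_mult free_prod_list free_emb_add free_single free_geomc)
  have frR: "free ?w (Rat q (wrev k))"
    unfolding Rat_def
  proof (intro free_mult free_pairprod)
    fix u v assume uv: "u \<in> set (wrev k)" "v \<in> set (wrev k)" "u \<noteq> v"
    then show "free ?w (emb (lf 1 u (- 1) v))" "free ?w (lf_inv q u (- 1 / q) v)"
      by (auto intro!: free_emb_lf free_lf_inv)
  qed (simp_all add: distinct_map inj_on_def)
  have frz: "free ?w (Zrest q (Suc k))"
    unfolding Zrest_def
    by (intro free_prod_list)
      (auto simp: lookup_ratio' lookup_single intro!: free_mult free_emb_add free_single free_geomc)
  have d: "distinct (?us @ ?w # ?vs)" "?t \<notin> set (?us @ ?vs)"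
    by (auto simp: distinct_map inj_on_def)
  have "oi ?w (sc (prod_list (map (Zfac q) [1..<Suc k + 1]) * Rat q (wrev (Suc k))) * Sc q (mix a (Suc k)))
    = oi ?w (sc (?Z * Rat q (wrev k) * Zrest q (Suc k)) * (sc (Kf (Suc k)) * (sc (?row ?w) * Sc q (?us @ ?w # ?vs))))"
    unfolding mixS rat mult.assoc[symmetric] sc_mult[symmetric]
    by (rule arg_cong[of _ _ "\<lambda>c. oi ?w (sc c * Sc q (?us @ ?w # ?vs))"]) (simp add: Zfac_eq ac_simps)
  also have "\<dots> = sc (?Z * Rat q (wrev k) * Zrest q (Suc k)) * L (Suc k) (sc (?row ?w) * Sc q (?us @ ?w # ?vs))"
    unfolding L_def by (rule oi_free_mult) (intro free_mult frZ frR frz)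
  also have "\<dots> = sc (?Z * Rat q (wrev k) * Zrest q (Suc k)) * (sc (?row ?t) * Sc q (?us @ ?t # ?vs))"
    using L_row[OF assms(1) d] by simp
  also have "\<dots> = sc (?Z * Rat q (wrev k) * (Zrest q (Suc k) * ?row ?t)) * Sc q (mix a k)"
    unfolding mix mult.assoc[symmetric] sc_mult[symmetric] ..
  also have "Zrest q (Suc k) * ?row ?t = 1" using Zrest_cancel[OF assms(1), of "Suc k"] by simp
  finally have "oi ?w (sc (prod_list (map (Zfac q) [1..<Suc k + 1]) * Rat q (wrev (Suc k))) * Sc q (mix a (Suc k)))
    = sc (?Z * Rat q (wrev k)) * Sc q (mix a k)" by simp
  then show ?case using Suc by simp
qed

section \<open>The integral formula\<close>

lemma chain_wrev: "chain (wrev a)"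
  by (simp add: sorted_wrt_rev sorted_wrt_map del: upt_Suc)

lemma chain_tvars: "chain (tvars a)"
  by (simp add: sorted_wrt_map del: upt_Suc)

lemma Phic_tvars_integral:
  assumes "q \<noteq> 0"
  shows "Phic q (tvars a) = sc (Rat q (tvars a)) *
    foldr oi (map W [1..<a + 1]) (sc (prod_list (map (Zfac q) [1..<a + 1])) * Phic q (wrev a))"
proof -
  have "Sf q ([] @ wrev a) = Sf q ([] @ map W [1..<a + 1])"
    by (rule Sf_permute) (use assms in \<open>auto simp: distinct_map inj_on_def\<close>)
  then have "Sc q (mix a a) = Sc q (wrev a)"
    by (simp add: mix_def Sc_def)
  then have "foldr oi (map W [1..<a + 1]) (sc (prod_list (map (Zfac q) [1..<a + 1])) * Phic q (wrev a)) = Sc q (tvars a)"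
    using integrate_all[OF assms order_refl, of a]
    by (simp only: Phic_eq_Sc[OF chain_wrev assms] sc_mult mult.assoc)
  then show ?thesis by (simp only: Phic_eq_Sc[OF chain_tvars assms])
qed

lemma cf_foldr_oi: "cf (foldr oi ws A) N = (if \<forall>w\<in>set ws. lookup N w = 0 then cf A N else 0)"
  by (induction ws) (auto simp: cf_oi)

lemma foldr_oint: "foldr oint ws A N = (if \<forall>w\<in>set ws. lookup N w = 0 then A N else 0)"
  by (induction ws) (auto simp: oint_def)

text \<open>The kernel contains positive powers of every \<open>w\<^sub>i\<close>, so the coefficient at \<open>w\<^sup>0\<close> sees only negative
  powers from the other factor.\<close>

lemma conv_agree:
  assumes "\<And>N. (\<forall>w\<in>S. lookup N w \<le> - 1) \<Longrightarrow> A N = B N"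
    and "\<And>w. w \<in> S \<Longrightarrow> cbound (\<lambda>N. - lookup N w) (- 1) Z"
    and "\<forall>w\<in>S. lookup N w = 0"
  shows "conv (cf (sc Z)) A N = conv (cf (sc Z)) B N"
  unfolding conv_def
proof (rule Sum_any.cong)
  fix M
  show "cf (sc Z) M * A (N - M) = cf (sc Z) M * B (N - M)"
  proof (cases "cf Z M = 0")
    case False
    then have "- lookup M w \<le> - 1" if "w \<in> S" for w
      using assms(2)[OF that] unfolding cbound_def by blast
    then have "A (N - M) = B (N - M)"
      using assms(3) by (intro assms(1)) (auto simp: lookup_minus)
    then show ?thesis by simp
  qed simp
qed

lemma cbound_prod_list_member:
  fixes As :: "'a::ring_1 cseries list"
  assumes "additive_fun f" "A \<in> set As" "cbound f (- 1) A" "\<And>B. B \<in> set As \<Longrightarrow> cbound f 0 B"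
  shows "cbound f (- 1) (prod_list As)"
  using assms(2,4)
proof (induction As)
  case (Cons B As)
  show ?case
  proof (cases "A = B")
    case True
    have "cbound f (0 * int (length As)) (prod_list As)"
      by (rule cbound_prod_list[OF assms(1)]) (use Cons.prems in auto)
    then have "cbound f (- 1 + 0) (B * prod_list As)"
      using assms(3) True by (intro cbound_mult[OF assms(1)]) auto
    then show ?thesis by simp
  next
    case False
    then have "cbound f (0 + (- 1)) (B * prod_list As)"
      using Cons by (intro cbound_mult[OF assms(1)]) auto
    then show ?thesis by simp
  qed
qed simp

lemma cbound_Zfac: "cbound (\<lambda>N. - lookup N (W i)) (if i = j then - 1 else 0) (Zfac q j)"
proof -
  let ?f = "\<lambda>N. - lookup N (W i)"
  have add: "additive_fun ?f" by simp
  have r: "?f (ratio (W l) (T j) k) = (if i = l then - k else 0)" for l k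
    by (simp add: lookup_ratio')
  have z: "cbound ?f 0 (Zrest q j)"
  proof -
    have "pbound ?f 0 (Poly_Mapping.single 0 q + Poly_Mapping.single (ratio (W l) (T j) 1) (- 1 / q))" for l
      unfolding pbound_def
    proof
      fix M assume "M \<in> keys (Poly_Mapping.single 0 q + Poly_Mapping.single (ratio (W l) (T j) 1) (- 1 / q))"
      then have "M = 0 \<or> M = ratio (W l) (T j) 1"
        using keys_add by (fastforce split: if_splits)
      then show "?f M \<le> 0" by (auto simp: lookup_ratio')
    qed
    then have "cbound ?f (0 + 0) (Zfactor q j l)" for l
      by (intro cbound_mult[OF add] cbound_emb cbound_geomc) (auto simp: r)
    then have "cbound ?f (0 * int (length (map (\<lambda>l. Zfactor q j l) [1..<j]))) (Zrest q j)"
      unfolding Zrest_def by (intro cbound_prod_list[OF add]) auto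
    then show ?thesis by simp
  qed
  have "cbound ?f ((if i = j then - 1 else 0) + 0 + 0) (Zfac q j)"
    unfolding Zfac_eq Kf_def
    by (intro cbound_mult[OF add] z cbound_single cbound_geomc) (auto simp: r)
  then show ?thesis by simp
qed

lemma cf_prod_fp: "distinct vs \<Longrightarrow> cf (prod_list (map fp vs)) = word_series (\<lambda>k. k < 0) vs"
  using sprod_list_map_cf[of fp vs] sprod_list_modes[of vs "\<lambda>k. k < 0"]
  by (simp add: cf_fp f_plus_modes[abs_def] comp_def)

definition rhs2 :: "complex \<Rightarrow> nat \<Rightarrow> falg cseries" where
  "rhs2 q a = sc (Rat q (tvars a)) *
     foldr oi (map W [1..<a + 1]) (sc (prod_list (map (Zfac q) [1..<a + 1])) * prod_list (map fp (wrev a)))"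

lemma word_series_agree:
  "(\<forall>v\<in>set vs. lookup N v \<le> - 1) \<Longrightarrow> word_series (\<lambda>k. k < 0) vs N = cur vs N"
  by (force simp: word_series_def)

lemma Z_bound:
  assumes "w \<in> set (map W [1..<a + 1])"
  shows "cbound (\<lambda>N. - lookup N w) (- 1) (prod_list (map (Zfac q) [1..<a + 1]))"
proof -
  obtain i where i: "w = W i" "i \<in> set [1..<a + 1]" using assms by auto
  have "cbound (\<lambda>N. - lookup N (W i)) (- 1) (Zfac q i)" using cbound_Zfac[of i i q] by simp
  moreover have "cbound (\<lambda>N. - lookup N (W i)) 0 (Zfac q j)" for j
    using cbound_Zfac[of i j q] by (rule cbound_mono) simp
  ultimately show ?thesis
    unfolding i using i(2) by (intro cbound_prod_list_member[where A = "Zfac q i"]) auto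
qed

text \<open>Only the positive parts of the currents contribute to the integral. The product of these parts is cone-supported,
  unlike the product of the full currents.\<close>

lemma weight_rhs2_cf: "weight_rhs2 q a = cf (rhs2 q a)"
proof -
  let ?Z = "prod_list (map (Zfac q) [1..<a + 1])"
  have cur: "sprod_list [f_current (W i). i \<leftarrow> rev [1..<a + 1]] = cur (wrev a)"
    using sprod_list_modes[of "wrev a" "\<lambda>_. True"]
    by (simp add: f_current_modes distinct_map comp_def inj_on_def rev_map[symmetric] del: upt_Suc)
  have dist: "distinct (wrev a)" by (auto simp: distinct_map inj_on_def)
  have "foldr oint (map W [1..<a + 1]) (cf (sc ?Z) \<star> cur (wrev a))
    = cf (foldr oi (map W [1..<a + 1]) (sc ?Z * prod_list (map fp (wrev a))))"
  proof
    fix N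
    have "conv (cf (sc ?Z)) (cur (wrev a)) N = conv (cf (sc ?Z)) (word_series (\<lambda>k. k < 0) (wrev a)) N"
      if "\<forall>w\<in>set (map W [1..<a + 1]). lookup N w = 0"
    proof (rule conv_agree[OF _ _ that])
      fix N :: "var \<Rightarrow>\<^sub>0 int" assume "\<forall>w\<in>set (map W [1..<a + 1]). lookup N w \<le> - 1"
      then have "\<forall>w\<in>set (wrev a). lookup N w \<le> - 1" by simp
      then show "cur (wrev a) N = word_series (\<lambda>k. k < 0) (wrev a) N"
        by (rule word_series_agree[symmetric])
    qed (rule Z_bound)
    then show "foldr oint (map W [1..<a + 1]) (cf (sc ?Z) \<star> cur (wrev a)) N
      = cf (foldr oi (map W [1..<a + 1]) (sc ?Z * prod_list (map fp (wrev a)))) N"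
      unfolding foldr_oint cf_foldr_oi cf_mult cf_prod_fp[OF dist] sprod_def conv_def by auto
  qed
  then show ?thesis
    unfolding weight_rhs2_def pairs_cf Zkernel_cf cur rhs2_def Rat_def
    by (simp only: sprod_cf)
qed

lemma nfs_foldr_oi: "nfs q (foldr oi ws A) = foldr oi ws (nfs q A)"
  by (rule cseries_eqI) (simp add: cf_nfs cf_foldr_oi)

text \<open>Modulo \<open>J\<close> the positive parts can be exchanged for the full currents again, as long as they are
  integrated against the kernel.\<close>

lemma nfs_rhs2:
  assumes "q \<noteq> 0"
  shows "nfs q (rhs2 q a) = Phic q (tvars a)"
proof -
  let ?Z = "prod_list (map (Zfac q) [1..<a + 1])" and ?ws = "map W [1..<a + 1]"
  have dist: "distinct (wrev a)" by (auto simp: distinct_map inj_on_def)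
  have "foldr oi ?ws (sc ?Z * nfs q (prod_list (map fp (wrev a)))) = foldr oi ?ws (sc ?Z * Phic q (wrev a))"
  proof (rule cseries_eqI)
    fix N
    have "conv (cf (sc ?Z)) (cf (nfs q (prod_list (map fp (wrev a))))) N = conv (cf (sc ?Z)) (cf (Phic q (wrev a))) N"
      if "\<forall>w\<in>set ?ws. lookup N w = 0"
    proof (rule conv_agree[OF _ _ that])
      fix N :: "var \<Rightarrow>\<^sub>0 int" assume "\<forall>w\<in>set ?ws. lookup N w \<le> - 1"
      then have "\<forall>w\<in>set (wrev a). lookup N w \<le> - 1" by simp
      then show "cf (nfs q (prod_list (map fp (wrev a)))) N = cf (Phic q (wrev a)) N"
        unfolding cf_nfs cf_prod_fp[OF dist] cf_Phic[OF chain_wrev assms] Phi_def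
        by (simp only: word_series_agree)
    qed (rule Z_bound)
    then show "cf (foldr oi ?ws (sc ?Z * nfs q (prod_list (map fp (wrev a))))) N
      = cf (foldr oi ?ws (sc ?Z * Phic q (wrev a))) N"
      unfolding cf_foldr_oi cf_mult by auto
  qed
  then show ?thesis
    unfolding rhs2_def nfs_sc_mult nfs_foldr_oi Phic_tvars_integral[OF assms] by simp
qed

lemma pos_foldr_oi: "pos A \<Longrightarrow> pos (foldr oi ws A)"
  using fwords_pos_scal[of 0] by (simp add: pos_def cf_foldr_oi)

lemma pos_rhs2: "pos (rhs2 q a)"
  unfolding rhs2_def
  by (intro pos_mult pos_sc pos_foldr_oi pos_prod_list) (auto intro: pos_fp)

lemma projection_current_product:
  assumes "q \<noteq> 0" "is_projection q P" "pos R" "nfs q R = Phic q (tvars a)"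
  shows "P (cls q (current_product a N)) = cls q (cf R N)"
proof (rule projection_eq[OF assms(2,1)])
  show "cf R N \<in> fwords_pos" using assms(3) by (simp add: pos_def)
  have "nf q (cf R N) = cf (nfs q R) N" by (simp add: cf_nfs)
  then show "nf q (current_product a N) = nf q (cf R N)"
    unfolding assms(4) current_product_eq cf_Phic[OF chain_tvars assms(1)] Phi_def by (simp only:)
qed

section \<open>The product formula\<close>

text \<open>The substitution \<open>a := b\<close>, kept as a function that is constant along the lines in direction \<open>a/b\<close>.\<close>

definition diag_sum :: "var \<Rightarrow> var \<Rightarrow> series \<Rightarrow> series" where
  "diag_sum a b A = (\<lambda>N. Sum_any (\<lambda>k::int. A (N + ratio a b k)))"

lemma diag_zero_iff_diag_sum: "diag_zero a b A \<longleftrightarrow> diag_sum a b A = (\<lambda>N. 0)"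
  by (simp add: diag_zero_def diag_sum_def fun_eq_iff)

lemma Sum_any_sum:
  assumes "finite I" "\<And>i. i \<in> I \<Longrightarrow> finite {k. f i k \<noteq> 0}"
  shows "Sum_any (\<lambda>k. \<Sum>i\<in>I. f i k) = (\<Sum>i\<in>I. Sum_any (f i))"
  using assms
proof (induction I rule: finite_induct)
  case (insert i I)
  have "finite {k. (\<Sum>i\<in>I. f i k) \<noteq> 0}"
  proof (rule finite_subset)
    show "{k. (\<Sum>i\<in>I. f i k) \<noteq> 0} \<subseteq> (\<Union>i\<in>I. {k. f i k \<noteq> 0})"
      by (auto dest: sum.not_neutral_contains_not_neutral)
  qed (use insert in auto)
  then have "Sum_any (\<lambda>k. f i k + (\<Sum>i\<in>I. f i k)) = Sum_any (f i) + Sum_any (\<lambda>k. \<Sum>i\<in>I. f i k)"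
    using insert.prems by (intro Sum_any.distrib) auto
  then show ?case using insert by simp
qed simp

lemma finite_line_shift:
  assumes "bdd V n A" "a \<in> V" "b \<in> V" "a \<noteq> b"
  shows "finite {k. A (N + ratio a b k - M) \<noteq> 0}"
  using finite_line[OF assms, of "N - M"] by (simp add: algebra_simps)

lemma diag_sum_act:
  assumes "bdd V n A" "a \<in> V" "b \<in> V" "a \<noteq> b"
  shows "diag_sum a b (act p A) = act p (diag_sum a b A)"
proof
  fix N
  have fin: "finite {k. scal c * A (N + ratio a b k - M) \<noteq> 0}" for c M
    by (rule finite_subset[OF _ finite_line_shift[OF assms, of N M]]) auto
  have "diag_sum a b (act p A) N = Sum_any (\<lambda>k. \<Sum>M\<in>keys p. scal (lookup p M) * A (N + ratio a b k - M))"
    by (simp add: diag_sum_def act_eq_sum[of "keys p"])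
  also have "\<dots> = (\<Sum>M\<in>keys p. Sum_any (\<lambda>k. scal (lookup p M) * A (N + ratio a b k - M)))"
    by (rule Sum_any_sum) (use fin in auto)
  also have "\<dots> = (\<Sum>M\<in>keys p. scal (lookup p M) * Sum_any (\<lambda>k. A (N + ratio a b k - M)))"
    by (simp add: Sum_any_right_distrib finite_line_shift[OF assms])
  also have "\<dots> = act p (diag_sum a b A) N"
    by (simp add: act_eq_sum[of "keys p"] diag_sum_def algebra_simps)
  finally show "diag_sum a b (act p A) N = act p (diag_sum a b A) N" .
qed

lemma diag_sum_add:
  assumes "bdd V n A" "bdd V m B" "a \<in> V" "b \<in> V" "a \<noteq> b"
  shows "diag_sum a b (\<lambda>N. A N + B N) N = diag_sum a b A N + diag_sum a b B N"
  unfolding diag_sum_def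
  by (rule Sum_any.distrib) (use finite_line[OF assms(1,3-5)] finite_line[OF assms(2,3-5)] in auto)

lemma diag_sum_uminus: "diag_sum a b (\<lambda>N. - A N) N = - diag_sum a b A N"
  by (simp add: diag_sum_def Sum_any_uminus)

lemma bdd_uminus: "bdd V n A \<Longrightarrow> bdd V n (\<lambda>N. - A N)"
  by (simp add: bdd_def svars_def sbound_def)

lemma diag_sum_diff:
  assumes "bdd V n A" "bdd V m B" "a \<in> V" "b \<in> V" "a \<noteq> b"
  shows "diag_sum a b (\<lambda>N. A N - B N) N = diag_sum a b A N - diag_sum a b B N"
  using diag_sum_add[OF assms(1) bdd_uminus[OF assms(2)] assms(3-5)] by (simp add: diag_sum_uminus)

lemma diag_sum_sum:
  assumes "finite I" "\<And>i. i \<in> I \<Longrightarrow> \<exists>n. bdd V n (A i)" "a \<in> V" "b \<in> V" "a \<noteq> b"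
  shows "diag_sum a b (\<lambda>N. \<Sum>i\<in>I. A i N) N = (\<Sum>i\<in>I. diag_sum a b (A i) N)"
  unfolding diag_sum_def
  by (rule Sum_any_sum[OF assms(1)]) (use assms(2) finite_line[OF _ assms(3-5)] in blast)

lemma diag_sum_shift: "diag_sum a b A (N - expo a 1) = diag_sum a b A (N - expo b 1)"
proof -
  have "bij (\<lambda>k::int. k + 1)" by (rule bij_betw_byWitness[where f' = "\<lambda>k. k - 1"]) auto
  moreover have eq: "N - expo b 1 + ratio a b k = N - expo a 1 + ratio a b (k + 1)" for k
    by (simp add: ratio_add) (simp add: ratio_def)
  have "(\<lambda>k. A (N - expo a 1 + ratio a b k)) \<circ> (\<lambda>k. k + 1) = (\<lambda>k. A (N - expo b 1 + ratio a b k))"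
    unfolding comp_def by (rule ext) (simp only: eq)
  ultimately show ?thesis
    unfolding diag_sum_def by (rule Sum_any.reindex_cong)
qed

text \<open>After the substitution \<open>a := b\<close> the variables \<open>a\<close> and \<open>b\<close> act in the same way.\<close>

lemma act_lf_diag_sum: "act (lf x a y v) (diag_sum a b A) = act (lf x b y v) (diag_sum a b A)"
  by (rule ext) (simp only: act_lf diag_sum_shift[of a b A])

lemma act_prod_diag_sum:
  "act (row x y a us) (diag_sum a b A) = act (row x y b us) (diag_sum a b A)"
proof (induction us)
  case (Cons u us)
  have "act (row x y a (u # us)) (diag_sum a b A)
    = act (lf x a y u) (act (row x y b us) (diag_sum a b A))"
    using Cons by (simp add: act_mult)
  also have "\<dots> = act (row x y b us) (act (lf x b y u) (diag_sum a b A))"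
    by (subst act_commute) (simp only: act_lf_diag_sum[of x a y u b A])
  also have "\<dots> = act (row x y b (u # us)) (diag_sum a b A)"
    by (simp add: act_mult[symmetric] mult.commute)
  finally show ?case .
qed simp

lemma bdd_act_ex:
  assumes "pvars V p" "bdd V n A"
  shows "\<exists>m. bdd V m (act p A)"
proof -
  have "pbound (\<lambda>M. lookup M w) (Max (insert 0 ((\<lambda>M. lookup M w) ` keys p))) p" for w
    unfolding pbound_def by auto
  from bdd_act[OF assms(2) this assms(1)] show ?thesis by blast
qed

lemma bdd_sum:
  assumes "finite I" "\<And>i. i \<in> I \<Longrightarrow> \<exists>n. bdd V n (A i)"
  shows "\<exists>n. bdd V n (\<lambda>N. \<Sum>i\<in>I. A i N)"
  using assms
proof (induction I rule: finite_induct)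
  case empty
  show ?case by (auto simp: bdd_def svars_def sbound_def)
next
  case (insert i I)
  then obtain n m where n: "bdd V n (A i)" and m: "bdd V m (\<lambda>N. \<Sum>i\<in>I. A i N)" by blast
  have "bdd V (\<lambda>w. max (n w) (m w)) (\<lambda>N. A i N - - (\<Sum>i\<in>I. A i N))"
    by (rule bdd_diff[OF n bdd_uminus[OF m]])
  then show ?case using insert by auto
qed

lemma sbound_diff: "sbound f n A \<Longrightarrow> sbound f n B \<Longrightarrow> sbound f n (\<lambda>N. A N - B N)"
  unfolding sbound_def by (metis diff_0_right diff_self)

lemma sbound_add: "sbound f n A \<Longrightarrow> sbound f n B \<Longrightarrow> sbound f n (\<lambda>N. A N + B N)"
  unfolding sbound_def by (metis add_0)

lemma sbound_sum: "(\<And>i. i \<in> I \<Longrightarrow> sbound f n (A i)) \<Longrightarrow> sbound f n (\<lambda>N. \<Sum>i\<in>I. A i N)"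
  unfolding sbound_def by (meson sum.not_neutral_contains_not_neutral)

subsection \<open>Multiplication by one more current\<close>

text \<open>The cleared product of the currents \<open>us\<close>, times the positive part of one more current, reduced modulo \<open>J\<close>.\<close>

definition Hc :: "complex \<Rightarrow> var list \<Rightarrow> var \<Rightarrow> falg cseries" where
  "Hc q us x = nfs q (Gamc q us * fp x)"

definition hterm :: "complex \<Rightarrow> var list \<Rightarrow> int \<Rightarrow> (var \<Rightarrow>\<^sub>0 int) \<Rightarrow> falg" where
  "hterm q us k M = (if k < 0 then nf q (Gam q us M * gen (F (- k))) else 0)"

lemma Sum_any_inj_reindex:
  assumes "inj h" "\<And>M. M \<notin> range h \<Longrightarrow> g M = 0"
  shows "Sum_any g = Sum_any (\<lambda>k. g (h k))"
proof -
  have "M \<in> h ` {k. g (h k) \<noteq> 0}" if "g M \<noteq> 0" for M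
  proof -
    have "M \<in> range h" using that assms(2)[of M] by (cases "M \<in> range h") simp_all
    then obtain k where "M = h k" by (rule rangeE)
    then show ?thesis using that by blast
  qed
  then have "{M. g M \<noteq> 0} = h ` {k. g (h k) \<noteq> 0}" by blast
  then show ?thesis
    unfolding Sum_any.expand_set using sum.reindex[of h "{k. g (h k) \<noteq> 0}" g] assms(1)
    by (simp add: inj_on_subset comp_def)
qed

lemma cf_Hc:
  assumes "distinct us" "q \<noteq> 0"
  shows "cf (Hc q us x) N = Sum_any (\<lambda>k. hterm q us k (N - expo x k))"
proof -
  have fin: "finite {M. cf (Gamc q us) M * cf (fp x) (N - M) \<noteq> 0}"
    by (rule finite_conv_terms[OF cone_supported_cf cone_supported_cf])
  have "cf (Hc q us x) N = Sum_any (\<lambda>M. nf q (cf (Gamc q us) M * cf (fp x) (N - M)))"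
    unfolding Hc_def cf_nfs cf_mult conv_def using fin by (rule nf_Sum_any)
  also have "\<dots> = Sum_any (\<lambda>M. nf q (Gam q us M * f_plus x (N - M)))"
    by (simp add: cf_Gamc[OF assms] cf_fp)
  also have "\<dots> = Sum_any (\<lambda>k. nf q (Gam q us (N - expo x k) * f_plus x (N - (N - expo x k))))"
  proof (rule Sum_any_inj_reindex)
    show "inj (\<lambda>k. N - expo x k)"
    proof (rule injI)
      fix j k :: int assume "N - expo x j = N - expo x k"
      then have "lookup (expo x j) x = lookup (expo x k) x" by simp
      then show "j = k" by simp
    qed
    fix M assume M: "M \<notin> range (\<lambda>k. N - expo x k)"
    have "N - M \<noteq> expo x k" for k
    proof
      assume "N - M = expo x k"
      then have "M = N - expo x k" by (simp add: algebra_simps)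
      with M show False by blast
    qed
    then have "f_plus x (N - M) = 0" by (simp add: f_plus_def)
    then show "nf q (Gam q us M * f_plus x (N - M)) = 0" by simp
  qed
  also have "\<dots> = Sum_any (\<lambda>k. hterm q us k (N - expo x k))"
    by (rule Sum_any.cong) (simp add: f_plus_def hterm_def)
  finally show ?thesis .
qed

lemma hterm_zero:
  assumes "hterm q us k M \<noteq> 0"
  shows "k < 0" "Gam q us M \<noteq> 0"
  using assms by (auto simp: hterm_def split: if_splits)

lemma bdd_Hc:
  assumes "distinct us" "q \<noteq> 0" "set us \<subseteq> V" "x \<in> V"
  shows "bdd V (\<lambda>w. max 0 (int (length us) - 2)) (cf (Hc q us x))"
  unfolding bdd_def svars_def sbound_def
proof (intro conjI allI impI ballI)
  fix N assume "cf (Hc q us x) N \<noteq> 0"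
  then obtain k where "hterm q us k (N - expo x k) \<noteq> 0"
    unfolding cf_Hc[OF assms(1,2)] by (rule Sum_any.not_neutral_obtains_not_neutral)
  then have k: "k < 0" "Gam q us (N - expo x k) \<noteq> 0" by (rule hterm_zero)+
  have keys: "keys (N - expo x k) \<subseteq> set us"
    using bddD(1)[OF bdd_Gam[OF assms(1,2)] k(2)] .
  then have 0: "lookup N v = 0" if "v \<notin> V" for v
  proof -
    have "v \<noteq> x" "v \<notin> set us" using that assms(3,4) by auto
    then have "lookup (N - expo x k) v = 0" using keys by (auto simp: keys_subset_iff)
    then show ?thesis using \<open>v \<noteq> x\<close> by (simp add: lookup_minus lookup_single)
  qed
  then show "keys N \<subseteq> V" by (auto simp: keys_subset_iff)
  fix w assume "w \<in> V"
  have "lookup (N - expo x k) w \<le> max 0 (int (length us) - 2)"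
  proof (cases "w \<in> set us")
    case True
    from bddD(2)[OF bdd_Gam[OF assms(1,2)] k(2) this] show ?thesis by simp
  next
    case False
    then have "lookup (N - expo x k) w = 0" using keys by (auto simp: keys_subset_iff)
    then show ?thesis by simp
  qed
  then show "lookup N w \<le> max 0 (int (length us) - 2)"
    using k(1) by (simp add: lookup_minus lookup_single when_def split: if_splits)
qed

lemma Hc_exponent:
  assumes "distinct us" "q \<noteq> 0" "t \<notin> set us" "cf (Hc q us x) N \<noteq> 0"
  shows "x = t \<Longrightarrow> lookup N t < 0" "x \<noteq> t \<Longrightarrow> lookup N t = 0"
proof -
  from assms(4) obtain k where "hterm q us k (N - expo x k) \<noteq> 0"
    unfolding cf_Hc[OF assms(1,2)] by (rule Sum_any.not_neutral_obtains_not_neutral)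
  then have k: "k < 0" "Gam q us (N - expo x k) \<noteq> 0" by (rule hterm_zero)+
  have "lookup (N - expo x k) t = 0"
    using bddD(1)[OF bdd_Gam[OF assms(1,2)] k(2)] assms(3) by (auto simp: keys_subset_iff)
  then show "x = t \<Longrightarrow> lookup N t < 0" "x \<noteq> t \<Longrightarrow> lookup N t = 0"
    using k(1) by (auto simp: lookup_minus lookup_single)
qed

lemma cf_Hc_fresh:
  assumes "distinct us" "q \<noteq> 0" "t \<notin> set us"
  shows "cf (Hc q us t) N = hterm q us (lookup N t) (N - expo t (lookup N t))"
proof -
  have eq: "hterm q us k (N - expo t k) = (if k = lookup N t then hterm q us (lookup N t) (N - expo t (lookup N t)) else 0)" for k
  proof (cases "k = lookup N t")
    case False
    have "hterm q us k (N - expo t k) = 0"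
    proof (rule ccontr)
      assume "hterm q us k (N - expo t k) \<noteq> 0"
      then have "Gam q us (N - expo t k) \<noteq> 0" by (rule hterm_zero)
      then have "lookup (N - expo t k) t = 0"
        using bddD(1)[OF bdd_Gam[OF assms(1,2)]] assms(3) by (auto simp: keys_subset_iff)
      with False show False by (simp add: lookup_minus)
    qed
    with False show ?thesis by simp
  qed simp
  then show ?thesis
    unfolding cf_Hc[OF assms(1,2)] by (subst Sum_any.cong[OF eq]) (rule Sum_any.delta)
qed

text \<open>Substituting \<open>t := u\<close> turns \<open>f\<^sup>+(t)\<close> into \<open>f\<^sup>+(u)\<close>.\<close>

lemma diag_sum_Hc:
  assumes "distinct us" "q \<noteq> 0" "t \<notin> set us" "u \<in> set us"
  shows "diag_sum t u (cf (Hc q us t)) = diag_sum t u (cf (Hc q us u))"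
proof
  fix N
  have tu: "t \<noteq> u" using assms by auto
  let ?N = "N + ratio t u (- lookup N t)"
  have "diag_sum t u (cf (Hc q us u)) N = Sum_any (\<lambda>k. if k = - lookup N t then cf (Hc q us u) ?N else 0)"
    unfolding diag_sum_def
  proof (rule Sum_any.cong)
    fix k
    show "cf (Hc q us u) (N + ratio t u k) = (if k = - lookup N t then cf (Hc q us u) ?N else 0)"
    proof (cases "k = - lookup N t")
      case False
      then have "lookup (N + ratio t u k) t \<noteq> 0" using tu by (simp add: lookup_add lookup_ratio')
      then have "cf (Hc q us u) (N + ratio t u k) = 0"
        using Hc_exponent(2)[OF assms(1-3), of u "N + ratio t u k"] tu by blast
      then show ?thesis using False by simp
    qed simp
  qed
  then have "diag_sum t u (cf (Hc q us u)) N = Sum_any (\<lambda>k. hterm q us k (?N - expo u k))"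
    by (simp add: cf_Hc[OF assms(1,2)])
  also have "\<dots> = Sum_any (\<lambda>j. hterm q us (lookup N t + j) (?N - expo u (lookup N t + j)))"
    by (rule Sum_any.reindex_cong[of "\<lambda>j. lookup N t + j"])
      (auto intro: bij_betw_byWitness[where f' = "\<lambda>k. k - lookup N t"])
  also have "\<dots> = diag_sum t u (cf (Hc q us t)) N"
    unfolding diag_sum_def
  proof (rule Sum_any.cong)
    fix j
    have l: "lookup (N + ratio t u j) t = lookup N t + j" using tu by (simp add: lookup_add lookup_ratio')
    have eq: "N + ratio t u j - expo t (lookup N t + j) = ?N - expo u (lookup N t + j)"
      using tu by (intro poly_mapping_eqI) (auto simp: lookup_add lookup_minus lookup_ratio' lookup_single when_def)
    show "hterm q us (lookup N t + j) (?N - expo u (lookup N t + j)) = cf (Hc q us t) (N + ratio t u j)"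
      unfolding cf_Hc_fresh[OF assms(1-3)] l eq ..
  qed
  finally show "diag_sum t u (cf (Hc q us t)) N = diag_sum t u (cf (Hc q us u)) N" by simp
qed

text \<open>The cleared product of the currents \<open>us\<close>, times the full current \<open>f(t)\<close>.\<close>

definition Theta :: "complex \<Rightarrow> var list \<Rightarrow> var \<Rightarrow> series" where
  "Theta q us t = act (D q us) (Phi q (us @ [t]))"

text \<open>The positive part of the current consists of the terms with negative exponents of \<open>t\<close>.\<close>

lemma Hc_eq_Theta:
  assumes "distinct us" "q \<noteq> 0" "t \<notin> set us" "lookup N t < 0"
  shows "cf (Hc q us t) N = Theta q us t N"
proof -
  let ?n = "- lookup N t" and ?N = "N - expo t (lookup N t)"
  have "cf (Hc q us t) N = nf q (Gam q us ?N * fw [?n])"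
    using assms by (simp add: cf_Hc_fresh hterm_def fw_Cons)
  also have "Gam q us ?N * fw [?n] = (\<Sum>M\<in>keys (D q us). scal (lookup (D q us) M) * (nf q (cur us (?N - M)) * fw [?n]))"
    by (simp only: Gam_def Phi_def act_eq_sum[OF finite_keys order_refl] sum_distrib_right mult.assoc)
  also have "nf q \<dots> = (\<Sum>M\<in>keys (D q us). scal (lookup (D q us) M) * nf q (cur us (?N - M) * fw [?n]))"
  proof -
    have "nf q (sum g I) = (\<Sum>M\<in>I. nf q (g M))" for g and I :: "(var \<Rightarrow>\<^sub>0 int) set"
      by (induction I rule: infinite_finite_induct) (simp_all add: nf_add)
    then show ?thesis by (simp only: nf_scal nf_nf_mult_fw)
  qed
  also have "\<dots> = (\<Sum>M\<in>keys (D q us). scal (lookup (D q us) M) * Phi q (us @ [t]) (N - M))"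
  proof (rule sum.cong[OF refl])
    fix M assume M: "M \<in> keys (D q us)"
    have "pvars (set us) (D q us)"
      unfolding D_def by (intro pvars_pairprod pvars_lf)
    then have "lookup M t = 0" using M assms(3) by (auto simp: pvars_def keys_subset_iff)
    then have l: "lookup (?N - M) v = (if v = t then 0 else lookup (N - M) v)" for v
      by (simp add: lookup_minus lookup_single when_def)
    have "keys (?N - M) \<subseteq> set us \<longleftrightarrow> keys (N - M) \<subseteq> set (us @ [t])"
      using assms(3) by (auto simp: keys_subset_iff l)
    moreover have "map (\<lambda>v. - lookup (?N - M) v) us = map (\<lambda>v. - lookup (N - M) v) us"
      using assms(3) by (auto simp: l)
    ultimately have 1: "cur us (?N - M)
      = (if keys (N - M) \<subseteq> set (us @ [t]) then fw (map (\<lambda>v. - lookup (N - M) v) us) else 0)"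
      by (simp only: cur_def)
    have "lookup (N - M) t = lookup N t" using \<open>lookup M t = 0\<close> by (simp add: lookup_minus)
    then have 2: "cur (us @ [t]) (N - M)
      = (if keys (N - M) \<subseteq> set (us @ [t]) then fw (map (\<lambda>v. - lookup (N - M) v) us) * fw [?n] else 0)"
      by (simp only: cur_def map_append list.map fw_append)
    have "cur us (?N - M) * fw [?n] = cur (us @ [t]) (N - M)"
      unfolding 1 2 by (simp only: if_distrib[of "\<lambda>x. x * fw [?n]"] mult_zero_left)
    then show "scal (lookup (D q us) M) * nf q (cur us (?N - M) * fw [?n])
      = scal (lookup (D q us) M) * Phi q (us @ [t]) (N - M)"
      by (simp add: Phi_def)
  qed
  also have "\<dots> = Theta q us t N"
    by (simp only: Theta_def act_eq_sum[OF finite_keys order_refl])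
  finally show ?thesis .
qed

lemma Gam_Cons_Theta:
  assumes "distinct (t # us)" "q \<noteq> 0"
  shows "Gam q (t # us) = act (row (1 / q) (- q) t us) (Theta q us t)"
proof -
  have "Gam q (t # us) = act (D q us) (act (row q (- 1 / q) t us) (Phi q (t # us)))"
    unfolding Gam_def by (simp add: D_def act_mult[symmetric] mult.commute)
  also have "act (row q (- 1 / q) t us) (Phi q (t # us)) = act (row (1 / q) (- q) t us) (Phi q (us @ [t]))"
    using Phi_cycle[of "[]" t us q] assms by simp
  finally show ?thesis
    unfolding Theta_def by (simp only: act_commute[of "D q us"])
qed

subsection \<open>Interpolation\<close>

lemma prod_list_remove:
  fixes f :: "'a \<Rightarrow> 'b::comm_monoid_mult"
  assumes "distinct xs" "m \<in> set xs"
  shows "prod_list (map f xs) = f m * prod_list (map f (filter (\<lambda>i. i \<noteq> m) xs))"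
  using assms
proof (induction xs)
  case (Cons x xs)
  show ?case
  proof (cases "x = m")
    case True
    then have "filter (\<lambda>i. i \<noteq> m) xs = xs" using Cons.prems by (auto simp: filter_id_conv)
    then show ?thesis using True by simp
  next
    case False
    then show ?thesis using Cons by (simp add: ac_simps)
  qed
qed simp

text \<open>Up to sign, \<open>E\<close> can be taken to be the Vandermonde product of the other variables.\<close>

lemma Vdm_factor:
  assumes "distinct us" "m \<in> set us"
  shows "\<exists>E. Vdm us = E * row 1 (- 1) m (filter (\<lambda>i. i \<noteq> m) us) \<and> pvars (set us) E"
  using assms
proof (induction us)
  case (Cons u us)
  show ?case
  proof (cases "u = m")
    case True
    then have "filter (\<lambda>i. i \<noteq> m) (u # us) = us" using Cons.prems by (auto simp: filter_id_conv)
    moreover have "pvars (set (u # us)) (Vdm us)"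
      unfolding Vdm_def by (intro pvars_pairprod pvars_lf) auto
    ultimately show ?thesis
      using True by (intro exI[of _ "Vdm us"]) (simp add: Vdm_def mult.commute)
  next
    case False
    then have m: "m \<in> set us" "distinct us" using Cons.prems by auto
    then obtain E where E: "Vdm us = E * row 1 (- 1) m (filter (\<lambda>i. i \<noteq> m) us)" "pvars (set us) E"
      using Cons.IH by blast
    let ?R = "row 1 (- 1) u (filter (\<lambda>i. i \<noteq> m) us)"
    have "Vdm (u # us) = lf 1 u (- 1) m * ?R * Vdm us"
      unfolding Vdm_def pairprod.simps using prod_list_remove[OF m(2,1), of "lf 1 u (- 1)"] by simp
    also have "lf 1 u (- 1) m = - lf 1 m (- 1) u"
      using lf_swap[of 1 u "- 1" m] lf_neg[of 1 m "- 1" u] by simp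
    finally have "Vdm (u # us) = (- E * ?R) * row 1 (- 1) m (filter (\<lambda>i. i \<noteq> m) (u # us))"
      using E(1) False by (simp add: ac_simps)
    moreover have "pvars (set (u # us)) (- E * ?R)"
    proof (intro pvars_mult pvars_prod_list)
      show "pvars (set (u # us)) (- E)" using E(2) by (auto simp: pvars_def)
    qed (auto intro: pvars_lf)
    ultimately show ?thesis by blast
  qed
qed simp

text \<open>The numerator of the Lagrange interpolation polynomial at the node \<open>m\<close>, cleared of the Vandermonde product of the nodes
  and multiplied by \<open>\<Prod>(q\<^sup>-\<^sup>1 t\<^sub>m - q t\<^sub>i)\<close>.\<close>

definition interp_num :: "complex \<Rightarrow> var \<Rightarrow> var list \<Rightarrow> var \<Rightarrow> lpoly" where
  "interp_num q t us m = (SOME E. Vdm us = E * row 1 (- 1) m (filter (\<lambda>i. i \<noteq> m) us) \<and> pvars (set us) E)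
      * row 1 (- 1) t (filter (\<lambda>i. i \<noteq> m) us) * row (1 / q) (- q) m us"

lemma interp_numE:
  assumes "distinct us" "m \<in> set us"
  obtains E where "Vdm us = E * row 1 (- 1) m (filter (\<lambda>i. i \<noteq> m) us)" "pvars (set us) E"
    "interp_num q t us m = E * row 1 (- 1) t (filter (\<lambda>i. i \<noteq> m) us) * row (1 / q) (- q) m us"
  using someI_ex[OF Vdm_factor[OF assms]] that unfolding interp_num_def by blast

text \<open>The difference of the two sides of the interpolation identity, with denominators cleared.\<close>

definition Psi :: "complex \<Rightarrow> var \<Rightarrow> var list \<Rightarrow> series" where
  "Psi q t us = (\<lambda>N. act (Vdm us) (Gam q (t # us)) N - act (Vdm us * row (1 / q) (- q) t us) (cf (Hc q us t)) N
     + (\<Sum>m\<in>set us. act (interp_num q t us m) (cf (Hc q us m)) N))"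

context
  fixes q :: complex and t :: var and us :: "var list"
  assumes dist: "distinct (t # us)" and q: "q \<noteq> 0"
begin

lemma dist': "distinct us" "t \<notin> set us"
  using dist by auto

lemma pvars_Vdm: "pvars (set (t # us)) (Vdm us)"
  unfolding Vdm_def by (intro pvars_pairprod pvars_lf) auto

lemma pvars_row: "v \<in> set (t # us) \<Longrightarrow> set ws \<subseteq> set us \<Longrightarrow> pvars (set (t # us)) (row x y v ws)"
  by (intro pvars_prod_list) (auto intro!: pvars_lf)

lemma pvars_interp_num: "m \<in> set us \<Longrightarrow> pvars (set (t # us)) (interp_num q t us m)"
proof -
  assume m: "m \<in> set us"
  obtain E where E: "pvars (set us) E" "interp_num q t us m = E * row 1 (- 1) t (filter (\<lambda>i. i \<noteq> m) us) * row (1 / q) (- q) m us"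
    using interp_numE[OF dist'(1) m, of q t] by blast
  have "pvars (set (t # us)) E" using E(1) by (auto simp: pvars_def)
  then show ?thesis unfolding E(2) using m by (intro pvars_mult pvars_row) auto
qed

lemma bdd_H: "x \<in> set (t # us) \<Longrightarrow> bdd (set (t # us)) (\<lambda>w. max 0 (int (length us) - 2)) (cf (Hc q us x))"
  by (rule bdd_Hc[OF dist'(1) q]) auto

lemma bdd_parts:
  "\<exists>n. bdd (set (t # us)) n (act (Vdm us) (Gam q (t # us)))"
  "\<exists>n. bdd (set (t # us)) n (act (Vdm us * row (1 / q) (- q) t us) (cf (Hc q us t)))"
  "m \<in> set us \<Longrightarrow> \<exists>n. bdd (set (t # us)) n (act (interp_num q t us m) (cf (Hc q us m)))"
  "\<exists>n. bdd (set (t # us)) n (\<lambda>N. \<Sum>m\<in>set us. act (interp_num q t us m) (cf (Hc q us m)) N)"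
proof -
  show "\<exists>n. bdd (set (t # us)) n (act (Vdm us) (Gam q (t # us)))"
    by (rule bdd_act_ex[OF pvars_Vdm bdd_Gam[OF dist q]])
  show "\<exists>n. bdd (set (t # us)) n (act (Vdm us * row (1 / q) (- q) t us) (cf (Hc q us t)))"
    by (rule bdd_act_ex[OF pvars_mult[OF pvars_Vdm pvars_row] bdd_H]) auto
  show m: "\<exists>n. bdd (set (t # us)) n (act (interp_num q t us m) (cf (Hc q us m)))" if "m \<in> set us" for m
    using that by (intro bdd_act_ex[OF pvars_interp_num bdd_H]) auto
  show "\<exists>n. bdd (set (t # us)) n (\<lambda>N. \<Sum>m\<in>set us. act (interp_num q t us m) (cf (Hc q us m)) N)"
    by (rule bdd_sum) (use m in auto)
qed

lemma bdd_Psi: "\<exists>n. bdd (set (t # us)) n (Psi q t us)"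
proof -
  obtain n1 where n1: "bdd (set (t # us)) n1 (act (Vdm us) (Gam q (t # us)))" using bdd_parts(1) by blast
  obtain n2 where n2: "bdd (set (t # us)) n2 (act (Vdm us * row (1 / q) (- q) t us) (cf (Hc q us t)))"
    using bdd_parts(2) by blast
  obtain n3 where n3: "bdd (set (t # us)) n3 (\<lambda>N. \<Sum>m\<in>set us. act (interp_num q t us m) (cf (Hc q us m)) N)"
    using bdd_parts(4) by blast
  show ?thesis
    using bdd_diff[OF bdd_diff[OF n1 n2] bdd_uminus[OF n3]] unfolding Psi_def by auto
qed

text \<open>At the node \<open>t := u\<close> the antisymmetric first term vanishes, and in the sum all terms with \<open>m \<noteq> u\<close> contain the factor \<open>t - u\<close>.
  The remaining two terms cancel by the choice of the interpolation values.\<close>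

lemma diag_zero_Psi:
  assumes u: "u \<in> set us"
  shows "diag_zero t u (Psi q t us)"
proof -
  have V: "t \<in> set (t # us)" "u \<in> set (t # us)" "t \<noteq> u" using u dist' by auto
  let ?H = "\<lambda>x. diag_sum t u (cf (Hc q us x))"
  obtain n1 where n1: "bdd (set (t # us)) n1 (act (Vdm us) (Gam q (t # us)))" using bdd_parts(1) by blast
  obtain n2 where n2: "bdd (set (t # us)) n2 (act (Vdm us * row (1 / q) (- q) t us) (cf (Hc q us t)))"
    using bdd_parts(2) by blast
  obtain n3 where n3: "bdd (set (t # us)) n3 (\<lambda>N. \<Sum>m\<in>set us. act (interp_num q t us m) (cf (Hc q us m)) N)"
    using bdd_parts(4) by blast
  have "diag_sum t u (Gam q (t # us)) = (\<lambda>N. 0)"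
    using diag_zero_Gam[OF dist V q] by (simp add: diag_zero_iff_diag_sum)
  then have G: "diag_sum t u (act (Vdm us) (Gam q (t # us))) N = 0" for N
    by (simp add: diag_sum_act[OF bdd_Gam[OF dist q] V])
  have Ht: "diag_sum t u (act (Vdm us * row (1 / q) (- q) t us) (cf (Hc q us t))) = act (Vdm us * row (1 / q) (- q) u us) (?H u)"
  proof -
    have "diag_sum t u (act (Vdm us * row (1 / q) (- q) t us) (cf (Hc q us t)))
      = act (Vdm us) (act (row (1 / q) (- q) t us) (?H t))"
      unfolding diag_sum_act[OF bdd_H[OF V(1)] V] by (rule act_mult)
    also have "\<dots> = act (Vdm us * row (1 / q) (- q) u us) (?H t)"
      unfolding act_prod_diag_sum[of "1 / q" t "- q" us u] by (rule act_mult[symmetric])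
    finally show ?thesis by (simp only: diag_sum_Hc[OF dist'(1) q dist'(2) u])
  qed
  have Hm: "diag_sum t u (act (interp_num q t us m) (cf (Hc q us m))) = (if m = u then act (Vdm us * row (1 / q) (- q) u us) (?H u) else (\<lambda>N. 0))"
    if m: "m \<in> set us" for m
  proof -
    obtain E where E: "Vdm us = E * row 1 (- 1) m (filter (\<lambda>i. i \<noteq> m) us)"
      "interp_num q t us m = E * row 1 (- 1) t (filter (\<lambda>i. i \<noteq> m) us) * row (1 / q) (- q) m us"
      using interp_numE[OF dist'(1) m, of q t] by blast
    have mV: "m \<in> set (t # us)" using m by simp
    have "diag_sum t u (act (interp_num q t us m) (cf (Hc q us m)))
      = act (E * row (1 / q) (- q) m us) (act (row 1 (- 1) t (filter (\<lambda>i. i \<noteq> m) us)) (?H m))"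
      unfolding diag_sum_act[OF bdd_H[OF mV] V] E(2) act_mult[symmetric] by (simp add: ac_simps)
    also have "\<dots> = act (E * row (1 / q) (- q) m us) (act (row 1 (- 1) u (filter (\<lambda>i. i \<noteq> m) us)) (?H m))"
      by (simp only: act_prod_diag_sum[of 1 t "- 1" "filter (\<lambda>i. i \<noteq> m) us" u])
    also have "\<dots> = (if m = u then act (Vdm us * row (1 / q) (- q) u us) (?H u) else (\<lambda>N. 0))"
    proof (cases "m = u")
      case True
      then show ?thesis unfolding E(1) act_mult[symmetric] by (simp add: ac_simps)
    next
      case False
      have "row 1 (- 1) u (filter (\<lambda>i. i \<noteq> m) us) = lf 1 u (- 1) u * row 1 (- 1) u (filter (\<lambda>i. i \<noteq> u) (filter (\<lambda>i. i \<noteq> m) us))"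
        by (rule prod_list_remove) (use dist' u False in auto)
      also have "lf 1 u (- 1) u = 0" by (simp add: lf_def single_add[symmetric])
      finally show ?thesis using False by simp
    qed
    finally show ?thesis .
  qed
  have S: "diag_sum t u (\<lambda>N. \<Sum>m\<in>set us. act (interp_num q t us m) (cf (Hc q us m)) N) N
    = act (Vdm us * row (1 / q) (- q) u us) (?H u) N" for N
  proof -
    have "diag_sum t u (\<lambda>N. \<Sum>m\<in>set us. act (interp_num q t us m) (cf (Hc q us m)) N) N
      = (\<Sum>m\<in>set us. diag_sum t u (act (interp_num q t us m) (cf (Hc q us m))) N)"
      by (rule diag_sum_sum[OF _ bdd_parts(3) V]) simp_all
    also have "\<dots> = (\<Sum>m\<in>set us. if m = u then act (Vdm us * row (1 / q) (- q) u us) (?H u) N else 0)"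
      by (rule sum.cong[OF refl]) (simp add: Hm)
    finally show ?thesis using u by simp
  qed
  have "diag_sum t u (Psi q t us) N = 0" for N
    unfolding Psi_def diag_sum_add[OF bdd_diff[OF n1 n2] n3 V] diag_sum_diff[OF n1 n2 V] G Ht S by simp
  then show ?thesis by (simp add: diag_zero_iff_diag_sum fun_eq_iff)
qed

lemma pbound_row_t: "t \<notin> set ws \<Longrightarrow> pbound (\<lambda>M. lookup M t) (int (length ws)) (row x y t ws)"
proof -
  have "pbound (\<lambda>M. lookup M t) (1 * int (length (map (lf x t y) ws))) (row x y t ws)"
    by (rule pbound_prod_list) (auto intro!: pbound_mono[OF pbound_lf_lookup])
  then show ?thesis by simp
qed

lemma pbound_row_other:
  assumes "v \<noteq> t" "t \<notin> set ws"
  shows "pbound (\<lambda>M. lookup M t) 0 (row x y v ws)"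
proof -
  have "pbound (\<lambda>M. lookup M t) (0 * int (length (map (lf x v y) ws))) (row x y v ws)"
    by (rule pbound_prod_list) (use assms in \<open>auto intro!: pbound_mono[OF pbound_lf_lookup]\<close>)
  then show ?thesis by simp
qed

lemma pbound_row_lower: "pbound (\<lambda>M. - lookup M t) 0 (row x y v ws)"
proof -
  have "pbound (\<lambda>M. - lookup M t) (0 * int (length (map (lf x v y) ws))) (row x y v ws)"
    by (rule pbound_prod_list) (auto intro: pbound_lf_uminus_lookup)
  then show ?thesis by simp
qed

lemma pbound_free:
  assumes "pvars (set us) p"
  shows "pbound (\<lambda>M. lookup M t) 0 p" "pbound (\<lambda>M. - lookup M t) 0 p"
  using assms dist' by (auto simp: pvars_def pbound_def keys_subset_iff)

lemma pvars_Vdm': "pvars (set us) (Vdm us)"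
  unfolding Vdm_def by (intro pvars_pairprod pvars_lf) auto

lemma pbound_interp_num:
  assumes m: "m \<in> set us"
  shows "pbound (\<lambda>M. lookup M t) (int (length us) - 1) (interp_num q t us m)" "pbound (\<lambda>M. - lookup M t) 0 (interp_num q t us m)"
proof -
  obtain E where E: "pvars (set us) E" "interp_num q t us m = E * row 1 (- 1) t (filter (\<lambda>i. i \<noteq> m) us) * row (1 / q) (- q) m us"
    using interp_numE[OF dist'(1) m, of q t] by blast
  have "filter (\<lambda>i. i \<noteq> m) ws = ws" if "m \<notin> set ws" for ws
    using that by (auto simp: filter_id_conv)
  then have "length us = Suc (length (filter (\<lambda>i. i \<noteq> m) us))"
    using dist'(1) m by (induction us) auto
  then have len: "int (length us) - 1 = 0 + int (length (filter (\<lambda>i. i \<noteq> m) us)) + 0" by simp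
  show "pbound (\<lambda>M. lookup M t) (int (length us) - 1) (interp_num q t us m)"
    unfolding E(2) len
    by (intro pbound_mult pbound_row_t pbound_row_other pbound_free(1)[OF E(1)]) (use m dist' in auto)
  have "pbound (\<lambda>M. - lookup M t) (0 + 0 + 0) (interp_num q t us m)"
    unfolding E(2) by (intro pbound_mult pbound_row_lower pbound_free(2)[OF E(1)]) auto
  then show "pbound (\<lambda>M. - lookup M t) 0 (interp_num q t us m)" by simp
qed

lemma sbound_Psi: "sbound (\<lambda>N. lookup N t) (int (length us) - 1) (Psi q t us)"
proof -
  have "sbound (\<lambda>N. lookup N t) (int (length (t # us)) - 2) (Gam q (t # us))"
    by (rule sbound_Gam[OF dist _ q]) simp
  then have "sbound (\<lambda>N. lookup N t) (0 + (int (length (t # us)) - 2)) (act (Vdm us) (Gam q (t # us)))"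
    by (intro sbound_act pbound_free(1)[OF pvars_Vdm']) auto
  moreover have "sbound (\<lambda>N. lookup N t) (0 + int (length us) + (- 1)) (act (Vdm us * row (1 / q) (- q) t us) (cf (Hc q us t)))"
  proof (intro sbound_act pbound_mult pbound_free(1)[OF pvars_Vdm'] pbound_row_t)
    show "sbound (\<lambda>N. lookup N t) (- 1) (cf (Hc q us t))"
      unfolding sbound_def using Hc_exponent(1)[OF dist'(1) q dist'(2)] by force
  qed (use dist' in auto)
  moreover have "sbound (\<lambda>N. lookup N t) (int (length us) - 1 + 0) (act (interp_num q t us m) (cf (Hc q us m)))"
    if m: "m \<in> set us" for m
  proof (intro sbound_act pbound_interp_num(1)[OF m])
    have "m \<noteq> t" using m dist' by auto
    then show "sbound (\<lambda>N. lookup N t) 0 (cf (Hc q us m))"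
      unfolding sbound_def using Hc_exponent(2)[OF dist'(1) q dist'(2)] by force
  qed auto
  ultimately show ?thesis
    unfolding Psi_def by (intro sbound_add sbound_diff sbound_sum) simp_all
qed

text \<open>Up to a polynomial factor the first two terms combine to the part of \<open>f(t)\<close> with nonnegative exponents
  of \<open>t\<close>; the interpolation terms are polynomials in \<open>t\<close>.\<close>

lemma sbound_Psi_lower: "sbound (\<lambda>N. - lookup N t) 0 (Psi q t us)"
proof -
  let ?B = "row (1 / q) (- q) t us"
  let ?R = "\<lambda>N. Theta q us t N - cf (Hc q us t) N"
  have "sbound (\<lambda>N. - lookup N t) 0 ?R"
    unfolding sbound_def
  proof (intro allI impI)
    fix N assume "?R N \<noteq> 0"
    then have "\<not> lookup N t < 0" using Hc_eq_Theta[OF dist'(1) q dist'(2), of N] by auto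
    then show "- lookup N t \<le> 0" by simp
  qed
  then have "sbound (\<lambda>N. - lookup N t) (0 + 0 + 0) (act (Vdm us * ?B) ?R)"
    by (intro sbound_act pbound_mult pbound_free(2)[OF pvars_Vdm'] pbound_row_lower) auto
  moreover have "act (Vdm us * ?B) ?R = (\<lambda>N. act (Vdm us) (Gam q (t # us)) N - act (Vdm us * ?B) (cf (Hc q us t)) N)"
    unfolding Gam_Cons_Theta[OF dist q] act_mult[symmetric] by (simp add: fun_eq_iff act_fun_diff)
  ultimately have 1: "sbound (\<lambda>N. - lookup N t) 0
      (\<lambda>N. act (Vdm us) (Gam q (t # us)) N - act (Vdm us * ?B) (cf (Hc q us t)) N)" by simp
  have 2: "sbound (\<lambda>N. - lookup N t) (0 + 0) (act (interp_num q t us m) (cf (Hc q us m)))"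
    if m: "m \<in> set us" for m
  proof (intro sbound_act pbound_interp_num(2)[OF m])
    have "m \<noteq> t" using m dist' by auto
    then show "sbound (\<lambda>N. - lookup N t) 0 (cf (Hc q us m))"
      unfolding sbound_def using Hc_exponent(2)[OF dist'(1) q dist'(2)] by force
  qed auto
  show ?thesis
    unfolding Psi_def by (intro sbound_add 1 sbound_sum) (use 2 in simp)
qed

text \<open>A polynomial in \<open>t\<close> of degree less than the number of its roots \<open>us\<close>: the quotient by the product of the
  \<open>t - u\<close> would have exponents of \<open>t\<close> both negative and nonnegative.\<close>

lemma Psi_zero: "Psi q t us = (\<lambda>N. 0)"
proof -
  obtain n where n: "bdd (set (t # us)) n (Psi q t us)" using bdd_Psi by blast
  have n': "bdd (set (t # us)) (n(t := int (length us) - 1)) (Psi q t us)"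
    using n sbound_Psi by (auto simp: bdd_def)
  obtain B where B: "act (row 1 (- 1) t us) B = Psi q t us"
    "bdd (set (t # us)) (\<lambda>w. (n(t := int (length us) - 1)) w - (if w = t then int (length us) else if w \<in> set us then 1 else 0)) B"
    "sbound (\<lambda>N. - lookup N t) 0 B"
    using divide_by_row[OF dist order_refl n'] diag_zero_Psi sbound_Psi_lower by blast
  have "B N = 0" for N
  proof (rule ccontr)
    assume N: "B N \<noteq> 0"
    from bddD(2)[OF B(2) N, of t] have "lookup N t \<le> - 1" by simp
    moreover have "- lookup N t \<le> 0" using B(3) N unfolding sbound_def by blast
    ultimately show False by simp
  qed
  then have "B = (\<lambda>N. 0)" by auto
  then show ?thesis using B(1) by simp
qed

end

lemma prod_list_map_mult:
  fixes f g :: "'a \<Rightarrow> 'b::comm_monoid_mult"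
  shows "prod_list (map (\<lambda>i. f i * g i) xs) = prod_list (map f xs) * prod_list (map g xs)"
  by (induction xs) (simp_all add: ac_simps)

text \<open>Multiplication by the two products clears exactly the denominators of \<open>\<phi>\<close>.\<close>

lemma Vdm_row_phi_series:
  assumes "distinct (s # ss)" "m \<in> set ss" "q \<noteq> 0"
  defines "us \<equiv> map T ss"
  shows "emb (Vdm us) * (emb (row (1 / q) (- q) (T s) us) * phi_series q m s ss) = emb (interp_num q (T s) us (T m))"
proof -
  let ?fl = "map T (filter (\<lambda>i. i \<noteq> m) ss)"
  let ?R = "\<lambda>x v y ws. inv_row x y v ws"
  have fl: "filter (\<lambda>i. i \<noteq> T m) us = ?fl"
    by (simp add: us_def filter_map comp_def)
  have dus: "distinct us" and mus: "T m \<in> set us"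
    using assms by (auto simp: us_def distinct_map inj_on_def)
  obtain E where E: "Vdm us = E * row 1 (- 1) (T m) ?fl"
    "interp_num q (T s) us (T m) = E * row 1 (- 1) (T s) ?fl * row (1 / q) (- q) (T m) us"
    using interp_numE[OF dus mus, of q "T s"] unfolding fl by blast
  have phi_series: "phi_series q m s ss = emb (row 1 (- 1) (T s) ?fl) * ?R 1 (T m) (- 1) ?fl
    * (emb (row (1 / q) (- q) (T m) us) * ?R (1 / q) (T s) (- q) us)"
    by (simp add: phi_series_def prod_list_map_mult emb_prod_list us_def comp_def)
  have 1: "emb (row 1 (- 1) (T m) ?fl) * ?R 1 (T m) (- 1) ?fl = 1"
    by (rule row_inverse) auto
  have 2: "emb (row (1 / q) (- q) (T s) us) * ?R (1 / q) (T s) (- q) us = 1"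
    by (rule row_inverse) (use assms in auto)
  have "emb (Vdm us) * (emb (row (1 / q) (- q) (T s) us) * phi_series q m s ss)
    = emb (interp_num q (T s) us (T m)) * (emb (row 1 (- 1) (T m) ?fl) * ?R 1 (T m) (- 1) ?fl)
      * (emb (row (1 / q) (- q) (T s) us) * ?R (1 / q) (T s) (- q) us)"
    unfolding E phi_series emb_mult by (simp only: ac_simps)
  then show ?thesis unfolding 1 2 by simp
qed

lemma nfs_0 [simp]: "nfs q 0 = 0"
  by (rule cseries_eqI) (simp add: cf_nfs)

lemma nfs_add: "nfs q (A + B) = nfs q A + nfs q B"
  by (rule cseries_eqI) (simp add: cf_nfs nf_add)

lemma nfs_mult_sum_list:
  "nfs q (A * (\<Sum>m\<leftarrow>ms. sc (c m) * B m)) = (\<Sum>m\<leftarrow>ms. sc (c m) * nfs q (A * B m))"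
  by (induction ms) (simp_all add: distrib_left nfs_add sc_left_commute[of A] nfs_sc_mult)

text \<open>The interpolation identity with its denominators put back. This is where the shifted currents \<open>f\<^sup>+(t; t\<^sub>1, \<dots>)\<close> arise.\<close>

lemma Gamc_step:
  assumes "distinct (s # ss)" "q \<noteq> 0"
  shows "Gamc q (map T (s # ss)) = sc (emb (row (1 / q) (- q) (T s) (map T ss))) * nfs q (Gamc q (map T ss) * fp_shifted q s ss)"
proof -
  let ?us = "map T ss" and ?t = "T s"
  let ?B = "row (1 / q) (- q) ?t ?us" and ?V = "emb (Vdm ?us)"
  have dist: "distinct (?t # ?us)" using assms by (auto simp: distinct_map inj_on_def)
  have dus: "distinct ?us" using dist by simp
  have eq: "sc ?V * (sc (emb ?B) * nfs q (Gamc q ?us * fp_shifted q s ss)) = sc ?V * Gamc q (?t # ?us)"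
  proof (rule cseries_eqI)
    fix N
    have "nfs q (Gamc q ?us * fp_shifted q s ss) = Hc q ?us ?t - (\<Sum>m\<leftarrow>ss. sc (phi_series q m s ss) * Hc q ?us (T m))"
      by (simp add: fp_shifted_def right_diff_distrib nfs_diff nfs_mult_sum_list Hc_def)
    then have "sc ?V * (sc (emb ?B) * nfs q (Gamc q ?us * fp_shifted q s ss))
      = sc (emb (Vdm ?us * ?B)) * Hc q ?us ?t - (\<Sum>m\<leftarrow>ss. sc (?V * (emb ?B * phi_series q m s ss)) * Hc q ?us (T m))"
      by (simp add: right_diff_distrib sum_list_const_mult[symmetric] sc_mult emb_mult mult.assoc)
    also have "(\<Sum>m\<leftarrow>ss. sc (?V * (emb ?B * phi_series q m s ss)) * Hc q ?us (T m))
      = (\<Sum>m\<leftarrow>ss. sc (emb (interp_num q ?t ?us (T m))) * Hc q ?us (T m))"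
      by (rule arg_cong[of _ _ sum_list], rule map_cong[OF refl]) (use Vdm_row_phi_series[OF assms(1) _ assms(2)] in auto)
    finally have "cf (sc ?V * (sc (emb ?B) * nfs q (Gamc q ?us * fp_shifted q s ss))) N
      = act (Vdm ?us * ?B) (cf (Hc q ?us ?t)) N - (\<Sum>m\<leftarrow>ss. act (interp_num q ?t ?us (T m)) (cf (Hc q ?us (T m))) N)"
      by (simp add: cf_sum_list cf_sc_emb_mult comp_def)
    also have "(\<Sum>m\<leftarrow>ss. act (interp_num q ?t ?us (T m)) (cf (Hc q ?us (T m))) N)
      = (\<Sum>u\<in>set ?us. act (interp_num q ?t ?us u) (cf (Hc q ?us u)) N)"
      using sum_list_distinct_conv_sum_set[OF dus, of "\<lambda>u. act (interp_num q ?t ?us u) (cf (Hc q ?us u)) N"]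
      by (simp add: comp_def)
    also have "act (Vdm ?us * ?B) (cf (Hc q ?us ?t)) N - \<dots> = act (Vdm ?us) (Gam q (?t # ?us)) N"
      using fun_cong[OF Psi_zero[OF dist assms(2)], of N] unfolding Psi_def by (simp add: algebra_simps)
    also have "\<dots> = cf (sc ?V * Gamc q (?t # ?us)) N"
      by (simp add: cf_sc_emb_mult cf_Gamc[OF dist assms(2)])
    finally show "cf (sc ?V * (sc (emb ?B) * nfs q (Gamc q ?us * fp_shifted q s ss))) N = cf (sc ?V * Gamc q (?t # ?us)) N" .
  qed
  obtain V' where "V' * ?V = 1"
    using emb_pairprod_inverse[OF dus, of 1 "- 1"] unfolding Vdm_def by (auto simp: mult.commute)
  then have "sc V' * (sc ?V * A) = A" for A
    by (simp only: mult.assoc[symmetric] sc_mult[symmetric] sc_1 mult_1_left)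
  then have "sc (emb ?B) * nfs q (Gamc q ?us * fp_shifted q s ss) = Gamc q (?t # ?us)"
    using eq by metis
  then show ?thesis by simp
qed

primrec shifted_prod :: "complex \<Rightarrow> nat list \<Rightarrow> falg cseries" where
  "shifted_prod q [] = 1"
| "shifted_prod q (s # ss) = shifted_prod q ss * fp_shifted q s ss"

lemma shifted_prod_upt: "prod_list (map (\<lambda>i. fp_shifted q i [i + 1..<n]) (rev [m..<n])) = shifted_prod q [m..<n]"
proof (induction "n - m" arbitrary: m)
  case (Suc k)
  then have "m < n" "k = n - Suc m" by auto
  then show ?case using Suc(1)[of "Suc m"] by (simp add: upt_conv_Cons)
qed simp

lemma pos_fp_shifted: "pos (fp_shifted q s ss)"
  unfolding fp_shifted_def by (intro pos_diff pos_fp pos_sum_list) (auto intro: pos_mult pos_sc pos_fp)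

lemma pos_shifted_prod: "pos (shifted_prod q ss)"
  by (induction ss) (auto intro: pos_1 pos_mult pos_fp_shifted)

abbreviation Dop :: "complex \<Rightarrow> var list \<Rightarrow> lpoly" where
  "Dop q vs \<equiv> pairprod (\<lambda>u v. lf (1 / q) u (- q) v) vs"

text \<open>Each new variable is the largest one and contributes one factor on the right; reduction modulo \<open>J\<close> passes through
  multiplication by it.\<close>

lemma nfs_shifted_prod:
  assumes "distinct ss" "q \<noteq> 0"
  shows "nfs q (sc (emb (Dop q (map T ss))) * shifted_prod q ss) = Gamc q (map T ss)"
  using assms(1)
proof (induction ss)
  case Nil
  show ?case
    by (rule cseries_eqI)
      (auto simp: cf_nfs cf_one cf_Gamc[OF _ assms(2)] Gam_def D_def Phi_def cur_def)
next
  case (Cons s ss)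
  let ?B = "row (1 / q) (- q) (T s) (map T ss)"
  have fw: "cf (fp_shifted q s ss) N \<in> fwords" for N
    using pos_fp_shifted[of q s ss] fwords_pos_subset by (auto simp: pos_def)
  have "nfs q (sc (emb (Dop q (map T (s # ss)))) * shifted_prod q (s # ss))
    = sc (emb ?B) * nfs q ((sc (emb (Dop q (map T ss))) * shifted_prod q ss) * fp_shifted q s ss)"
    by (simp add: nfs_sc_mult[symmetric] emb_mult sc_mult mult.assoc)
  also have "\<dots> = sc (emb ?B) * nfs q (nfs q (sc (emb (Dop q (map T ss))) * shifted_prod q ss) * fp_shifted q s ss)"
    by (simp only: nfs_nfs_mult[OF fw])
  also have "\<dots> = Gamc q (map T (s # ss))"
    using Cons by (simp only: Gamc_step[OF Cons.prems assms(2)]) simp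
  finally show ?case .
qed

lemma rhs1_eq: "rhs1 q a = sc (pairprod (\<lambda>u v. lf_inv q u (- 1 / q) v) (tvars a)) * (sc (emb (Dop q (tvars a))) * shifted_prod q [1..<a + 1])"
  unfolding rhs1_def shifted_prod_upt emb_pairprod[symmetric] mult.assoc[symmetric] sc_mult[symmetric]
  by (simp only: mult.commute)

lemma nfs_rhs1:
  assumes "q \<noteq> 0"
  shows "nfs q (rhs1 q a) = Phic q (tvars a)"
  unfolding rhs1_eq nfs_sc_mult[of q "pairprod (\<lambda>u v. lf_inv q u (- 1 / q) v) (tvars a)"]
    nfs_shifted_prod[OF distinct_upt assms] Phic_eq[OF chain_tvars assms] ..

lemma pos_rhs1: "pos (rhs1 q a)"
  unfolding rhs1_eq by (intro pos_mult pos_sc pos_shifted_prod)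

theorem theorem3:
  fixes q :: complex and a :: nat and P :: "falg set \<Rightarrow> falg set"
  assumes "q \<noteq> 0" and "\<And>n::nat. n > 0 \<Longrightarrow> q ^ n \<noteq> 1"
    and "a \<ge> 1"
    and "is_projection q P"
  shows "(\<forall>N. P (cls q (current_product a N)) = cls q (weight_rhs1 q a N)) \<and>
         (\<forall>N. P (cls q (current_product a N)) = cls q (weight_rhs2 q a N))"
  using projection_current_product[OF assms(1,4) pos_rhs1 nfs_rhs1[OF assms(1)]]
    projection_current_product[OF assms(1,4) pos_rhs2 nfs_rhs2[OF assms(1)]]
  by (simp add: weight_rhs1_cf weight_rhs2_cf)

end
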